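(* For every $n\ge 1$ there is a constant $c_n>0$ depending only on $n$ such that the following holds. Let $0<\delta<1$ and $\beta>0$, let $1\le p<\frac n\delta\min\{1,\beta\}$, and let $\mu$ be any non-negative Borel measure on $\mathbb{R}^n$ such that $M_{n-\frac{p\delta}{\beta}}(\mu)$ is finite almost everywhere. Then, for any $u\in L^1_{\mathrm{loc}}(\mathbb{R}^n)$ and any cube $Q$ in $\mathbb{R}^n$, $$\inf_{c\in\mathbb{R}}\left(\int_Q|u(x)-c|^p\,\big(M_{n-\frac{p\delta}{\beta}}(\mu)(x)\big)^{\beta}\,dx\right)^{\frac1p}\le c_n^{\beta+1}\,(1-\delta)^{\frac1p}\,\frac{p}{(n-\delta p)^{1+\frac1p}}\,\mu(\mathbb{R}^n)^{\frac\beta p}\left(\int_Q\int_Q\frac{|u(x)-u(y)|^p}{|x-y|^{n+\delta p}}\,dy\,dx\right)^{\frac1p}.$$ In particular, choosing $\beta=1$ and $\mu$ the Dirac mass at the origin (so $1\le p<\frac n\delta$), $$\inf_{c\in\mathbb{R}}\left(\int_Q|u(x)-c|^p\,\frac{1}{|x|^{\delta p}}\,dx\right)^{\frac1p}\le c_n\,(1-\delta)^{\frac1p}\,\frac{p}{(n-\delta p)^{1+\frac1p}}\left(\int_Q\int_Q\frac{|u(x)-u(y)|^p}{|x-y|^{n+\delta p}}\,dy\,dx\right)^{\frac1p}$$ (with a possibly different constant $c_n$ depending only on $n$).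
   Context: A cube in $\mathbb{R}^n$ is a cartesian product of $n$ intervals of the same side length $\ell(Q)$. For $\alpha\ge0$ and a non-negative Borel measure $\mu$, the fractional maximal function is $M_\alpha\mu(x)=\sup_{R\ni x}\ell(R)^\alpha\frac{\mu(R)}{|R|}$, the supremum over all cubes $R$ in $\mathbb{R}^n$ containing $x$. *)

theory Defs
  imports "HOL-Analysis.Analysis"
begin

text \<open>A cube of side length \<open>l\<close>. Each factor is an interval with end points \<open>a i\<close> and \<open>a i + l\<close>
  that may or may not contain either of them. Cubes are non-degenerate.\<close>

definition cube_of_side :: "real \<Rightarrow> (real ^ 'n) set \<Rightarrow> bool" where
  "cube_of_side l Q \<longleftrightarrow> l > 0 \<and>
     (\<exists>a I. (\<forall>i. {a i<..<a i + l} \<subseteq> I i \<and> I i \<subseteq> {a i..a i + l}) \<and> Q = {x. \<forall>i. x $ i \<in> I i})"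

definition is_cube :: "(real ^ 'n) set \<Rightarrow> bool" where
  "is_cube Q \<longleftrightarrow> (\<exists>l. cube_of_side l Q)"

definition frac_maximal :: "real \<Rightarrow> (real ^ 'n) measure \<Rightarrow> real ^ 'n \<Rightarrow> ennreal" where
  "frac_maximal \<alpha> \<mu> x =
     (SUP (l, R) \<in> {(l, R). cube_of_side l R \<and> x \<in> R}.
        ennreal (l powr \<alpha>) * (emeasure \<mu> R / emeasure lborel R))"

text \<open>Real powers of extended non-negative reals. The clause for \<open>\<infinity>\<close> is the usual one only for
  positive exponents, and no others are used.\<close>

definition ennreal_powr :: "ennreal \<Rightarrow> real \<Rightarrow> ennreal" where
  "ennreal_powr t r = (if t = \<infinity> then \<infinity> else ennreal (enn2real t powr r))"

text \<open>Absolute integrability on a set includes Lebesgue measurability there.\<close>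

definition L1_loc :: "(real ^ 'n \<Rightarrow> real) \<Rightarrow> bool" where
  "L1_loc u \<longleftrightarrow> (\<forall>K. compact K \<longrightarrow> u absolutely_integrable_on K)"

text \<open>The double integral on the right-hand side, possibly infinite. On the diagonal, which does
  not contribute, the integrand is \<open>0 / 0 = 0\<close>.\<close>

definition frac_energy :: "real \<Rightarrow> real \<Rightarrow> (real ^ 'n \<Rightarrow> real) \<Rightarrow> (real ^ 'n) set \<Rightarrow> ennreal" where
  "frac_energy \<delta> p u Q =
     (\<integral>\<^sup>+x\<in>Q. (\<integral>\<^sup>+y\<in>Q. ennreal (\<bar>u x - u y\<bar> powr p / norm (x - y) powr (real CARD('n) + \<delta> * p))
        \<partial>lebesgue) \<partial>lebesgue)"

end

theory Submission
  imports Defs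
begin

text \<open>Let \<open>n\<close> be the dimension and put \<open>s = \<delta> p\<close>, \<open>\<epsilon> = n - s\<close>. Since \<open>l(R)\<^sup>\<alpha> / |R| = l(R) powr (- s / \<beta>)\<close> for
  \<open>\<alpha> = n - s / \<beta>\<close>, the weight in the theorem is the supremum of \<open>\<mu>(R) powr \<beta> * l(R) powr (- s)\<close> over the
  cubes \<open>R\<close> through the point. Up to a factor depending on \<open>n\<close> it lies below the same supremum \<open>w\<close> over
  centred balls (\<open>frac_maximal_le_ball_weight\<close>), which is lower semicontinuous. The condition on \<open>p\<close> says
  \<open>s < n\<close> and \<open>s < \<beta> n\<close>; then a Vitali covering gives a weak type estimate for the small balls
  (\<open>weak_type\<close>), and two properties of \<open>w\<close> follow. On a cube of side \<open>r\<close> the integral of \<open>w\<close> is at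
  most \<open>C / \<epsilon> * \<mu>(UNIV) powr \<beta> * r powr \<epsilon>\<close>, and the mean of \<open>w\<close> is at most \<open>C / \<epsilon>\<close> times its infimum
  there. By the second one, a set that fills half of a cube carries at least a proportion \<open>\<sigma>\<close> of its
  weight, where \<open>\<sigma>\<close> is a multiple of \<open>\<epsilon>\<close> (\<open>dyadic_weight_ball_weight\<close>).

  Without a weight, the factor \<open>1 - \<delta>\<close> has a simple source. On a convex set, comparing \<open>x\<close> and \<open>y\<close> with
  their midpoint shows that the differences of \<open>u\<close> at distance up to \<open>2 t\<close> are controlled, with the exact
  factor \<open>2 powr (p + n)\<close>, by those at distance up to \<open>t\<close>. So the energy at scale \<open>2 powr (- k)\<close> decays at
  most like \<open>2 powr (- k p (1 - \<delta>))\<close>, and the sum over all scales exceeds the term of the coarsest scale by a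
  factor of order \<open>1 / (p (1 - \<delta>))\<close> (\<open>poincare_convex\<close>).

  The two ingredients have to be combined without adding the energies of nested cubes, in which the same
  pairs of points would be counted again and again. So the values of the function are cut, not the domain. Let \<open>c\<close> be a median of
  \<open>u\<close> on \<open>Q\<close>, and let \<open>f\<close> be \<open>max (u - c) 0\<close> or \<open>max (c - u) 0\<close>. Take levels \<open>b k = b 0 * \<theta> ^ k\<close> with
  \<open>\<theta> = 1 + \<sigma> / (4 p)\<close>, and let \<open>H k\<close> be the union of the dyadic cubes that \<open>{f > b k}\<close> fills by more than
  one half. Consider a maximal cube of \<open>H k\<close> and its parent. If \<open>{f > b (k + 1)}\<close> occupies a fixed
  proportion of the parent, then the part of \<open>f\<close> with values between the two levels oscillates on the
  parent, and the Poincare inequality bounds the weight of the parent by the energy of that part; the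
  maximal parents of this kind are disjoint. Otherwise \<open>H (k + 1)\<close> covers at most half of the cube, and a
  proportion \<open>\<sigma>\<close> of the weight is lost. Hence \<open>w(H (k + 1))\<close> is at most \<open>(1 - \<sigma>) w(H k)\<close> plus a multiple
  of the energy of one slice of \<open>f\<close> (\<open>heavy_step\<close>, \<open>weight_transition\<close>).

  Summed against \<open>b k powr p\<close> this recursion converges because \<open>\<theta> powr p * (1 - \<sigma>) \<le> 1 - \<sigma> / 2\<close>, and the
  energies of all slices together do not exceed that of \<open>f\<close>. The ratio of a level to the height of its
  slice is at most \<open>8 p / \<sigma>\<close>, which gives \<open>(p / \<epsilon>) powr p\<close>; the loss of \<open>2 / \<sigma>\<close> in the summation is
  compensated by the factor \<open>\<theta> powr p - 1 \<le> \<sigma> / 2\<close> of the layer cake formula. One more factor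
  \<open>1 / \<epsilon>\<close> comes from the bound for the weight of a cube, so the constant is
  \<open>C powr p * (1 - \<delta>) * p powr p / \<epsilon> powr (p + 1)\<close> before the root is taken. The inequality for
  \<open>1 / |x| powr (\<delta> p)\<close> is the case \<open>\<beta> = 1\<close> with a unit point mass at the origin.\<close>

section \<open>Preliminaries on extended reals and measures\<close>

lemma ennreal_powr_mono: "0 < r \<Longrightarrow> x \<le> y \<Longrightarrow> ennreal_powr x r \<le> ennreal_powr y r"
  unfolding ennreal_powr_def
  by (cases x; cases y) (auto intro!: ennreal_leI powr_mono2 simp: top_unique)

lemma ennreal_powr_mult: "0 < r \<Longrightarrow> ennreal_powr (x * y) r = ennreal_powr x r * ennreal_powr y r"
  unfolding ennreal_powr_def
  by (cases x; cases y) (auto simp: ennreal_mult[symmetric] powr_mult ennreal_mult_top ennreal_top_mult enn2real_mult top_unique)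

lemma ennreal_powr_ennreal: "0 \<le> x \<Longrightarrow> ennreal_powr (ennreal x) r = ennreal (x powr r)"
  by (simp add: ennreal_powr_def)

lemma ennreal_powr_powr: "0 < r \<Longrightarrow> ennreal_powr (ennreal_powr x r) q = ennreal_powr x (r * q)"
  by (cases x) (auto simp: ennreal_powr_def powr_powr)

lemma ennreal_mult_le_cancel:
  fixes x y :: ennreal and c :: real
  assumes "0 < c" "ennreal c * x \<le> ennreal c * y"
  shows "x \<le> y"
proof -
  have "ennreal (1/c) * (ennreal c * x) \<le> ennreal (1/c) * (ennreal c * y)"
    by (intro mult_left_mono assms(2)) auto
  then show ?thesis
    using assms(1) by (simp add: mult.assoc[symmetric] ennreal_mult[symmetric])
qed

text \<open>This is how estimates on single cubes are added up. In the applications \<open>M\<close> and \<open>N\<close> are Lebesgue measure,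
  a weight, or an energy regarded as a measure in one of its two variables.\<close>

lemma emeasure_le_on_pieces:
  assumes F: "countable F" "disjoint F" and sets: "sets M = sets N"
    and S: "S \<in> sets M" "T \<in> sets M" "\<And>D. D \<in> F \<Longrightarrow> D \<in> sets M"
    and le: "\<And>D. D \<in> F \<Longrightarrow> emeasure M (D \<inter> S) \<le> c * emeasure N (D \<inter> T)"
  shows "emeasure M (\<Union>F \<inter> S) \<le> c * emeasure N (\<Union>F \<inter> T)"
proof -
  have *: "emeasure L (\<Union>F \<inter> Y) = (\<integral>\<^sup>+D. emeasure L (D \<inter> Y) \<partial>count_space F)" 
    if "sets L = sets M" "Y \<in> sets M" for L Y
  proof -
    have "\<Union>F \<inter> Y = (\<Union>D\<in>F. D \<inter> Y)" by auto
    also have "emeasure L \<dots> = (\<integral>\<^sup>+D. emeasure L (D \<inter> Y) \<partial>count_space F)"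
      using F S that by (intro emeasure_UN_countable) (auto simp: disjoint_family_on_def disjoint_def)
    finally show ?thesis .
  qed
  have "emeasure M (\<Union>F \<inter> S) \<le> (\<integral>\<^sup>+D. c * emeasure N (D \<inter> T) \<partial>count_space F)"
    using S by (subst *) (auto intro!: nn_integral_mono le)
  also have "\<dots> = c * emeasure N (\<Union>F \<inter> T)"
    using sets S by (subst *) (auto simp: nn_integral_cmult)
  finally show ?thesis .
qed

lemma emeasure_UN_countable_le:
  assumes X: "\<And>i. i \<in> I \<Longrightarrow> X i \<in> sets M" and I: "countable I"
  shows "emeasure M (\<Union>(X ` I)) \<le> (\<integral>\<^sup>+i. emeasure M (X i) \<partial>count_space I)"
proof -
  have pt: "indicator (\<Union>(X ` I)) x \<le> (\<integral>\<^sup>+i. indicator (X i) x \<partial>count_space I :: ennreal)" for x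
  proof (cases "x \<in> \<Union>(X ` I)")
    case True
    then obtain j where j: "x \<in> X j" "j \<in> I" by auto
    have "(1 :: ennreal) = (\<integral>\<^sup>+i. indicator {j} i \<partial>count_space I)"
      using j by (subst nn_integral_indicator) auto
    also have "\<dots> \<le> (\<integral>\<^sup>+i. indicator (X i) x \<partial>count_space I)"
      using j by (intro nn_integral_mono) (auto simp: indicator_def)
    finally show ?thesis by (simp add: indicator_def)
  qed simp
  have "\<Union>(X ` I) \<in> sets M" using X I by (intro sets.countable_UN') auto
  then have "emeasure M (\<Union>(X ` I)) = (\<integral>\<^sup>+x. indicator (\<Union>(X ` I)) x \<partial>M)" by simp
  also have "\<dots> \<le> (\<integral>\<^sup>+x. \<integral>\<^sup>+i. indicator (X i) x \<partial>count_space I \<partial>M)" by (intro nn_integral_mono pt)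
  also have "\<dots> = (\<integral>\<^sup>+i. \<integral>\<^sup>+x. indicator (X i) x \<partial>M \<partial>count_space I)"
    using X I by (subst nn_integral_count_space_nn_integral) auto
  also have "\<dots> = (\<integral>\<^sup>+i. emeasure M (X i) \<partial>count_space I)"
    using X by (intro nn_integral_cong) simp
  finally show ?thesis .
qed

lemma ball_subset_ballI:
  fixes x y :: "'a::metric_space"
  assumes "dist x y + r \<le> R"
  shows "ball x r \<subseteq> ball y R"
proof
  fix w assume "w \<in> ball x r"
  then show "w \<in> ball y R" using dist_triangle[of y w x] assms by (simp add: dist_commute)
qed

section \<open>The Poincare inequality on convex sets\<close>

text \<open>The inner integral of the fractional energy, with \<open>s\<close> in place of \<open>\<delta> p\<close>. As a function of \<open>x\<close> it is
  the density of a measure, so the energies of disjoint cubes can be added like measures.\<close>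

definition energy_density :: "real \<Rightarrow> real \<Rightarrow> (real ^ 'n \<Rightarrow> real) \<Rightarrow> (real ^ 'n) set \<Rightarrow> real ^ 'n \<Rightarrow> ennreal" where
  "energy_density s p g P x =
     (\<integral>\<^sup>+y\<in>P. ennreal (\<bar>g x - g y\<bar> powr p / norm (x - y) powr (real CARD('n) + s)) \<partial>lborel)"

lemma energy_density_measurable [measurable]:
  assumes [measurable]: "g \<in> borel_measurable borel" "P \<in> sets borel"
  shows "energy_density s p g P \<in> borel_measurable borel"
  unfolding energy_density_def by measurable

lemma energy_density_mono: "P \<subseteq> P' \<Longrightarrow> energy_density s p g P x \<le> energy_density s p g P' x"
  unfolding energy_density_def
  by (intro nn_integral_mono) (auto split: split_indicator)

lemma powr_add_le_two_powr:
  fixes a b p :: real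
  assumes "0 \<le> a" "0 \<le> b" "1 \<le> p"
  shows "(a + b) powr p \<le> 2 powr (p - 1) * (a powr p + b powr p)"
proof (cases "a = 0 \<or> b = 0")
  case True
  have "1 * (a + b) powr p \<le> 2 powr (p - 1) * (a + b) powr p"
    using assms by (intro mult_right_mono ge_one_powr_ge_zero) auto
  with True show ?thesis using assms by auto
next
  case False
  have "convex_on {0<..} (\<lambda>x. x powr p)"
    using assms by (simp add: powr_convex)
  from convex_onD[OF this, of "1/2" a b] assms False
  have "((a + b) / 2) powr p \<le> (a powr p + b powr p) / 2"
    by (simp add: field_simps)
  moreover have "((a + b) / 2) powr p = (a + b) powr p / 2 powr p"
    using assms by (simp add: powr_divide)
  ultimately show ?thesis
    using assms by (simp add: powr_diff field_simps)
qed

definition near_diff :: "real \<Rightarrow> (real ^ 'n \<Rightarrow> real) \<Rightarrow> (real ^ 'n) set \<Rightarrow> real \<Rightarrow> ennreal" where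
  "near_diff p g P t =
     (\<integral>\<^sup>+x. \<integral>\<^sup>+y. ennreal (if x \<in> P \<and> y \<in> P \<and> norm (x - y) \<le> t then \<bar>g x - g y\<bar> powr p else 0)
        \<partial>lborel \<partial>lborel)"

lemma nn_integral_midpoint:
  fixes x :: "real ^ 'n" and H :: "real ^ 'n \<Rightarrow> ennreal"
  assumes [measurable]: "H \<in> borel_measurable borel"
  shows "(\<integral>\<^sup>+y. H ((1/2) *\<^sub>R (x + y)) \<partial>lborel) = 2 ^ CARD('n) * (\<integral>\<^sup>+z. H z \<partial>lborel)"
proof -
  have "(\<integral>\<^sup>+y. H ((1/2) *\<^sub>R (x + y)) \<partial>lborel)
     = (\<integral>\<^sup>+y. H ((1/2) *\<^sub>R (x + y)) \<partial>density (distr lborel borel (\<lambda>z. - x + 2 *\<^sub>R z)) (\<lambda>_. ennreal (\<bar>2\<bar> ^ DIM(real^'n))))"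
    by (subst lborel_affine[of 2 "-x"]) auto
  also have "\<dots> = (\<integral>\<^sup>+z. 2 ^ CARD('n) * H z \<partial>lborel)"
    by (subst nn_integral_density; (subst nn_integral_distr)?)
       (auto simp: scaleR_right.add ennreal_power[symmetric] scaleR_add_left[symmetric])
  finally show ?thesis by (simp add: nn_integral_cmult)
qed

text \<open>Through the midpoint, a pair at distance at most \<open>2 t\<close> is replaced by two pairs at distance at most \<open>t\<close>.
  The convexity of the power gives \<open>2 powr (p - 1)\<close>, the two halves contribute equally, and the change of
  variables from \<open>y\<close> to the midpoint costs \<open>2 ^ n\<close>. The factor has to be exactly \<open>2 powr (p + n)\<close>, since it
  is iterated over all scales.\<close>

lemma near_diff_double:
  fixes g :: "real ^ 'n \<Rightarrow> real"
  assumes g [measurable]: "g \<in> borel_measurable borel" and P [measurable]: "P \<in> sets borel"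
    and cv: "convex P" and p: "1 \<le> p"
  shows "near_diff p g P (2 * t) \<le> ennreal (2 powr (p + real CARD('n))) * near_diff p g P t"
proof -
  define h where "h x y = ennreal (if x \<in> P \<and> y \<in> P \<and> norm (x - y) \<le> t then \<bar>g x - g y\<bar> powr p else 0)"
    for x y :: "real^'n"
  define m where "m x y = (1/2) *\<^sub>R (x + y)" for x y :: "real^'n"
  have [measurable]: "(\<lambda>(x, y). h x y) \<in> borel_measurable (borel \<Otimes>\<^sub>M borel)"
    unfolding h_def by measurable
  have [measurable]: "(\<lambda>(x, y). m x y) \<in> borel_measurable (borel \<Otimes>\<^sub>M borel)"
    unfolding m_def by measurable
  have T: "near_diff p g P t = (\<integral>\<^sup>+x. \<integral>\<^sup>+y. h x y \<partial>lborel \<partial>lborel)"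
    by (simp add: near_diff_def h_def)
  have pt: "ennreal (if x \<in> P \<and> y \<in> P \<and> norm (x - y) \<le> 2 * t then \<bar>g x - g y\<bar> powr p else 0)
        \<le> ennreal (2 powr (p - 1)) * (h x (m x y) + h y (m y x))" for x y
  proof (cases "x \<in> P \<and> y \<in> P \<and> norm (x - y) \<le> 2 * t")
    case True
    have mm: "m y x = m x y" by (simp add: m_def add.commute)
    have mP: "m x y \<in> P"
      using convexD[OF cv, of x y "1/2" "1/2"] True by (simp add: m_def scaleR_right.add)
    have "x - m x y = (1/2) *\<^sub>R (x - y)" "y - m x y = (1/2) *\<^sub>R (y - x)"
      by (simp_all add: m_def vec_eq_iff field_simps)
    then have n: "norm (x - m x y) \<le> t" "norm (y - m x y) \<le> t"
      using True by (simp_all add: norm_minus_commute)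
    have "\<bar>g x - g y\<bar> powr p \<le> (\<bar>g x - g (m x y)\<bar> + \<bar>g y - g (m x y)\<bar>) powr p"
      using p by (intro powr_mono2) auto
    also have "\<dots> \<le> 2 powr (p - 1) * (\<bar>g x - g (m x y)\<bar> powr p + \<bar>g y - g (m x y)\<bar> powr p)"
      using p by (intro powr_add_le_two_powr) auto
    finally show ?thesis
      using True mP n by (simp add: h_def mm ennreal_plus[symmetric] ennreal_mult[symmetric] del: ennreal_plus)
  next
    case False
    then show ?thesis by (subst if_not_P) auto
  qed
  have half: "(\<integral>\<^sup>+x. \<integral>\<^sup>+y. h x (m x y) \<partial>lborel \<partial>lborel) = 2 ^ CARD('n) * near_diff p g P t"
  proof -
    have "(\<integral>\<^sup>+y. h x (m x y) \<partial>lborel) = 2 ^ CARD('n) * (\<integral>\<^sup>+y. h x y \<partial>lborel)" for x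
      unfolding m_def by (rule nn_integral_midpoint) measurable
    then show ?thesis unfolding T by (simp add: nn_integral_cmult)
  qed
  have swap: "(\<integral>\<^sup>+x. \<integral>\<^sup>+y. h y (m y x) \<partial>lborel \<partial>lborel) = (\<integral>\<^sup>+x. \<integral>\<^sup>+y. h x (m x y) \<partial>lborel \<partial>lborel)"
    by (rule lborel_pair.Fubini') measurable
  have "near_diff p g P (2 * t) \<le> (\<integral>\<^sup>+x. \<integral>\<^sup>+y. ennreal (2 powr (p - 1)) * (h x (m x y) + h y (m y x)) \<partial>lborel \<partial>lborel)"
    unfolding near_diff_def by (intro nn_integral_mono pt)
  also have "\<dots> = ennreal (2 powr (p - 1)) * (2 * (2 ^ CARD('n) * near_diff p g P t))"
    by (simp add: nn_integral_cmult nn_integral_add swap half mult_2)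
  also have "\<dots> = ennreal (2 powr (p + real CARD('n))) * near_diff p g P t"
  proof -
    have "2 powr (p + real CARD('n)) = 2 powr (p - 1) * (2 * 2 ^ CARD('n))"
      by (simp add: powr_add powr_diff powr_realpow)
    then have "ennreal (2 powr (p + real CARD('n))) = ennreal (2 powr (p - 1)) * (2 * 2 ^ CARD('n))"
      by (simp add: ennreal_mult ennreal_power[symmetric])
    then show ?thesis by (simp add: mult.assoc)
  qed
  finally show ?thesis .
qed

lemma near_diff_scale:
  fixes g :: "real ^ 'n \<Rightarrow> real"
  assumes "g \<in> borel_measurable borel" "P \<in> sets borel" "convex P" "1 \<le> p"
  shows "near_diff p g P d \<le> ennreal ((2 powr (p + real CARD('n))) ^ k) * near_diff p g P (d / 2 ^ k)"
proof (induction k)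
  case (Suc k)
  have "near_diff p g P (d / 2 ^ k) \<le> ennreal (2 powr (p + real CARD('n))) * near_diff p g P (d / 2 ^ Suc k)"
    using near_diff_double[OF assms, of "d / 2 ^ Suc k"] by simp
  from order.trans[OF Suc mult_left_mono[OF this]] show ?case
    by (simp add: ennreal_mult mult.assoc mult.left_commute)
qed simp

text \<open>The terms grow at least by a factor \<open>2\<close> from one scale to the next, so the sum is comparable to its last
  term, which belongs to the smallest scale above \<open>r\<close>. Therefore the kernel \<open>r powr (- s)\<close> dominates the sum
  of the truncated kernels at all dyadic scales.\<close>

lemma sum_scales_le:
  fixes r d s :: real
  assumes "0 < r" "0 < d" "1 \<le> s"
  shows "(\<Sum>k<N. if r \<le> d / 2 ^ k then (d / 2 ^ k) powr (- s) else 0) \<le> 2 * r powr (- s)"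
proof -
  have *: "r * 2 ^ N \<le> d \<Longrightarrow> (\<Sum>k\<le>N. (d / 2 ^ k) powr (- s)) \<le> 2 * (d / 2 ^ N) powr (- s)" for N
  proof (induction N)
    case (Suc N)
    have e: "(d / 2 ^ Suc N) powr (- s) = 2 powr s * (d / 2 ^ N) powr (- s)"
    proof -
      have "d / 2 ^ Suc N = (d / 2 ^ N) * (1/2)" by simp
      then show ?thesis using assms
        by (simp only: powr_mult) (simp add: powr_minus powr_divide field_simps)
    qed
    have "2 powr 1 \<le> (2::real) powr s" using assms by (intro powr_mono) auto
    then have "2 * (d / 2 ^ N) powr (- s) \<le> (d / 2 ^ Suc N) powr (- s)"
      unfolding e by (intro mult_right_mono) auto
    moreover have "r * 2 ^ N \<le> d"
      by (rule order.trans[OF _ Suc.prems]) (use assms in simp)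
    ultimately show ?case using Suc.IH by simp
  qed simp
  show ?thesis
  proof (induction N)
    case (Suc N)
    show ?case
    proof (cases "r \<le> d / 2 ^ N")
      case True
      then have rd: "r * 2 ^ N \<le> d" by (simp add: field_simps)
      have "(\<Sum>k<Suc N. if r \<le> d / 2 ^ k then (d / 2 ^ k) powr (- s) else 0) \<le> (\<Sum>k\<le>N. (d / 2 ^ k) powr (- s))"
        unfolding lessThan_Suc_atMost by (intro sum_mono) auto
      also have "\<dots> \<le> 2 * (d / 2 ^ N) powr (- s)" by (rule *[OF rd])
      also have "\<dots> \<le> 2 * r powr (- s)"
        using True assms by (auto intro!: powr_mono2')
      finally show ?thesis .
    qed (use Suc in simp)
  qed (use assms in simp)
qed

text \<open>By the doubling estimate, the contribution of scale \<open>d / 2 ^ k\<close> to the energy is at least \<open>q ^ k\<close> times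
  that of scale \<open>d\<close>, where \<open>q = 2 powr (s - p)\<close>. Adding all scales gives a factor of order \<open>1 / (1 - q)\<close>, and
  \<open>1 - q \<le> p - s\<close>. This is where \<open>p - s = p (1 - \<delta>)\<close> enters.\<close>

lemma poincare_convex:
  fixes g :: "real ^ 'n \<Rightarrow> real"
  assumes g [measurable]: "g \<in> borel_measurable borel" and P [measurable]: "P \<in> sets borel"
    and cv: "convex P" and p: "1 \<le> p" and s: "0 < s" "s < p" and d: "0 < d"
    and diam: "\<And>x y. x \<in> P \<Longrightarrow> y \<in> P \<Longrightarrow> norm (x - y) \<le> d"
  shows "(\<integral>\<^sup>+x\<in>P. (\<integral>\<^sup>+y\<in>P. ennreal (\<bar>g x - g y\<bar> powr p) \<partial>lborel) \<partial>lborel)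
      \<le> ennreal (4 * (p - s) * d powr (real CARD('n) + s)) * (\<integral>\<^sup>+x\<in>P. energy_density s p g P x \<partial>lborel)"
proof -
  define S where "S = real CARD('n) + s"
  define E where "E = (\<integral>\<^sup>+x\<in>P. energy_density s p g P x \<partial>lborel)"
  define q where "q = (2::real) powr (s - p)"
  define T where "T = near_diff p g P"
  have S: "1 \<le> S"
  proof -
    have "1 \<le> CARD('n)" by (simp add: Suc_leI)
    then have "1 \<le> real CARD('n)" by linarith
    then show ?thesis using s unfolding S_def by linarith
  qed
  have q: "0 < q" "q < 1" using s by (simp_all add: q_def powr_less_one)
  have lhs: "(\<integral>\<^sup>+x\<in>P. (\<integral>\<^sup>+y\<in>P. ennreal (\<bar>g x - g y\<bar> powr p) \<partial>lborel) \<partial>lborel) = T d"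
    unfolding T_def near_diff_def nn_integral_cmult[symmetric]
    by (subst nn_integral_multc[symmetric]) (auto intro!: nn_integral_cong simp: diam split: split_indicator)
  have main: "ennreal (\<Sum>k<N. q ^ k) * T d \<le> ennreal (2 * d powr S) * E" for N
  proof -
    have trm: "ennreal (q ^ k) * T d \<le> ennreal (d powr S) * (ennreal ((d / 2 ^ k) powr (- S)) * T (d / 2 ^ k))" for k
    proof -
      have "ennreal (q ^ k) * T d \<le> ennreal (q ^ k) * (ennreal ((2 powr (p + real CARD('n))) ^ k) * T (d / 2 ^ k))"
        unfolding T_def using near_diff_scale[OF g P cv p] by (intro mult_left_mono) auto
      also have "\<dots> = ennreal (q ^ k * (2 powr (p + real CARD('n))) ^ k) * T (d / 2 ^ k)"
        using q by (simp add: ennreal_mult mult.assoc)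
      also have "q ^ k * (2 powr (p + real CARD('n))) ^ k = d powr S * (d / 2 ^ k) powr (- S)"
      proof -
        have "q ^ k * (2 powr (p + real CARD('n))) ^ k = (2 powr S) ^ k"
          by (simp add: q_def S_def power_mult_distrib[symmetric] powr_add[symmetric] add.commute)
        also have "\<dots> = (2 ^ k) powr S"
          by (simp add: powr_power powr_realpow[symmetric] powr_powr mult.commute)
        also have "\<dots> = d powr S * (d / 2 ^ k) powr (- S)"
          using d by (simp add: powr_minus powr_divide)
        finally show ?thesis .
      qed
      finally show ?thesis using d by (simp add: ennreal_mult mult.assoc)
    qed
    have "ennreal (\<Sum>k<N. q ^ k) * T d = (\<Sum>k<N. ennreal (q ^ k) * T d)"
      using q by (simp add: sum_distrib_right[symmetric])
    also have "\<dots> \<le> (\<Sum>k<N. ennreal (d powr S) * (ennreal ((d / 2 ^ k) powr (- S)) * T (d / 2 ^ k)))"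
      by (intro sum_mono trm)
    also have "\<dots> = ennreal (d powr S) * (\<Sum>k<N. ennreal ((d / 2 ^ k) powr (- S)) * T (d / 2 ^ k))"
      by (simp add: sum_distrib_left)
    also have "(\<Sum>k<N. ennreal ((d / 2 ^ k) powr (- S)) * T (d / 2 ^ k)) =
       (\<integral>\<^sup>+x. \<integral>\<^sup>+y. (\<Sum>k<N. ennreal ((d / 2 ^ k) powr (- S)) * ennreal (if x \<in> P \<and> y \<in> P \<and> norm (x - y) \<le> d / 2 ^ k then \<bar>g x - g y\<bar> powr p else 0)) \<partial>lborel \<partial>lborel)"
      unfolding T_def near_diff_def
      by (simp add: nn_integral_sum nn_integral_cmult)
    also have "\<dots> \<le> (\<integral>\<^sup>+x. \<integral>\<^sup>+y. 2 * (indicator P x * (ennreal (\<bar>g x - g y\<bar> powr p / norm (x - y) powr S) * indicator P y)) \<partial>lborel \<partial>lborel)"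
    proof (intro nn_integral_mono)
      fix x y :: "real^'n"
      show "(\<Sum>k<N. ennreal ((d / 2 ^ k) powr (- S)) * ennreal (if x \<in> P \<and> y \<in> P \<and> norm (x - y) \<le> d / 2 ^ k then \<bar>g x - g y\<bar> powr p else 0))
        \<le> 2 * (indicator P x * (ennreal (\<bar>g x - g y\<bar> powr p / norm (x - y) powr S) * indicator P y))" (is "?L \<le> ?R")
      proof (cases "x \<in> P \<and> y \<in> P \<and> x \<noteq> y")
        case True
        have "?L = ennreal ((\<Sum>k<N. if norm (x - y) \<le> d / 2 ^ k then (d / 2 ^ k) powr (- S) else 0) * \<bar>g x - g y\<bar> powr p)"
          using True unfolding sum_distrib_right
          by (subst sum_ennreal[symmetric]) (auto intro!: sum.cong simp: ennreal_mult)
        also have "\<dots> \<le> ennreal (2 * norm (x - y) powr (- S) * \<bar>g x - g y\<bar> powr p)"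
          using True d S by (intro ennreal_leI mult_right_mono sum_scales_le) auto
        also have "2 * norm (x - y) powr (- S) * \<bar>g x - g y\<bar> powr p = 2 * (\<bar>g x - g y\<bar> powr p / norm (x - y) powr S)"
          by (simp add: powr_minus divide_inverse mult_ac)
        also have "ennreal \<dots> = ?R"
          using True by (subst ennreal_mult) auto
        finally show ?thesis .
      next
        case False
        then have "?L = 0" by (intro sum.neutral) auto
        then show ?thesis by (simp only:) simp
      qed
    qed
    also have "\<dots> = (\<integral>\<^sup>+x. 2 * (indicator P x * energy_density s p g P x) \<partial>lborel)"
      unfolding energy_density_def S_def by (intro nn_integral_cong) (simp add: nn_integral_cmult)
    also have "\<dots> = 2 * E"
      unfolding E_def by (subst nn_integral_cmult) (auto simp: mult.commute)
    finally have "ennreal (\<Sum>k<N. q ^ k) * T d \<le> ennreal (d powr S) * (2 * E)"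
      by (simp add: mult_left_mono)
    also have "\<dots> = ennreal (2 * d powr S) * E"
      by (simp add: ennreal_mult mult_ac)
    finally show ?thesis .
  qed
  \<comment> \<open>Finitely many scales suffice: as soon as \<open>q ^ N < 1/2\<close>, the partial sum is at least half of \<open>1 / (1 - q)\<close>.\<close>
  have "(\<lambda>N. q ^ N) \<longlonglongrightarrow> 0" using q by (intro LIMSEQ_power_zero) auto
  then have "\<forall>\<^sub>F N in sequentially. q ^ N < 1/2" by (rule order_tendstoD) simp
  then obtain N where N: "q ^ N < 1/2" by (auto simp: eventually_sequentially)
  have "1 / 2 \<le> (1 - q) * (\<Sum>k<N. q ^ k)"
    using q N by (simp add: sum_gp_strict)
  then have half: "1 \<le> 2 * (1 - q) * (\<Sum>k<N. q ^ k)" by (simp add: algebra_simps)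
  have "T d \<le> ennreal (2 * (1 - q) * (\<Sum>k<N. q ^ k)) * T d"
    using mult_right_mono[of 1 "ennreal (2 * (1 - q) * (\<Sum>k<N. q ^ k))" "T d"] half by (simp add: ennreal_leI[of 1, simplified])
  also have "\<dots> = ennreal (2 * (1 - q)) * (ennreal (\<Sum>k<N. q ^ k) * T d)"
    using q by (subst ennreal_mult) (auto intro!: sum_nonneg simp: mult.assoc)
  also have "\<dots> \<le> ennreal (2 * (1 - q)) * (ennreal (2 * d powr S) * E)"
    by (intro mult_left_mono main) auto
  also have "\<dots> = ennreal (2 * (1 - q) * (2 * d powr S)) * E"
    using q by (simp add: ennreal_mult mult.assoc)
  also have "\<dots> \<le> ennreal (4 * (p - s) * d powr S) * E"
  proof (intro mult_right_mono ennreal_leI)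
    have "1 - (p - s) \<le> 1 - (p - s) * ln 2"
      using s mult_left_le[of "ln 2" "p - s"] ln_2_less_1 by linarith
    also have "\<dots> \<le> exp (- ((p - s) * ln 2))"
      using exp_ge_add_one_self[of "- ((p - s) * ln 2)"] by simp
    also have "\<dots> = q" by (simp add: q_def powr_def algebra_simps)
    finally have "1 - q \<le> p - s" by simp
    then have "(1 - q) * (4 * d powr S) \<le> (p - s) * (4 * d powr S)"
      by (intro mult_right_mono) auto
    then show "2 * (1 - q) * (2 * d powr S) \<le> 4 * (p - s) * d powr S"
      by (simp add: algebra_simps)
  qed auto
  finally show ?thesis unfolding lhs E_def S_def .
qed

section \<open>Dyadic cubes\<close>

text \<open>The half-open cube of generation \<open>k\<close> that contains \<open>x\<close>, in the dyadic grid of the cube with corner \<open>a\<close> and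
  side \<open>l\<close>. As a class of the relation "equal floors", it comes with the partition into cubes and with their
  nesting at once.\<close>

definition dyadic_cube :: "real ^ 'n \<Rightarrow> real \<Rightarrow> nat \<Rightarrow> real ^ 'n \<Rightarrow> (real ^ 'n) set" where
  "dyadic_cube a l k x = {y. \<forall>i. \<lfloor>(y $ i - a $ i) * 2 ^ k / l\<rfloor> = \<lfloor>(x $ i - a $ i) * 2 ^ k / l\<rfloor>}"

lemma dyadic_cube_self [simp]: "x \<in> dyadic_cube a l k x"
  by (simp add: dyadic_cube_def)

lemma dyadic_cube_eq: "y \<in> dyadic_cube a l k x \<Longrightarrow> dyadic_cube a l k y = dyadic_cube a l k x"
  by (auto simp: dyadic_cube_def)

lemma dyadic_cube_Suc: "dyadic_cube a l (Suc k) x \<subseteq> dyadic_cube a l k x"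
proof
  fix y assume y: "y \<in> dyadic_cube a l (Suc k) x"
  have *: "\<lfloor>z * 2 ^ k / l\<rfloor> = \<lfloor>z * 2 ^ Suc k / l\<rfloor> div 2" for z :: real
    using floor_divide_real_eq_div[of 2 "z * 2 ^ Suc k / l"] by simp
  show "y \<in> dyadic_cube a l k x"
    using y unfolding dyadic_cube_def * by simp
qed

lemma dyadic_cube_mono: "j \<le> k \<Longrightarrow> dyadic_cube a l k x \<subseteq> dyadic_cube a l j x"
proof (induction k rule: dec_induct)
  case (step k)
  then show ?case using dyadic_cube_Suc[of a l k x] by blast
qed simp

lemma dyadic_cube_eq_box:
  fixes a x :: "real ^ 'n" and l :: real and k :: nat
  assumes "0 < l"
  defines "c \<equiv> \<chi> i. a $ i + of_int \<lfloor>(x $ i - a $ i) * 2 ^ k / l\<rfloor> * (l / 2 ^ k)"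
  shows "dyadic_cube a l k x = {y. \<forall>i. c $ i \<le> y $ i \<and> y $ i < c $ i + l / 2 ^ k}"
proof -
  have "\<lfloor>(z - b) * 2 ^ k / l\<rfloor> = m \<longleftrightarrow> b + of_int m * (l / 2 ^ k) \<le> z \<and> z < b + of_int m * (l / 2 ^ k) + l / 2 ^ k"
    for z b m using assms(1)
    by (auto simp: floor_eq_iff field_simps)
  then show ?thesis
    by (simp add: dyadic_cube_def c_def)
qed

lemma halfopen_box_measurable:
  "{y :: real ^ 'n. \<forall>i. c $ i \<le> y $ i \<and> y $ i < c $ i + r} \<in> sets borel"
  by measurable

lemma emeasure_halfopen_box:
  fixes c :: "real ^ 'n"
  assumes "0 \<le> r"
  shows "emeasure lborel {y. \<forall>i. c $ i \<le> y $ i \<and> y $ i < c $ i + r} = ennreal (r ^ CARD('n))"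
proof -
  define d where "d = c + (\<chi> i. r)"
  have d: "d $ i = c $ i + r" for i by (simp add: d_def)
  have "emeasure lborel (box c d) \<le> emeasure lborel {y. \<forall>i. c $ i \<le> y $ i \<and> y $ i < c $ i + r}"
    by (intro emeasure_mono) (auto simp: mem_box_cart d less_imp_le intro!: halfopen_box_measurable)
  moreover have "emeasure lborel {y. \<forall>i. c $ i \<le> y $ i \<and> y $ i < c $ i + r} \<le> emeasure lborel (cbox c d)"
    by (intro emeasure_mono) (auto simp: mem_box_cart d less_imp_le)
  moreover have "emeasure lborel (cbox c d) = ennreal (r ^ CARD('n))"
    using assms by (subst emeasure_lborel_cbox_eq) (auto simp: Basis_vec_def d inner_axis prod.UNION_disjoint axis_eq_axis
      prod_constant UNION_singleton_eq_range prod.reindex inj_on_def)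
  moreover have "emeasure lborel (box c d) = emeasure lborel (cbox c d)"
    by (simp add: emeasure_lborel_box_eq emeasure_lborel_cbox_eq)
  ultimately show ?thesis by simp
qed

lemma dyadic_cube_measurable [measurable]: "0 < l \<Longrightarrow> dyadic_cube a l k x \<in> sets borel"
  by (subst dyadic_cube_eq_box) (auto intro: halfopen_box_measurable)

lemma emeasure_dyadic_cube:
  fixes a :: "real ^ 'n"
  shows "0 < l \<Longrightarrow> emeasure lborel (dyadic_cube a l k x) = ennreal ((l / 2 ^ k) ^ CARD('n))"
  unfolding dyadic_cube_eq_box by (rule emeasure_halfopen_box) simp

lemma dyadic_cube_diameter:
  fixes a :: "real ^ 'n"
  assumes "0 < l" "y \<in> dyadic_cube a l k x" "z \<in> dyadic_cube a l k x"
  shows "norm (y - z) \<le> sqrt (real CARD('n)) * (l / 2 ^ k)"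
proof -
  have "\<bar>(y - z) $ i\<bar> \<le> l / 2 ^ k" for i
    using assms(2,3) unfolding dyadic_cube_eq_box[OF assms(1)]
    by (auto simp: abs_le_iff dest!: spec[of _ i])
  then have "norm (y - z) \<le> norm (\<chi> i::'n. l / 2 ^ k)"
    using assms(1) by (intro norm_le_componentwise_cart) auto
  also have "\<dots> = sqrt (real CARD('n)) * (l / 2 ^ k)"
    using assms(1) by (simp add: norm_vec_def L2_set_def real_sqrt_mult)
  finally show ?thesis .
qed

lemma convex_dyadic_cube:
  fixes a :: "real ^ 'n"
  shows "0 < l \<Longrightarrow> convex (dyadic_cube a l k x)"
proof -
  assume l: "0 < l"
  have "convex {y :: real ^ 'n. \<forall>i. y $ i \<in> {c i..<d i}}" for c d
  proof (rule convexI)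
    fix x y :: "real^'n" and u v :: real
    assume h: "x \<in> {y. \<forall>i. y $ i \<in> {c i..<d i}}" "y \<in> {y. \<forall>i. y $ i \<in> {c i..<d i}}" "0 \<le> u" "0 \<le> v" "u + v = 1"
    then have "u *\<^sub>R (x $ i) + v *\<^sub>R (y $ i) \<in> {c i..<d i}" for i
      by (intro convexD[OF convex_real_interval(7)]) auto
    then show "u *\<^sub>R x + v *\<^sub>R y \<in> {y. \<forall>i. y $ i \<in> {c i..<d i}}" by simp
  qed
  then show ?thesis unfolding dyadic_cube_eq_box[OF l] by simp
qed

lemma countable_range_dyadic_cube: "countable (range (dyadic_cube a l k))"
proof -
  have "range (dyadic_cube a l k) \<subseteq> (\<lambda>m. {y. \<forall>i. \<lfloor>(y $ i - a $ i) * 2 ^ k / l\<rfloor> = m i}) ` (\<Pi>\<^sub>E i\<in>UNIV. UNIV)"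
    by (auto simp: dyadic_cube_def PiE_UNIV_domain intro!: image_eqI)
  moreover have "countable (\<Pi>\<^sub>E i\<in>(UNIV::'a set). (UNIV::int set))"
    by (rule countable_PiE) auto
  ultimately show ?thesis by (meson countable_image countable_subset)
qed

text \<open>Every point that lies in some cube with the property \<open>X\<close> is assigned the largest such cube, that of
  least generation. These cubes form a partition of the union.\<close>

lemma maximal_dyadic_cubes:
  fixes a :: "real ^ 'n"
  assumes l: "0 < l" and Q0: "Q = dyadic_cube a l 0 a"
  obtains F where "countable F" "disjoint F" "\<Union>F = {x \<in> Q. \<exists>k. X (dyadic_cube a l k x)}"
    "\<And>D. D \<in> F \<Longrightarrow> \<exists>k. \<exists>x\<in>Q. D = dyadic_cube a l k x \<and> X D \<and> (\<forall>j<k. \<not> X (dyadic_cube a l j x))"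
proof -
  define U where "U = {x \<in> Q. \<exists>k. X (dyadic_cube a l k x)}"
  define N where "N x = (LEAST k. X (dyadic_cube a l k x))" for x
  define F where "F = (\<lambda>x. dyadic_cube a l (N x) x) ` U"
  have Q: "x \<in> Q \<Longrightarrow> dyadic_cube a l k x \<subseteq> Q" for x k
    using dyadic_cube_mono[of 0 k a l x] dyadic_cube_eq[of x a l 0 a] Q0 by auto
  have X: "X (dyadic_cube a l (N x) x)" if "x \<in> U" for x
    using that unfolding U_def N_def by (auto intro: LeastI)
  have less: "\<not> X (dyadic_cube a l j x)" if "j < N x" for x j
    using that unfolding N_def by (rule not_less_Least)
  have inU: "y \<in> U \<and> N y = N x \<and> dyadic_cube a l (N y) y = dyadic_cube a l (N x) x"
    if "x \<in> U" "y \<in> dyadic_cube a l (N x) x" for x y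
  proof -
    have e: "dyadic_cube a l j y = dyadic_cube a l j x" if "j \<le> N x" for j
      using dyadic_cube_mono[OF that, of a l x] \<open>y \<in> dyadic_cube a l (N x) x\<close> by (intro dyadic_cube_eq) auto
    have "y \<in> Q" using Q[of x "N x"] that by (auto simp: U_def)
    moreover have "X (dyadic_cube a l (N x) y)" using X[OF \<open>x \<in> U\<close>] e[of "N x"] by simp
    ultimately have y: "y \<in> U" unfolding U_def by blast
    have "N y = N x"
      unfolding N_def[of y]
    proof (rule Least_equality)
      show "X (dyadic_cube a l (N x) y)" using X[OF \<open>x \<in> U\<close>] e by simp
      show "N x \<le> j" if "X (dyadic_cube a l j y)" for j
        using that less[of j x] e[of j] by (cases "j < N x") auto
    qed
    then show ?thesis using y e by simp
  qed
  have "countable F"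
  proof (rule countable_subset)
    show "F \<subseteq> (\<Union>k. range (dyadic_cube a l k))" by (auto simp: F_def)
    show "countable (\<Union>k. range (dyadic_cube a l k))" using countable_range_dyadic_cube by blast
  qed
  moreover have "disjoint F"
    unfolding disjoint_def
  proof (intro ballI impI)
    fix A B assume "A \<in> F" "B \<in> F" "A \<noteq> B"
    then show "A \<inter> B = {}" unfolding F_def using inU by blast
  qed
  moreover have "\<Union>F = {x \<in> Q. \<exists>k. X (dyadic_cube a l k x)}"
  proof -
    have "\<Union>F = U"
    proof
      show "\<Union>F \<subseteq> U" unfolding F_def using inU by blast
      show "U \<subseteq> \<Union>F"
      proof
        fix x assume "x \<in> U"
        then have "dyadic_cube a l (N x) x \<in> F" unfolding F_def by (rule imageI)
        then show "x \<in> \<Union>F" using dyadic_cube_self by (rule UnionI)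
      qed
    qed
    then show ?thesis unfolding U_def .
  qed
  moreover have "\<exists>k. \<exists>x\<in>Q. D = dyadic_cube a l k x \<and> X D \<and> (\<forall>j<k. \<not> X (dyadic_cube a l j x))" if "D \<in> F" for D
  proof -
    from that obtain x where x: "x \<in> U" "D = dyadic_cube a l (N x) x" unfolding F_def by blast
    moreover have "x \<in> Q" using x by (simp add: U_def)
    moreover have "X D" using X[OF x(1)] x(2) by simp
    moreover have "\<forall>j<N x. \<not> X (dyadic_cube a l j x)" using less by blast
    ultimately show ?thesis by blast
  qed
  ultimately show ?thesis by (rule that(1)[of F])
qed

section \<open>Dyadic cubes half filled by a set\<close>

text \<open>The two properties of the weight that the dyadic argument needs: \<open>growth\<close> bounds the weight of a cube by a
  power of its side, and \<open>retain\<close> says that half of a cube, in the sense of volume, carries at least a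
  proportion \<open>\<sigma>\<close> of its weight.\<close>

locale dyadic_weight =
  fixes a :: "real ^ 'n" and l s A \<sigma> :: real and w :: "real ^ 'n \<Rightarrow> ennreal"
    and Q :: "(real ^ 'n) set" and W :: "(real ^ 'n) measure"
  defines "Q \<equiv> dyadic_cube a l 0 a" and "W \<equiv> density lborel w"
  assumes l: "0 < l" and s: "0 < s" "s < real CARD('n)" and \<sigma>: "0 < \<sigma>" "\<sigma> \<le> 1" and A: "0 \<le> A"
    and w [measurable]: "w \<in> borel_measurable borel"
    and growth: "\<And>x k. x \<in> Q \<Longrightarrow> emeasure W (dyadic_cube a l k x) \<le> ennreal (A * (l / 2 ^ k) powr (real CARD('n) - s))"
    and retain: "\<And>x k S. x \<in> Q \<Longrightarrow> S \<in> sets borel \<Longrightarrow> S \<subseteq> dyadic_cube a l k x \<Longrightarrow>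
        emeasure lborel (dyadic_cube a l k x) \<le> 2 * emeasure lborel S \<Longrightarrow>
        ennreal \<sigma> * emeasure W (dyadic_cube a l k x) \<le> emeasure W S"
begin

lemma sets_W [simp, measurable_cong]: "sets W = sets borel"
  by (simp add: W_def)

lemma sub_cube: "x \<in> Q \<Longrightarrow> dyadic_cube a l k x \<subseteq> Q"
  using dyadic_cube_mono[of 0 k a l x] dyadic_cube_eq[of x a l 0 a] by (auto simp: Q_def)

lemma cube_0: "x \<in> Q \<Longrightarrow> dyadic_cube a l 0 x = Q"
  using dyadic_cube_eq[of x a l 0 a] by (simp add: Q_def)

lemma Q_sets [measurable]: "Q \<in> sets borel"
  using l by (simp add: Q_def)

lemma D_sets [measurable]: "dyadic_cube a l k x \<in> sets borel"
  using l by simp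

lemma W_Q_finite: "emeasure W Q < \<infinity>"
  using growth[of a 0] by (auto simp: Q_def intro: le_less_trans)

lemma lborel_cube_fin: "emeasure lborel (dyadic_cube a l k x) < \<infinity>"
  using l by (simp add: emeasure_dyadic_cube)

lemma maximal:
  obtains F where "countable F" "disjoint F" "\<Union>F = {x \<in> Q. \<exists>k. X (dyadic_cube a l k x)}"
    "\<And>D. D \<in> F \<Longrightarrow> \<exists>k. \<exists>x\<in>Q. D = dyadic_cube a l k x \<and> X D \<and> (\<forall>j<k. \<not> X (dyadic_cube a l j x))"
    "\<And>D. D \<in> F \<Longrightarrow> D \<in> sets borel"
proof -
  obtain F
    where F: "countable F" "disjoint F" "\<Union>F = {x \<in> Q. \<exists>k. X (dyadic_cube a l k x)}"
    "\<And>D. D \<in> F \<Longrightarrow> \<exists>k. \<exists>x\<in>Q. D = dyadic_cube a l k x \<and> X D \<and> (\<forall>j<k. \<not> X (dyadic_cube a l j x))"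
    by (rule maximal_dyadic_cubes[OF l Q_def[THEN meta_eq_to_obj_eq], of X]) (rule that)
  have "D \<in> sets borel" if "D \<in> F" for D
  proof -
    from F(4)[OF that] obtain k x where "D = dyadic_cube a l k x" by blast
    then show ?thesis by simp
  qed
  with F show ?thesis by (rule that)
qed

lemma sets_exists_cube: "{x \<in> Q. \<exists>k. X (dyadic_cube a l k x)} \<in> sets borel"
proof (rule maximal[of X])
  fix F assume F: "countable F" "\<Union>F = {x \<in> Q. \<exists>k. X (dyadic_cube a l k x)}" "\<And>D. D \<in> F \<Longrightarrow> D \<in> sets borel"
  show ?thesis unfolding F(2)[symmetric] by (rule sets.countable_Union[OF F(1)]) (rule subsetI, rule F(3))
qed

definition heavy :: "(real ^ 'n) set \<Rightarrow> (real ^ 'n) set" where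
  "heavy G = {x \<in> Q. \<exists>k. emeasure lborel (dyadic_cube a l k x) < 2 * emeasure lborel (dyadic_cube a l k x \<inter> G)}"

lemma heavy_sets [measurable]: "heavy G \<in> sets borel"
  unfolding heavy_def by (rule sets_exists_cube[of "\<lambda>D. emeasure lborel D < 2 * emeasure lborel (D \<inter> G)"])

lemma heavy_subset: "heavy G \<subseteq> Q"
  by (auto simp: heavy_def)

lemma heavy_mono:
  assumes "G' \<subseteq> G" "G \<in> sets borel"
  shows "heavy G' \<subseteq> heavy G"
proof -
  have "emeasure lborel (dyadic_cube a l k x \<inter> G') \<le> emeasure lborel (dyadic_cube a l k x \<inter> G)" for k x
    using assms by (intro emeasure_mono) auto
  then have "2 * emeasure lborel (dyadic_cube a l k x \<inter> G') \<le> 2 * emeasure lborel (dyadic_cube a l k x \<inter> G)" for k x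
    by (intro mult_left_mono) auto
  from less_le_trans[OF _ this] show ?thesis unfolding heavy_def by fast
qed

lemma small_cube_in_open:
  assumes "open U" "x \<in> U"
  shows "\<exists>k. dyadic_cube a l k x \<subseteq> U"
proof -
  from assms obtain e where e: "0 < e" "ball x e \<subseteq> U" by (auto simp: open_contains_ball)
  define c where "c = sqrt (real CARD('n)) * l"
  have "(\<lambda>k. c * (1/2) ^ k) \<longlonglongrightarrow> c * 0" by (intro tendsto_mult_left LIMSEQ_power_zero) auto
  then have "\<forall>\<^sub>F k in sequentially. c * (1/2) ^ k < e" using e by (intro order_tendstoD) auto
  then obtain k where k: "c * (1/2) ^ k < e" by (auto simp: eventually_sequentially)
  have "dyadic_cube a l k x \<subseteq> ball x e"
  proof
    fix y assume "y \<in> dyadic_cube a l k x"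
    then have "norm (x - y) \<le> sqrt (real CARD('n)) * (l / 2 ^ k)"
      by (intro dyadic_cube_diameter[OF l]) auto
    also have "\<dots> = c * (1/2) ^ k" by (simp add: c_def power_divide)
    finally show "y \<in> ball x e" using k by (simp add: dist_norm)
  qed
  then show ?thesis using e by blast
qed

text \<open>A one-sided Lebesgue density theorem. Let \<open>Z\<close> be the exceptional set. A dyadic cube with a point of \<open>Z\<close> is
  at most half filled by \<open>Z\<close>. Covering \<open>Z\<close> by the maximal dyadic cubes inside an open set of almost the same
  measure shows that \<open>Z\<close> is at most half as large as itself, up to an arbitrarily small error.\<close>

lemma null_outside_heavy:
  assumes [measurable]: "G \<in> sets borel" and GQ: "G \<subseteq> Q"
  shows "emeasure lborel (G - heavy G) = 0"
proof -
  define Z where "Z = G - heavy G"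
  have Z [measurable]: "Z \<in> sets borel" by (simp add: Z_def)
  have fin: "emeasure lborel Z < \<infinity>"
  proof -
    have "emeasure lborel Z \<le> emeasure lborel Q"
      using GQ by (intro emeasure_mono) (auto simp: Z_def)
    also have "\<dots> < \<infinity>" using lborel_cube_fin[of 0 a] by (simp add: Q_def)
    finally show ?thesis .
  qed
  have small: "emeasure lborel Z \<le> 0 + ennreal e" if "0 < e" for e
  proof -
    obtain U where U: "open U" "Z \<subseteq> U" "emeasure lborel (U - Z) < ennreal e"
      by (rule outer_regular_lborel[OF Z \<open>0 < e\<close>]) (rule that)
    have [measurable]: "U \<in> sets borel" using U by auto
    obtain F where F: "countable F" "disjoint F" "\<Union>F = {x \<in> Q. \<exists>k. dyadic_cube a l k x \<subseteq> U}"
      and FD: "\<And>D. D \<in> F \<Longrightarrow> \<exists>k. \<exists>x\<in>Q. D = dyadic_cube a l k x \<and> D \<subseteq> U \<and> (\<forall>j<k. \<not> dyadic_cube a l j x \<subseteq> U)"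
      and Fm: "\<And>D. D \<in> F \<Longrightarrow> D \<in> sets borel"
      by (rule maximal[of "\<lambda>D. D \<subseteq> U"]) (rule that)
    have ZF: "\<Union>F \<inter> Z = Z"
      using F U GQ small_cube_in_open[of U] by (auto simp: Z_def)
    have "emeasure lborel (\<Union>F \<inter> Z) \<le> ennreal (1/2) * emeasure lborel (\<Union>F \<inter> U)"
    proof (rule emeasure_le_on_pieces[OF F(1,2)])
      fix D assume D: "D \<in> F"
      from FD[OF D] obtain k x where Dx: "x \<in> Q" "D = dyadic_cube a l k x" "D \<subseteq> U" by auto
      have DU: "D \<inter> U = D" using Dx by auto
      show "emeasure lborel (D \<inter> Z) \<le> ennreal (1/2) * emeasure lborel (D \<inter> U)"
      proof (cases "D \<inter> Z = {}")
        case False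
        then obtain z where z: "z \<in> D" "z \<in> Z" by auto
        then have Dz: "D = dyadic_cube a l k z" using Dx dyadic_cube_eq[of z a l k x] by simp
        have "2 * emeasure lborel (D \<inter> G) \<le> emeasure lborel D"
          using z GQ unfolding Z_def heavy_def Dz by (auto simp: not_less)
        moreover have "emeasure lborel (D \<inter> Z) \<le> emeasure lborel (D \<inter> G)"
          using Dx by (intro emeasure_mono) (auto simp: Z_def)
        ultimately have *: "2 * emeasure lborel (D \<inter> Z) \<le> emeasure lborel D"
          by (meson mult_left_mono order.trans zero_le)
        then have "ennreal 2 * emeasure lborel (D \<inter> Z) \<le> ennreal 2 * (ennreal (1/2) * emeasure lborel (D \<inter> U))"
        proof -
          have "ennreal 2 * ennreal (1/2) = 1" by (subst ennreal_mult[symmetric]) auto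
          then show ?thesis using * by (simp add: DU mult.assoc[symmetric] del: ennreal_half)
        qed
        then show ?thesis by (rule ennreal_mult_le_cancel[rotated]) simp
      qed simp
    qed (use Fm in auto)
    then have "emeasure lborel Z \<le> ennreal (1/2) * emeasure lborel U"
      unfolding ZF by (rule order.trans) (intro mult_left_mono emeasure_mono; auto)
    also have "emeasure lborel U = emeasure lborel Z + emeasure lborel (U - Z)"
      using U by (subst plus_emeasure) (auto intro!: arg_cong[where f="emeasure lborel"])
    also have "\<dots> \<le> emeasure lborel Z + ennreal e" using U by (intro add_left_mono) auto
    finally have le: "emeasure lborel Z \<le> ennreal (1/2) * (emeasure lborel Z + ennreal e)"
      by (simp only: mult_left_mono zero_le)
    obtain z where z: "0 \<le> z" "emeasure lborel Z = ennreal z" using fin by (cases "emeasure lborel Z") auto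
    have "z \<le> (1/2) * (z + e)"
      using le z \<open>0 < e\<close> by (simp add: ennreal_mult[symmetric] ennreal_plus[symmetric] del: ennreal_plus ennreal_half)
    then show ?thesis using z by simp
  qed
  have "emeasure lborel Z \<le> 0" by (rule ennreal_le_epsilon) (rule small)
  then show ?thesis by (simp add: Z_def)
qed

text \<open>With \<open>G\<close> and \<open>G'\<close> the sets where a function exceeds a lower and a higher level, such a cube contains a
  definite proportion of points below the lower level and of points above the higher one. The number
  \<open>2 ^ (n + 2)\<close> leaves a factor \<open>4\<close> after passing from a cube to its parent, whose volume is \<open>2 ^ n\<close> times
  larger.\<close>

definition straddling :: "(real ^ 'n) set \<Rightarrow> (real ^ 'n) set \<Rightarrow> (real ^ 'n) set \<Rightarrow> bool" where
  "straddling G G' D \<longleftrightarrow> 2 * emeasure lborel (D \<inter> G) \<le> emeasure lborel D \<and>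
     emeasure lborel D \<le> 2 ^ (CARD('n) + 2) * emeasure lborel (D \<inter> G')"

definition transition :: "(real ^ 'n) set \<Rightarrow> (real ^ 'n) set \<Rightarrow> (real ^ 'n) set" where
  "transition G G' = {x \<in> Q. \<exists>k. straddling G G' (dyadic_cube a l k x)}"

lemma transition_sets [measurable]: "transition G G' \<in> sets borel"
  unfolding transition_def by (rule sets_exists_cube[of "straddling G G'"])

text \<open>The maximal heavy cubes for \<open>G'\<close> that meet the given cube are contained in it: a larger one would be an
  ancestor heavy for \<open>G' \<subseteq> G\<close>, against \<open>light\<close>. Each of them is at most twice as large as its part in
  \<open>G'\<close>.\<close>

lemma heavy_in_heavy_cube:
  assumes [measurable]: "G \<in> sets borel" "G' \<in> sets borel" and sub: "G' \<subseteq> G"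
    and x: "x \<in> Q" and light: "\<And>j. j < k \<Longrightarrow> 2 * emeasure lborel (dyadic_cube a l j x \<inter> G) \<le> emeasure lborel (dyadic_cube a l j x)"
  shows "emeasure lborel (dyadic_cube a l k x \<inter> heavy G') \<le> 2 * emeasure lborel (dyadic_cube a l k x \<inter> G')"
proof -
  define D where "D = dyadic_cube a l k x"
  obtain F where F: "countable F" "disjoint F"
      "\<Union>F = {x \<in> Q. \<exists>k. emeasure lborel (dyadic_cube a l k x) < 2 * emeasure lborel (dyadic_cube a l k x \<inter> G')}"
    and FD: "\<And>D. D \<in> F \<Longrightarrow> \<exists>k. \<exists>x\<in>Q. D = dyadic_cube a l k x \<and> emeasure lborel D < 2 * emeasure lborel (D \<inter> G')
       \<and> (\<forall>j<k. \<not> emeasure lborel (dyadic_cube a l j x) < 2 * emeasure lborel (dyadic_cube a l j x \<inter> G'))"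
    and Fm: "\<And>D. D \<in> F \<Longrightarrow> D \<in> sets borel"
    by (rule maximal[of "\<lambda>D. emeasure lborel D < 2 * emeasure lborel (D \<inter> G')"]) (rule that)
  define F' where "F' = {D' \<in> F. D' \<subseteq> D}"
  have F': "countable F'" "disjoint F'" using F by (auto simp: F'_def disjoint_def)
  have "D \<inter> heavy G' \<subseteq> \<Union>F'"
  proof
    fix y assume y: "y \<in> D \<inter> heavy G'"
    then have "y \<in> \<Union>F" by (simp add: F(3) heavy_def)
    then obtain D' where D': "D' \<in> F" "y \<in> D'" by auto
    from FD[OF D'(1)] obtain k' x' where "D' = dyadic_cube a l k' x'"
      and hv: "emeasure lborel D' < 2 * emeasure lborel (D' \<inter> G')" by auto
    then have Dy: "D' = dyadic_cube a l k' y" using D' dyadic_cube_eq[of y a l k' x'] by simp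
    have "k \<le> k'"
    proof (rule ccontr)
      assume "\<not> k \<le> k'"
      then have k: "k' < k" by simp
      have "y \<in> dyadic_cube a l k' x" using y dyadic_cube_mono[of k' k a l x] k by (auto simp: D_def)
      then have "D' = dyadic_cube a l k' x" using Dy dyadic_cube_eq[of y a l k' x] by simp
      then have "2 * emeasure lborel (D' \<inter> G) \<le> emeasure lborel D'" using light[OF k] by simp
      moreover have "emeasure lborel (D' \<inter> G') \<le> emeasure lborel (D' \<inter> G)"
        using sub Fm[OF D'(1)] by (intro emeasure_mono) auto
      ultimately have "2 * emeasure lborel (D' \<inter> G') \<le> emeasure lborel D'"
        by (meson mult_left_mono order.trans zero_le)
      then show False using hv by simp
    qed
    then have "D' \<subseteq> dyadic_cube a l k y" using dyadic_cube_mono Dy by simp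
    also have "\<dots> = D" using y dyadic_cube_eq[of y a l k x] by (simp add: D_def)
    finally show "y \<in> \<Union>F'" using D' by (auto simp: F'_def)
  qed
  then have "emeasure lborel (D \<inter> heavy G') \<le> emeasure lborel (\<Union>F' \<inter> UNIV)"
    using F' Fm by (intro emeasure_mono) (auto intro!: sets.countable_Union simp: F'_def)
  also have "\<dots> \<le> 2 * emeasure lborel (\<Union>F' \<inter> G')"
  proof (rule emeasure_le_on_pieces[OF F'])
    fix D' assume "D' \<in> F'"
    then have "D' \<in> F" by (simp add: F'_def)
    from FD[OF this] show "emeasure lborel (D' \<inter> UNIV) \<le> 2 * emeasure lborel (D' \<inter> G')"
      by (auto simp: less_imp_le)
  qed (use Fm in \<open>auto simp: F'_def\<close>)
  also have "\<dots> \<le> 2 * emeasure lborel (D \<inter> G')"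
    by (intro mult_left_mono emeasure_mono) (auto simp: F'_def D_def)
  finally show ?thesis by (simp add: D_def)
qed

text \<open>The parent \<open>P\<close> of a maximal heavy cube \<open>D\<close> for \<open>G\<close> is at most half filled by \<open>G\<close>. Either \<open>P\<close> straddles, and
  then \<open>D\<close> belongs to the transition set, or \<open>G'\<close> is so sparse in \<open>P\<close> that \<open>heavy G'\<close> covers at most half of
  \<open>D\<close> and a proportion \<open>\<sigma>\<close> of the weight of \<open>D\<close> is left outside.\<close>

lemma heavy_step:
  assumes [measurable]: "G \<in> sets borel" "G' \<in> sets borel" and sub: "G' \<subseteq> G" and GQ: "G \<subseteq> Q"
    and half: "2 * emeasure lborel G \<le> emeasure lborel Q"
  shows "emeasure W (heavy G') \<le> ennreal (1 - \<sigma>) * emeasure W (heavy G) + emeasure W (transition G G')"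
proof -
  let ?H = "heavy G' - transition G G'"
  obtain F where F: "countable F" "disjoint F"
      "\<Union>F = {x \<in> Q. \<exists>k. emeasure lborel (dyadic_cube a l k x) < 2 * emeasure lborel (dyadic_cube a l k x \<inter> G)}"
    and FD: "\<And>D. D \<in> F \<Longrightarrow> \<exists>k. \<exists>x\<in>Q. D = dyadic_cube a l k x \<and> emeasure lborel D < 2 * emeasure lborel (D \<inter> G)
       \<and> (\<forall>j<k. \<not> emeasure lborel (dyadic_cube a l j x) < 2 * emeasure lborel (dyadic_cube a l j x \<inter> G))"
    and Fm: "\<And>D. D \<in> F \<Longrightarrow> D \<in> sets borel"
    by (rule maximal[of "\<lambda>D. emeasure lborel D < 2 * emeasure lborel (D \<inter> G)"]) (rule that)
  have UF: "\<Union>F = heavy G" by (simp add: F heavy_def)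
  have "emeasure W (\<Union>F \<inter> ?H) \<le> ennreal (1 - \<sigma>) * emeasure W (\<Union>F \<inter> UNIV)"
  proof (rule emeasure_le_on_pieces[OF F(1,2)])
    fix D assume D: "D \<in> F"
    from FD[OF D] obtain k x where x: "x \<in> Q" "D = dyadic_cube a l k x" "emeasure lborel D < 2 * emeasure lborel (D \<inter> G)"
      and light: "\<And>j. j < k \<Longrightarrow> 2 * emeasure lborel (dyadic_cube a l j x \<inter> G) \<le> emeasure lborel (dyadic_cube a l j x)"
      by (auto simp: not_less)
    \<comment> \<open>\<open>Q\<close> itself is not heavy, since \<open>G\<close> fills at most half of it; so \<open>D\<close> has a parent.\<close>
    have "k \<noteq> 0"
    proof
      assume "k = 0"
      then have "D = Q" using x cube_0 by simp
      moreover have "Q \<inter> G = G" using GQ by auto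
      ultimately show False using x(3) half by simp
    qed
    then obtain j where j: "k = Suc j" by (cases k) auto
    define P where "P = dyadic_cube a l j x"
    have DP: "D \<subseteq> P" using dyadic_cube_Suc x j by (simp add: P_def)
    have [measurable]: "P \<in> sets borel" "D \<in> sets borel" by (simp_all add: P_def x)
    show "emeasure W (D \<inter> ?H) \<le> ennreal (1 - \<sigma>) * emeasure W (D \<inter> UNIV)"
    proof (cases "emeasure lborel P \<le> 2 ^ (CARD('n) + 2) * emeasure lborel (P \<inter> G')")
      case True
      have "y \<in> transition G G'" if "y \<in> D" for y
      proof -
        have "dyadic_cube a l j y = P" using dyadic_cube_eq[of y a l j x] DP that by (auto simp: P_def)
        then have "straddling G G' (dyadic_cube a l j y)"
          using light[of j] j True by (simp add: straddling_def P_def)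
        moreover have "y \<in> Q" using sub_cube[OF x(1)] x(2) that by auto
        ultimately show ?thesis by (auto simp: transition_def)
      qed
      then have "D \<inter> ?H = {}" by auto
      then show ?thesis by simp
    next
      case False
      have "2 ^ CARD('n) * (4 * emeasure lborel (D \<inter> G')) \<le> 2 ^ (CARD('n) + 2) * emeasure lborel (P \<inter> G')"
      proof -
        have "emeasure lborel (D \<inter> G') \<le> emeasure lborel (P \<inter> G')"
          using DP by (intro emeasure_mono) auto
        then have "2 ^ CARD('n) * 4 * emeasure lborel (D \<inter> G') \<le> 2 ^ CARD('n) * 4 * emeasure lborel (P \<inter> G')"
          by (intro mult_left_mono) auto
        then show ?thesis by (simp add: power_add mult_ac)
      qed
      also have "\<dots> \<le> emeasure lborel P" using False by simp
      also have "emeasure lborel P = 2 ^ CARD('n) * emeasure lborel D"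
      proof -
        have "(l / 2 ^ j) ^ CARD('n) = 2 ^ CARD('n) * (l / 2 ^ k) ^ CARD('n)"
          unfolding power_mult_distrib[symmetric] j by simp
        then show ?thesis using l
          by (simp add: P_def x emeasure_dyadic_cube ennreal_mult ennreal_power[symmetric])
      qed
      finally have "ennreal (2 ^ CARD('n)) * (4 * emeasure lborel (D \<inter> G')) \<le> ennreal (2 ^ CARD('n)) * emeasure lborel D"
        by (simp add: ennreal_power[symmetric])
      then have "4 * emeasure lborel (D \<inter> G') \<le> emeasure lborel D"
        by (rule ennreal_mult_le_cancel[rotated]) simp
      moreover have "2 * emeasure lborel (D \<inter> heavy G') \<le> 2 * (2 * emeasure lborel (D \<inter> G'))"
        using heavy_in_heavy_cube[OF _ _ sub x(1) light, of k] x(2) by (intro mult_left_mono) auto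
      ultimately have h: "2 * emeasure lborel (D \<inter> heavy G') \<le> emeasure lborel D"
        by (simp add: mult.assoc[symmetric]) 
      have sum: "emeasure lborel (D \<inter> heavy G') + emeasure lborel (D - heavy G') = emeasure lborel D"
        by (subst plus_emeasure) (auto intro!: arg_cong[where f="emeasure lborel"])
      have keep: "ennreal \<sigma> * emeasure W D \<le> emeasure W (D - heavy G')"
        unfolding x(2)
      proof (rule retain[OF x(1)])
        have fin: "emeasure lborel D < \<infinity>" using x lborel_cube_fin by simp
        have "emeasure lborel (D \<inter> heavy G') < \<infinity>" "emeasure lborel (D - heavy G') < \<infinity>"
          by (rule le_less_trans[OF emeasure_mono fin]; auto)+
        then obtain b c where bc: "0 \<le> b" "0 \<le> c"
            "emeasure lborel (D \<inter> heavy G') = ennreal b" "emeasure lborel (D - heavy G') = ennreal c"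
          by (auto simp: less_top_ennreal)
        have "2 * b \<le> b + c"
          using h bc unfolding sum[symmetric] bc
          by (simp add: ennreal_plus[symmetric] ennreal_mult[symmetric] numeral_mult_ennreal del: ennreal_plus)
        then have "ennreal (b + c) \<le> ennreal (2 * c)" by (intro ennreal_leI) simp
        then have "emeasure lborel D \<le> 2 * emeasure lborel (D - heavy G')"
          unfolding sum[symmetric] bc using bc by (simp add: ennreal_mult)
        then show "emeasure lborel (dyadic_cube a l k x) \<le> 2 * emeasure lborel (dyadic_cube a l k x - heavy G')"
          by (simp add: x)
      qed auto
      have sumW: "emeasure W (D \<inter> heavy G') + emeasure W (D - heavy G') = emeasure W D"
        by (subst plus_emeasure) (auto intro!: arg_cong[where f="emeasure W"])
      have "emeasure W D < \<infinity>" using growth[OF x(1), of k] x(2) by (auto intro: le_less_trans)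
      then have "emeasure W (D \<inter> heavy G') < \<infinity>" "emeasure W (D - heavy G') < \<infinity>"
        using sumW by (auto simp: less_top[symmetric])
      then obtain b c where bc: "0 \<le> b" "0 \<le> c"
          "emeasure W (D \<inter> heavy G') = ennreal b" "emeasure W (D - heavy G') = ennreal c"
        by (auto simp: less_top_ennreal)
      have D: "emeasure W D = ennreal (b + c)" using sumW bc by simp
      have "\<sigma> * (b + c) \<le> c"
        using keep \<sigma> bc unfolding D bc by (simp add: ennreal_mult[symmetric] ennreal_plus[symmetric] del: ennreal_plus)
      then have "b \<le> (1 - \<sigma>) * (b + c)" by (simp add: algebra_simps)
      then have "emeasure W (D \<inter> heavy G') \<le> ennreal (1 - \<sigma>) * emeasure W D"
        using \<sigma> bc unfolding D bc by (simp add: ennreal_mult[symmetric] ennreal_plus[symmetric] del: ennreal_plus)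
      moreover have "emeasure W (D \<inter> ?H) \<le> emeasure W (D \<inter> heavy G')"
        by (intro emeasure_mono) auto
      ultimately show ?thesis by simp
    qed
  qed (use Fm in auto)
  then have 1: "emeasure W ?H \<le> ennreal (1 - \<sigma>) * emeasure W (heavy G)"
    using heavy_mono[OF sub] by (simp add: UF Int_absorb1 subset_iff inf_absorb2)
  have "emeasure W (heavy G') \<le> emeasure W (?H \<union> transition G G')"
    by (intro emeasure_mono) auto
  also have "\<dots> \<le> emeasure W ?H + emeasure W (transition G G')"
    by (intro emeasure_subadditive) auto
  finally show ?thesis using 1 by (meson add_right_mono order.trans)
qed

end

section \<open>Slicing a function by its values\<close>

lemma sum_powr_le_powr_sum:
  fixes z :: "'i \<Rightarrow> real"
  assumes "finite I" "\<And>i. i \<in> I \<Longrightarrow> 0 \<le> z i" "1 \<le> p"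
  shows "(\<Sum>i\<in>I. z i powr p) \<le> (\<Sum>i\<in>I. z i) powr p"
proof -
  have pw: "x powr p = x * x powr (p - 1)" if "0 \<le> x" for x
    using that by (cases "x = 0") (auto simp: powr_diff)
  let ?S = "\<Sum>i\<in>I. z i"
  have S: "0 \<le> ?S" using assms by (intro sum_nonneg)
  have "(\<Sum>i\<in>I. z i powr p) = (\<Sum>i\<in>I. z i * z i powr (p - 1))"
    using assms by (intro sum.cong) (auto simp: pw)
  also have "\<dots> \<le> (\<Sum>i\<in>I. z i * ?S powr (p - 1))"
    using assms by (intro sum_mono mult_left_mono powr_mono2 member_le_sum) auto
  also have "\<dots> = ?S powr p" using S by (simp add: pw sum_distrib_right)
  finally show ?thesis .
qed

definition slice :: "real \<Rightarrow> real \<Rightarrow> real \<Rightarrow> real" where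
  "slice b c t = min (max t b) c - b"

lemma slice_mono: "b \<le> c \<Longrightarrow> t \<le> t' \<Longrightarrow> slice b c t \<le> slice b c t'"
  by (auto simp: slice_def)

lemma sum_slice:
  assumes "incseq b"
  shows "(\<Sum>k<K. slice (b k) (b (Suc k)) t) = slice (b 0) (b K) t"
proof (induction K)
  case (Suc K)
  have "b 0 \<le> b K" "b K \<le> b (Suc K)" using assms by (auto simp: incseq_def)
  then show ?case using Suc by (auto simp: slice_def)
qed (simp add: slice_def)

text \<open>All slices are monotone in \<open>t\<close>, so their differences have the same sign and add up to at most
  \<open>\<bar>t - t'\<bar>\<close>; and a sum of \<open>p\<close>-th powers is at most the \<open>p\<close>-th power of the sum. Hence the energies of the
  slices of a function add up to at most the energy of the function.\<close>

lemma sum_slice_diff_powr: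
  assumes "incseq b" "1 \<le> p"
  shows "(\<Sum>k<K. \<bar>slice (b k) (b (Suc k)) t - slice (b k) (b (Suc k)) t'\<bar> powr p) \<le> \<bar>t - t'\<bar> powr p"
proof -
  have *: "(\<Sum>k<K. \<bar>slice (b k) (b (Suc k)) t - slice (b k) (b (Suc k)) t'\<bar> powr p) \<le> \<bar>t - t'\<bar> powr p"
    if "t' \<le> t" for t t'
  proof -
    have mono: "slice (b k) (b (Suc k)) t' \<le> slice (b k) (b (Suc k)) t" for k
      using assms that by (intro slice_mono) (auto simp: incseq_def)
    have b: "b 0 \<le> b K" using assms by (auto simp: incseq_def)
    have "(\<Sum>k<K. \<bar>slice (b k) (b (Suc k)) t - slice (b k) (b (Suc k)) t'\<bar> powr p)
        \<le> (\<Sum>k<K. \<bar>slice (b k) (b (Suc k)) t - slice (b k) (b (Suc k)) t'\<bar>) powr p"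
      using assms by (intro sum_powr_le_powr_sum) auto
    also have "(\<Sum>k<K. \<bar>slice (b k) (b (Suc k)) t - slice (b k) (b (Suc k)) t'\<bar>) = slice (b 0) (b K) t - slice (b 0) (b K) t'"
      using mono by (simp add: sum_subtractf sum_slice[OF assms(1)])
    also have "(slice (b 0) (b K) t - slice (b 0) (b K) t') powr p \<le> \<bar>t - t'\<bar> powr p"
      using that b slice_mono[OF b that] assms by (intro powr_mono2) (auto simp: slice_def)
    finally show ?thesis .
  qed
  show ?thesis
    using *[of t' t] *[of t t'] by (cases "t' \<le> t") (auto simp: abs_minus_commute)
qed

text \<open>A discrete layer cake formula. The sum telescopes up to the first level that is not below \<open>y\<close>.\<close>

lemma powr_le_sum_levels:
  fixes y :: real
  assumes "0 < c" "1 < \<theta>" "0 < p" "0 \<le> y"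
  shows "ennreal (y powr p) \<le> ennreal (c powr p) +
     (\<Sum>k. ennreal ((\<theta> powr p - 1) * (c * \<theta> ^ k) powr p) * (if c * \<theta> ^ k < y then 1 else 0))"
proof -
  define L where "L k = (c * \<theta> ^ k) powr p" for k
  define e where "e k = ennreal ((\<theta> powr p - 1) * L k) * (if c * \<theta> ^ k < y then 1 else 0)" for k
  have L_Suc: "L (Suc k) = L k + (\<theta> powr p - 1) * L k" for k
  proof -
    have "L (Suc k) = (\<theta> * (c * \<theta> ^ k)) powr p" by (simp add: L_def mult_ac)
    also have "\<dots> = \<theta> powr p * L k" using assms by (simp add: L_def powr_mult)
    finally show ?thesis by (simp add: algebra_simps)
  qed
  have \<theta>: "1 \<le> \<theta> powr p" using assms by (intro ge_one_powr_ge_zero) auto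
  have Lnn: "0 \<le> L k" for k by (simp add: L_def)
  have L0: "L 0 = c powr p" by (simp add: L_def)
  obtain M where M: "y \<le> c * \<theta> ^ M"
  proof -
    from real_arch_pow[of \<theta> "y / c"] assms obtain M where "y / c < \<theta> ^ M" by auto
    then show ?thesis using that[of M] assms by (simp add: field_simps)
  qed
  define k where "k = (LEAST M. y \<le> c * \<theta> ^ M)"
  have k: "y \<le> c * \<theta> ^ k" unfolding k_def using M by (rule LeastI)
  have above: "c * \<theta> ^ j < y" if "j < k" for j
    using not_less_Least[of j "\<lambda>M. y \<le> c * \<theta> ^ M"] that unfolding k_def by simp
  have "ennreal (y powr p) \<le> ennreal (L k)"
    using k assms unfolding L_def by (intro ennreal_leI powr_mono2) auto
  also have "\<dots> = ennreal (L 0) + (\<Sum>j<k. e j)"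
  proof -
    have *: "ennreal (L m) = ennreal (L 0) + (\<Sum>j<m. e j)" if "m \<le> k" for m
      using that
    proof (induction m)
      case (Suc m)
      have "ennreal (L (Suc m)) = ennreal (L m) + ennreal ((\<theta> powr p - 1) * L m)"
        using Lnn \<theta> by (simp add: L_Suc)
      also have "ennreal ((\<theta> powr p - 1) * L m) = e m" using above[of m] Suc by (simp add: e_def)
      finally show ?case using Suc by (simp add: add.assoc)
    qed simp
    show ?thesis by (rule *) (rule order.refl)
  qed
  also have "\<dots> \<le> ennreal (L 0) + (\<Sum>j. e j)"
    by (intro add_left_mono sum_le_suminf) auto
  finally show ?thesis unfolding L0 unfolding e_def L_def .
qed

section \<open>The weighted inequality above a median\<close>

context dyadic_weight
begin

text \<open>The pairs in \<open>(D - G) \<times> (D \<inter> G')\<close> make up a fixed proportion of \<open>D \<times> D\<close>, and \<open>g\<close> jumps by \<open>h\<close> on each of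
  them, so the unweighted Poincare inequality on \<open>D\<close> bounds \<open>h powr p\<close> from above.\<close>

lemma oscillation_in_cube:
  fixes g :: "real ^ 'n \<Rightarrow> real"
  assumes [measurable]: "g \<in> borel_measurable borel" "G \<in> sets borel" "G' \<in> sets borel"
    and p: "1 \<le> p" "s < p" and h: "0 < h"
    and jump: "\<And>x y. x \<in> Q \<Longrightarrow> y \<in> Q \<Longrightarrow> x \<notin> G \<Longrightarrow> y \<in> G' \<Longrightarrow> h \<le> \<bar>g x - g y\<bar>"
    and x: "x \<in> Q" and D: "D = dyadic_cube a l k x" and str: "straddling G G' D"
  shows "ennreal (h powr p * (l / 2 ^ k) powr (real CARD('n) - s)) \<le>
     ennreal (2 ^ (CARD('n) + 5) * (p - s) * real CARD('n) ^ CARD('n)) * (\<integral>\<^sup>+x\<in>D. energy_density s p g D x \<partial>lborel)"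
proof -
  define n where "n = CARD('n)"
  define r where "r = l / 2 ^ k"
  have r: "0 < r" using l by (simp add: r_def)
  have card_ge_1: "1 \<le> n" by (simp add: n_def Suc_leI)
  have DQ: "D \<subseteq> Q" using sub_cube[OF x] D by simp
  have [measurable]: "D \<in> sets borel" by (simp add: D)
  define E where "E = (\<integral>\<^sup>+x\<in>D. energy_density s p g D x \<partial>lborel)"
  define I where "I = (\<integral>\<^sup>+x\<in>D. (\<integral>\<^sup>+y\<in>D. ennreal (\<bar>g x - g y\<bar> powr p) \<partial>lborel) \<partial>lborel)"
  have vol: "emeasure lborel D = ennreal (r ^ n)" using l by (simp add: D emeasure_dyadic_cube r_def n_def)
  have up: "I \<le> ennreal (4 * (p - s) * (sqrt (real n) * r) powr (real n + s)) * E"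
    unfolding I_def E_def n_def
  proof (rule poincare_convex)
    show "norm (y - z) \<le> sqrt (real CARD('n)) * r" if "y \<in> D" "z \<in> D" for y z
      using dyadic_cube_diameter[OF l] that unfolding D r_def by blast
    show "convex D" using convex_dyadic_cube[OF l] D by simp
    show "0 < sqrt (real CARD('n)) * r" using r by simp
  qed (use p s in auto)
  have low: "ennreal (h powr p) * (emeasure lborel (D - G) * emeasure lborel (D \<inter> G')) \<le> I"
  proof -
    have "ennreal (h powr p) * (emeasure lborel (D - G) * emeasure lborel (D \<inter> G')) =
        (\<integral>\<^sup>+x. \<integral>\<^sup>+y. ennreal (h powr p) * (indicator (D - G) x * indicator (D \<inter> G') y) \<partial>lborel \<partial>lborel)"
      by (simp add: nn_integral_cmult nn_integral_multc)
    also have "\<dots> \<le> (\<integral>\<^sup>+x. \<integral>\<^sup>+y. ennreal (\<bar>g x - g y\<bar> powr p) * indicator D y * indicator D x \<partial>lborel \<partial>lborel)"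
    proof (intro nn_integral_mono)
      fix x y :: "real^'n"
      show "ennreal (h powr p) * (indicator (D - G) x * indicator (D \<inter> G') y) \<le> ennreal (\<bar>g x - g y\<bar> powr p) * indicator D y * indicator D x"
      proof (cases "x \<in> D - G \<and> y \<in> D \<inter> G'")
        case True
        then have "h \<le> \<bar>g x - g y\<bar>" using DQ by (intro jump) auto
        then have "h powr p \<le> \<bar>g x - g y\<bar> powr p" using p h by (intro powr_mono2) auto
        then show ?thesis using True by (simp add: ennreal_leI)
      qed (auto simp: indicator_def)
    qed
    also have "\<dots> = I" unfolding I_def by (simp add: nn_integral_multc)
    finally show ?thesis .
  qed
  have sum: "emeasure lborel (D \<inter> G) + emeasure lborel (D - G) = ennreal (r ^ n)"
    unfolding vol[symmetric] by (subst plus_emeasure) (auto intro!: arg_cong[where f="emeasure lborel"])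
  have "emeasure lborel (D \<inter> G') < \<infinity>"
    by (rule le_less_trans[OF emeasure_mono[of _ D]]) (auto simp: vol)
  moreover have "emeasure lborel (D \<inter> G) < \<infinity>" "emeasure lborel (D - G) < \<infinity>"
    using sum by (auto simp: less_top[symmetric])
  ultimately obtain b c d where bcd: "0 \<le> b" "0 \<le> c" "0 \<le> d"
      "emeasure lborel (D \<inter> G) = ennreal b" "emeasure lborel (D - G) = ennreal c" "emeasure lborel (D \<inter> G') = ennreal d"
    by (auto simp: less_top_ennreal)
  have bc: "b + c = r ^ n" using sum bcd r by (simp add: ennreal_plus[symmetric] del: ennreal_plus)
  have "ennreal (2 * b) \<le> ennreal (r ^ n)"
    using str bcd unfolding straddling_def vol by (simp add: ennreal_mult)
  then have c: "r ^ n \<le> 2 * c" using bc r by simp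
  have "ennreal (r ^ n) \<le> ennreal (2 ^ (n + 2) * d)"
    using str bcd unfolding straddling_def vol n_def by (simp add: ennreal_mult ennreal_power[symmetric])
  then have d: "r ^ n \<le> 2 ^ (n + 2) * d" using bcd by simp
  have "(r ^ n) * (r ^ n) \<le> (2 * c) * (2 ^ (n + 2) * d)"
    using c d r bcd by (intro mult_mono) auto
  also have "\<dots> = 2 ^ (n + 3) * (c * d)" by (simp add: power_add)
  finally have rr: "r ^ n * r ^ n \<le> 2 ^ (n + 3) * (c * d)" .
  define X where "X = r powr (real n + s)"
  have X: "0 < X" using r by (simp add: X_def)
  have "ennreal X * ennreal (h powr p * r powr (real n - s)) = ennreal (h powr p * (r ^ n * r ^ n))"
  proof -
    have "X * (h powr p * r powr (real n - s)) = h powr p * (X * r powr (real n - s))" by simp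
    also have "X * r powr (real n - s) = r ^ n * r ^ n"
      unfolding X_def using r by (simp add: powr_add[symmetric] powr_realpow[symmetric])
    finally show ?thesis using X by (subst ennreal_mult[symmetric]) auto
  qed
  also have "\<dots> \<le> ennreal (h powr p * (2 ^ (n + 3) * (c * d)))"
    using rr by (intro ennreal_leI mult_left_mono) auto
  also have "\<dots> = ennreal (2 ^ (n + 3)) * (ennreal (h powr p) * (emeasure lborel (D - G) * emeasure lborel (D \<inter> G')))"
    using bcd by (simp add: ennreal_mult[symmetric] mult_ac)
  also have "\<dots> \<le> ennreal (2 ^ (n + 3)) * (ennreal (4 * (p - s) * (sqrt (real n) * r) powr (real n + s)) * E)"
    using low up by (intro mult_left_mono) auto
  also have "\<dots> = ennreal (2 ^ (n + 3) * (4 * (p - s) * (sqrt (real n) * r) powr (real n + s))) * E"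
    using p by (simp add: ennreal_mult mult.assoc)
  also have "\<dots> \<le> ennreal (X * (2 ^ (n + 5) * (p - s) * real n ^ n)) * E"
  proof (intro mult_right_mono ennreal_leI)
    have "sqrt (real n) powr (real n + s) \<le> sqrt (real n) powr (2 * real n)"
      using card_ge_1 s by (intro powr_mono) (auto simp: n_def)
    also have "\<dots> = (sqrt (real n) powr 2) powr real n" by (simp only: powr_powr)
    also have "sqrt (real n) powr 2 = real n" by simp
    also have "real n powr real n = real n ^ n" using card_ge_1 by (simp add: powr_realpow)
    finally have "sqrt (real n) powr (real n + s) \<le> real n ^ n" .
    moreover have "(sqrt (real n) * r) powr (real n + s) = sqrt (real n) powr (real n + s) * X"
      using r by (simp add: powr_mult X_def)
    ultimately have "(sqrt (real n) * r) powr (real n + s) \<le> real n ^ n * X"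
      using X by (simp add: mult_right_mono)
    then have "2 ^ (n + 3) * (4 * (p - s)) * (sqrt (real n) * r) powr (real n + s) \<le> 2 ^ (n + 3) * (4 * (p - s)) * (real n ^ n * X)"
      using p by (intro mult_left_mono) auto
    then show "2 ^ (n + 3) * (4 * (p - s) * (sqrt (real n) * r) powr (real n + s)) \<le> X * (2 ^ (n + 5) * (p - s) * real n ^ n)"
      by (simp add: power_add algebra_simps)
  qed auto
  also have "\<dots> = ennreal X * (ennreal (2 ^ (n + 5) * (p - s) * real n ^ n) * E)"
    using X p by (subst ennreal_mult) (auto simp: mult.assoc)
  finally have "ennreal (h powr p * r powr (real n - s)) \<le> ennreal (2 ^ (n + 5) * (p - s) * real n ^ n) * E"
    by (rule ennreal_mult_le_cancel[OF X])
  then show ?thesis by (simp add: n_def r_def E_def)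
qed

text \<open>Maximal straddling cubes are disjoint, so their energies add up. In each of them the growth condition turns
  the oscillation estimate into a bound for the weight.\<close>

lemma weight_transition:
  fixes g :: "real ^ 'n \<Rightarrow> real"
  assumes [measurable]: "g \<in> borel_measurable borel" "G \<in> sets borel" "G' \<in> sets borel"
    and p: "1 \<le> p" "s < p" and h: "0 < h"
    and jump: "\<And>x y. x \<in> Q \<Longrightarrow> y \<in> Q \<Longrightarrow> x \<notin> G \<Longrightarrow> y \<in> G' \<Longrightarrow> h \<le> \<bar>g x - g y\<bar>"
  shows "ennreal (h powr p) * emeasure W (transition G G') \<le>
     ennreal (A * (2 ^ (CARD('n) + 5) * (p - s) * real CARD('n) ^ CARD('n))) * (\<integral>\<^sup>+x\<in>Q. energy_density s p g Q x \<partial>lborel)"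
proof -
  define C where "C = 2 ^ (CARD('n) + 5) * (p - s) * real CARD('n) ^ CARD('n)"
  have C: "0 \<le> C" using p by (simp add: C_def)
  define N where "N = density lborel (energy_density s p g Q)"
  have N: "emeasure N S = (\<integral>\<^sup>+x\<in>S. energy_density s p g Q x \<partial>lborel)" if "S \<in> sets borel" for S
    using that by (simp add: N_def emeasure_density)
  obtain F where F: "countable F" "disjoint F" "\<Union>F = {x \<in> Q. \<exists>k. straddling G G' (dyadic_cube a l k x)}"
    and FD: "\<And>D. D \<in> F \<Longrightarrow> \<exists>k. \<exists>x\<in>Q. D = dyadic_cube a l k x \<and> straddling G G' D \<and> (\<forall>j<k. \<not> straddling G G' (dyadic_cube a l j x))"
    and Fm: "\<And>D. D \<in> F \<Longrightarrow> D \<in> sets borel"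
    by (rule maximal[of "straddling G G'"]) (rule that)
  have "emeasure W (\<Union>F \<inter> UNIV) \<le> ennreal (A * C / h powr p) * emeasure N (\<Union>F \<inter> UNIV)"
  proof (rule emeasure_le_on_pieces[OF F(1,2)])
    fix D assume DF: "D \<in> F"
    from FD[OF DF] obtain k x where x: "x \<in> Q" and D: "D = dyadic_cube a l k x" and str: "straddling G G' D" by blast
    have [measurable]: "D \<in> sets borel" by (simp add: D)
    have DQ: "D \<subseteq> Q" using sub_cube[OF x] D by simp
    define r where "r = (l / 2 ^ k) powr (real CARD('n) - s)"
    have "emeasure W D \<le> ennreal (A * r)" using growth[OF x, of k] D by (simp add: r_def)
    also have "\<dots> = ennreal (A / h powr p) * ennreal (h powr p * r)"
      using A h by (subst ennreal_mult[symmetric]) (auto simp: r_def)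
    also have "\<dots> \<le> ennreal (A / h powr p) * (ennreal C * (\<integral>\<^sup>+x\<in>D. energy_density s p g D x \<partial>lborel))"
      using oscillation_in_cube[OF assms(1-3) p h jump x D str] unfolding r_def C_def by (intro mult_left_mono) auto
    also have "\<dots> \<le> ennreal (A / h powr p) * (ennreal C * emeasure N D)"
      unfolding N[OF \<open>D \<in> sets borel\<close>]
      by (intro mult_left_mono nn_integral_mono mult_right_mono energy_density_mono DQ) auto
    also have "\<dots> = ennreal (A * C / h powr p) * emeasure N D"
      using A C h by (subst mult.assoc[symmetric], subst ennreal_mult[symmetric]) auto
    finally show "emeasure W (D \<inter> UNIV) \<le> ennreal (A * C / h powr p) * emeasure N (D \<inter> UNIV)" by simp
  qed (use Fm in \<open>auto simp: N_def\<close>)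
  then have "emeasure W (transition G G') \<le> ennreal (A * C / h powr p) * emeasure N (transition G G')"
    by (simp add: F(3) transition_def)
  also have "\<dots> \<le> ennreal (A * C / h powr p) * emeasure N Q"
    by (intro mult_left_mono emeasure_mono) (auto simp: N_def transition_def)
  finally have "ennreal (h powr p) * emeasure W (transition G G') \<le> ennreal (h powr p) * (ennreal (A * C / h powr p) * emeasure N Q)"
    by (intro mult_left_mono) auto
  also have "\<dots> = ennreal (A * C) * emeasure N Q"
    using A C h by (subst mult.assoc[symmetric], subst ennreal_mult[symmetric]) auto
  finally show ?thesis by (simp add: N C_def)
qed

text \<open>The iteration of \<open>heavy_step\<close> over geometric levels. The hypothesis on \<open>{f > 0}\<close> makes \<open>heavy_step\<close>
  applicable at every positive level.\<close>

lemma weighted_half_vanishing: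
  fixes f :: "real ^ 'n \<Rightarrow> real"
  assumes f [measurable]: "f \<in> borel_measurable borel" and f0: "\<And>x. 0 \<le> f x"
    and p: "1 \<le> p" "s < p"
    and half: "2 * emeasure lborel {x \<in> Q. 0 < f x} \<le> emeasure lborel Q"
  shows "(\<integral>\<^sup>+x\<in>Q. ennreal (f x powr p) * w x \<partial>lborel) \<le>
     ennreal (A * (2 ^ (CARD('n) + 5) * (p - s) * real CARD('n) ^ CARD('n)) * (8 * p / \<sigma>) powr p) *
       (\<integral>\<^sup>+x\<in>Q. energy_density s p f Q x \<partial>lborel)"
proof -
  define C where "C = A * (2 ^ (CARD('n) + 5) * (p - s) * real CARD('n) ^ CARD('n))"
  have C: "0 \<le> C" using p A by (simp add: C_def)
  \<comment> \<open>Close enough to \<open>1\<close> for \<open>\<theta> powr p * (1 - \<sigma>) \<le> 1 - \<sigma> / 2\<close>, and otherwise as large as possible up to a constant: the slices should be high.\<close>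
  define \<theta> where "\<theta> = 1 + \<sigma> / (4 * p)"
  define E where "E = (\<integral>\<^sup>+x\<in>Q. energy_density s p f Q x \<partial>lborel)"
  have \<theta>1: "1 < \<theta>" using \<sigma> p by (simp add: \<theta>_def)
  have \<theta>p: "\<theta> powr p \<le> 1 + \<sigma> / 2"
  proof -
    have "\<theta> powr p \<le> exp (\<sigma> / (4 * p)) powr p"
      using \<theta>1 p unfolding \<theta>_def by (intro powr_mono2 exp_ge_add_one_self) auto
    also have "\<dots> = exp (\<sigma> / 4)" using p by (simp add: powr_def)
    also have "\<dots> \<le> 1 + \<sigma> / 4 + (\<sigma> / 4)\<^sup>2" using \<sigma> by (intro exp_bound) auto
    also have "\<dots> \<le> 1 + \<sigma> / 2"
    proof -
      have "\<sigma> * \<sigma> \<le> \<sigma>" using \<sigma> by (intro mult_left_le) auto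
      then have "(\<sigma> / 4)\<^sup>2 \<le> \<sigma> / 16" by (simp add: power2_eq_square)
      then show ?thesis using \<sigma> by linarith
    qed
    finally show ?thesis .
  qed
  have \<theta>ratio: "(\<theta> / (\<theta> - 1)) powr p \<le> (8 * p / \<sigma>) powr p"
  proof (intro powr_mono2)
    have "\<theta> / (\<theta> - 1) = 4 * p / \<sigma> + 1" using \<sigma> p by (simp add: \<theta>_def field_simps)
    also have "1 \<le> 4 * p / \<sigma>" using \<sigma> p by (simp add: field_simps)
    finally show "\<theta> / (\<theta> - 1) \<le> 8 * p / \<sigma>" by simp
  qed (use \<theta>1 p in auto)
  define WQ where "WQ = emeasure W Q"
  \<comment> \<open>\<open>c\<close> is the lowest level. The values below it contribute the first term, which tends to \<open>0\<close> with \<open>c\<close>.\<close>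
  have main: "(\<integral>\<^sup>+x\<in>Q. ennreal (f x powr p) * w x \<partial>lborel) \<le>
     ennreal (2 * c powr p) * WQ + ennreal (C * (8 * p / \<sigma>) powr p) * E" if c: "0 < c" for c
  proof -
    define b where "b k = c * \<theta> ^ k" for k
    define L where "L k = b k powr p" for k
    define G where "G k = {x \<in> Q. b k < f x}" for k
    define h where "h k = b (Suc k) - b k" for k
    define g where "g k x = slice (b k) (b (Suc k)) (f x)" for k x
    have b0: "0 < b k" for k using c \<theta>1 by (simp add: b_def)
    have h: "h k = b k * (\<theta> - 1)" for k by (simp add: h_def b_def algebra_simps)
    have h0: "0 < h k" for k using b0 \<theta>1 by (simp add: h)
    have incb: "incseq b" by (rule incseq_SucI) (use h0 in \<open>simp add: h_def less_imp_le\<close>)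
    have [measurable]: "G k \<in> sets borel" "g k \<in> borel_measurable borel" for k
      unfolding G_def g_def slice_def by measurable
    have GQ: "G k \<subseteq> Q" for k by (auto simp: G_def)
    have Gsub: "G (Suc k) \<subseteq> G k" for k
      using h0[of k] by (auto simp: G_def h_def)
    have Ghalf: "2 * emeasure lborel (G k) \<le> emeasure lborel Q" for k
    proof -
      have "emeasure lborel (G k) \<le> emeasure lborel {x \<in> Q. 0 < f x}"
        using b0[of k] by (intro emeasure_mono) (auto simp: G_def)
      then show ?thesis using half by (meson mult_left_mono order.trans zero_le)
    qed
    define A' where "A' k = emeasure W (heavy (G k))" for k
    define T where "T k = emeasure W (transition (G k) (G (Suc k)))" for k
    have L_Suc: "L (Suc k) = \<theta> powr p * L k" for k
      using b0[of k] \<theta>1 by (simp add: L_def b_def powr_mult mult.commute[of _ \<theta>] mult.left_commute[of c])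
    have L0: "0 \<le> L k" for k by (simp add: L_def)
    have step: "ennreal (L (Suc k)) * A' (Suc k) \<le> ennreal ((1 - \<sigma> / 2) * L k) * A' k + ennreal (L (Suc k)) * T k" for k
    proof -
      have "ennreal (L (Suc k)) * A' (Suc k) \<le> ennreal (L (Suc k)) * (ennreal (1 - \<sigma>) * A' k + T k)"
        unfolding A'_def T_def by (intro mult_left_mono heavy_step Gsub GQ Ghalf) auto
      also have "\<dots> = ennreal (L (Suc k) * (1 - \<sigma>)) * A' k + ennreal (L (Suc k)) * T k"
        using L0 \<sigma> by (simp add: distrib_left ennreal_mult mult.assoc)
      also have "\<dots> \<le> ennreal ((1 - \<sigma> / 2) * L k) * A' k + ennreal (L (Suc k)) * T k"
      proof (intro add_right_mono mult_right_mono ennreal_leI)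
        have "\<theta> powr p * (1 - \<sigma>) \<le> (1 + \<sigma> / 2) * (1 - \<sigma>)" using \<theta>p \<sigma> by (intro mult_right_mono) auto
        also have "\<dots> \<le> 1 - \<sigma> / 2" using \<sigma> by (simp add: algebra_simps)
        finally have "L k * (\<theta> powr p * (1 - \<sigma>)) \<le> L k * (1 - \<sigma> / 2)" using L0 by (intro mult_left_mono)
        then show "L (Suc k) * (1 - \<sigma>) \<le> (1 - \<sigma> / 2) * L k" by (simp add: L_Suc mult_ac)
      qed auto
      finally show ?thesis .
    qed
    \<comment> \<open>The recursion with the weights \<open>L k\<close>, summed. Keeping the last term makes the induction work without any subtraction.\<close>
    have tele: "ennreal (\<sigma> / 2) * (\<Sum>k<K. ennreal (L k) * A' k) + ennreal (L K) * A' K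
        \<le> ennreal (L 0) * A' 0 + (\<Sum>k<K. ennreal (L (Suc k)) * T k)" for K
    proof (induction K)
      case (Suc K)
      have "ennreal (\<sigma> / 2) * (\<Sum>k<Suc K. ennreal (L k) * A' k) + ennreal (L (Suc K)) * A' (Suc K) \<le>
        ennreal (\<sigma> / 2) * (\<Sum>k<Suc K. ennreal (L k) * A' k) + (ennreal ((1 - \<sigma> / 2) * L K) * A' K + ennreal (L (Suc K)) * T K)"
        by (intro add_left_mono step)
      also have "\<dots> = ennreal (\<sigma> / 2) * (\<Sum>k<K. ennreal (L k) * A' k) +
          (ennreal (\<sigma> / 2) * ennreal (L K) + ennreal ((1 - \<sigma> / 2) * L K)) * A' K + ennreal (L (Suc K)) * T K"
        using \<sigma> L0 by (simp add: distrib_left distrib_right ennreal_mult mult.assoc add.assoc)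
      also have "ennreal (\<sigma> / 2) * ennreal (L K) + ennreal ((1 - \<sigma> / 2) * L K) = ennreal (L K)"
      proof -
        have "ennreal (\<sigma> / 2) * ennreal (L K) + ennreal ((1 - \<sigma> / 2) * L K) = ennreal (\<sigma> / 2 * L K + (1 - \<sigma> / 2) * L K)"
          using \<sigma> L0[of K] by (simp add: ennreal_mult[symmetric])
        also have "\<sigma> / 2 * L K + (1 - \<sigma> / 2) * L K = L K" by (simp add: algebra_simps)
        finally show ?thesis .
      qed
      also have "ennreal (\<sigma> / 2) * (\<Sum>k<K. ennreal (L k) * A' k) + ennreal (L K) * A' K + ennreal (L (Suc K)) * T K
          \<le> ennreal (L 0) * A' 0 + (\<Sum>k<K. ennreal (L (Suc k)) * T k) + ennreal (L (Suc K)) * T K"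
        by (intro add_right_mono Suc.IH)
      finally show ?case by (simp add: add.assoc)
    qed simp
    have energy_sum: "(\<Sum>k<K. \<integral>\<^sup>+x\<in>Q. energy_density s p (g k) Q x \<partial>lborel) \<le> E" for K
    proof -
      have pt: "(\<Sum>k<K. energy_density s p (g k) Q x) \<le> energy_density s p f Q x" for x
      proof -
        have "(\<Sum>k<K. energy_density s p (g k) Q x) =
          (\<integral>\<^sup>+y. (\<Sum>k<K. ennreal (\<bar>g k x - g k y\<bar> powr p / norm (x - y) powr (real CARD('n) + s)) * indicator Q y) \<partial>lborel)"
          unfolding energy_density_def by (subst nn_integral_sum) auto
        also have "\<dots> \<le> energy_density s p f Q x"
          unfolding energy_density_def sum_distrib_right[symmetric]
        proof (intro nn_integral_mono mult_right_mono)
          fix y :: "real^'n"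
          show "(\<Sum>k<K. ennreal (\<bar>g k x - g k y\<bar> powr p / norm (x - y) powr (real CARD('n) + s)))
             \<le> ennreal (\<bar>f x - f y\<bar> powr p / norm (x - y) powr (real CARD('n) + s))"
            using sum_slice_diff_powr[OF incb p(1), where K=K and t="f x" and t'="f y"]
            by (auto simp: sum_divide_distrib[symmetric] g_def intro!: ennreal_leI divide_right_mono)
        qed auto
        finally show ?thesis .
      qed
      have "(\<Sum>k<K. \<integral>\<^sup>+x\<in>Q. energy_density s p (g k) Q x \<partial>lborel) = (\<integral>\<^sup>+x. (\<Sum>k<K. energy_density s p (g k) Q x * indicator Q x) \<partial>lborel)"
        by (subst nn_integral_sum) auto
      also have "\<dots> \<le> E" unfolding E_def sum_distrib_right[symmetric]
        by (intro nn_integral_mono mult_right_mono pt) auto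
      finally show ?thesis .
    qed
    have T: "ennreal (L (Suc k)) * T k \<le> ennreal (C * (8 * p / \<sigma>) powr p) * (\<integral>\<^sup>+x\<in>Q. energy_density s p (g k) Q x \<partial>lborel)" for k
    proof -
      have "L (Suc k) = (\<theta> / (\<theta> - 1)) powr p * h k powr p"
        using \<theta>1 b0[of k] by (subst powr_mult[symmetric]) (auto simp: L_def h b_def mult_ac)
      also have "\<dots> \<le> (8 * p / \<sigma>) powr p * h k powr p" using \<theta>ratio by (intro mult_right_mono) auto
      finally have "ennreal (L (Suc k)) * T k \<le> ennreal ((8 * p / \<sigma>) powr p * h k powr p) * T k"
        by (intro mult_right_mono ennreal_leI) auto
      also have "\<dots> = ennreal ((8 * p / \<sigma>) powr p) * (ennreal (h k powr p) * T k)"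
        by (simp add: ennreal_mult mult.assoc)
      also have "\<dots> \<le> ennreal ((8 * p / \<sigma>) powr p) * (ennreal C * (\<integral>\<^sup>+x\<in>Q. energy_density s p (g k) Q x \<partial>lborel))"
        unfolding T_def C_def
      proof (intro mult_left_mono weight_transition p h0)
        show "h k \<le> \<bar>g k x - g k y\<bar>" if "x \<in> Q" "y \<in> Q" "x \<notin> G k" "y \<in> G (Suc k)" for x y
          using that h0[of k] by (auto simp: G_def g_def slice_def h_def)
      qed auto
      finally show ?thesis using C by (simp add: ennreal_mult mult_ac)
    qed
    \<comment> \<open>The layer cake factor \<open>\<theta> powr p - 1 \<le> \<sigma> / 2\<close> is exactly what the summed recursion can absorb.\<close>
    have bound: "(\<Sum>k<K. ennreal ((\<theta> powr p - 1) * L k) * A' k) \<le> ennreal (c powr p) * WQ + ennreal (C * (8 * p / \<sigma>) powr p) * E" for K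
    proof -
      have "(\<Sum>k<K. ennreal ((\<theta> powr p - 1) * L k) * A' k) \<le> (\<Sum>k<K. ennreal (\<sigma> / 2 * L k) * A' k)"
        using \<theta>p L0 by (intro sum_mono mult_right_mono ennreal_leI) auto
      also have "\<dots> = ennreal (\<sigma> / 2) * (\<Sum>k<K. ennreal (L k) * A' k)"
        unfolding sum_distrib_left
        by (intro sum.cong refl, subst ennreal_mult) (use \<sigma> L0 in \<open>auto simp: mult.assoc\<close>)
      also have "\<dots> \<le> ennreal (\<sigma> / 2) * (\<Sum>k<K. ennreal (L k) * A' k) + ennreal (L K) * A' K" by simp
      also have "\<dots> \<le> ennreal (L 0) * A' 0 + (\<Sum>k<K. ennreal (L (Suc k)) * T k)" by (rule tele)
      also have "\<dots> \<le> ennreal (c powr p) * WQ + ennreal (C * (8 * p / \<sigma>) powr p) * E"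
      proof (intro add_mono)
        show "ennreal (L 0) * A' 0 \<le> ennreal (c powr p) * WQ"
          unfolding A'_def WQ_def L_def b_def by (auto intro!: mult_left_mono emeasure_mono heavy_subset)
        have "(\<Sum>k<K. ennreal (L (Suc k)) * T k) \<le>
           ennreal (C * (8 * p / \<sigma>) powr p) * (\<Sum>k<K. \<integral>\<^sup>+x\<in>Q. energy_density s p (g k) Q x \<partial>lborel)"
          unfolding sum_distrib_left by (intro sum_mono T)
        also have "\<dots> \<le> ennreal (C * (8 * p / \<sigma>) powr p) * E" by (intro mult_left_mono energy_sum) auto
        finally show "(\<Sum>k<K. ennreal (L (Suc k)) * T k) \<le> ennreal (C * (8 * p / \<sigma>) powr p) * E" .
      qed
      finally show ?thesis .
    qed
    have GA: "emeasure W (G k) \<le> A' k" for k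
    proof -
      have null: "emeasure W (G k - heavy (G k)) = 0"
      proof -
        have "G k - heavy (G k) \<in> null_sets lborel"
          using null_outside_heavy[of "G k"] GQ by (auto intro!: null_setsI)
        then have "AE x in lborel. x \<notin> G k - heavy (G k)" by (rule AE_not_in)
        then have "(\<integral>\<^sup>+x\<in>G k - heavy (G k). w x \<partial>lborel) = (\<integral>\<^sup>+x. 0 \<partial>(lborel :: (real^'n) measure))"
          by (intro nn_integral_cong_AE) (auto elim!: AE_mp)
        then show ?thesis by (simp add: W_def emeasure_density)
      qed
      have "emeasure W (G k) \<le> emeasure W ((G k - heavy (G k)) \<union> heavy (G k))"
        by (intro emeasure_mono) auto
      also have "\<dots> \<le> emeasure W (G k - heavy (G k)) + emeasure W (heavy (G k))"
        by (intro emeasure_subadditive) auto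
      finally show ?thesis by (simp add: null A'_def)
    qed
    have "(\<integral>\<^sup>+x\<in>Q. ennreal (f x powr p) * w x \<partial>lborel) \<le>
       (\<integral>\<^sup>+x. ennreal (c powr p) * (w x * indicator Q x) + (\<Sum>k. ennreal ((\<theta> powr p - 1) * L k) * (w x * indicator (G k) x)) \<partial>lborel)"
    proof (intro nn_integral_mono)
      fix x :: "real^'n"
      have "(\<Sum>k. ennreal ((\<theta> powr p - 1) * L k) * (w x * indicator (G k) x))
         = (\<Sum>k. ennreal ((\<theta> powr p - 1) * L k) * (if b k < f x then 1 else 0)) * (w x * indicator Q x)"
        unfolding ennreal_suminf_multc[symmetric]
        by (intro suminf_cong) (auto simp: G_def indicator_def)
      moreover have "ennreal (f x powr p) \<le> ennreal (c powr p) +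
          (\<Sum>k. ennreal ((\<theta> powr p - 1) * L k) * (if b k < f x then 1 else 0))"
        unfolding L_def b_def using c \<theta>1 p f0 by (intro powr_le_sum_levels) auto
      ultimately show "ennreal (f x powr p) * w x * indicator Q x \<le>
          ennreal (c powr p) * (w x * indicator Q x) + (\<Sum>k. ennreal ((\<theta> powr p - 1) * L k) * (w x * indicator (G k) x))"
        by (simp add: distrib_right[symmetric] mult_right_mono mult.assoc)
    qed
    also have "\<dots> = ennreal (c powr p) * WQ + (\<Sum>k. ennreal ((\<theta> powr p - 1) * L k) * emeasure W (G k))"
      by (simp add: nn_integral_add nn_integral_cmult nn_integral_suminf WQ_def W_def emeasure_density)
    also have "\<dots> \<le> ennreal (c powr p) * WQ + (ennreal (c powr p) * WQ + ennreal (C * (8 * p / \<sigma>) powr p) * E)"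
    proof (intro add_left_mono)
      have "(\<Sum>k<K. ennreal ((\<theta> powr p - 1) * L k) * emeasure W (G k)) \<le>
          ennreal (c powr p) * WQ + ennreal (C * (8 * p / \<sigma>) powr p) * E" for K
        by (rule order.trans[OF _ bound[of K]]) (intro sum_mono mult_left_mono GA; simp)
      then show "(\<Sum>k. ennreal ((\<theta> powr p - 1) * L k) * emeasure W (G k)) \<le>
          ennreal (c powr p) * WQ + ennreal (C * (8 * p / \<sigma>) powr p) * E"
        unfolding suminf_eq_SUP by (intro SUP_least)
    qed
    also have "\<dots> = ennreal (2 * c powr p) * WQ + ennreal (C * (8 * p / \<sigma>) powr p) * E"
    proof -
      have "ennreal (2 * c powr p) = ennreal (c powr p) + ennreal (c powr p)"
        by (subst ennreal_plus[symmetric]) auto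
      then show ?thesis by (simp only: distrib_right add.assoc)
    qed
    finally show ?thesis .
  qed
  obtain \<omega> where \<omega>: "0 \<le> \<omega>" "WQ = ennreal \<omega>"
    using W_Q_finite by (auto simp: WQ_def less_top_ennreal)
  have "(\<integral>\<^sup>+x\<in>Q. ennreal (f x powr p) * w x \<partial>lborel) \<le> ennreal (C * (8 * p / \<sigma>) powr p) * E"
  proof (rule ennreal_le_epsilon)
    fix e :: real assume e: "0 < e"
    define c where "c = (e / (2 * (\<omega> + 1))) powr (1 / p)"
    have c: "0 < c" using e \<omega> by (simp add: c_def)
    have "c powr p = e / (2 * (\<omega> + 1))" using e \<omega> p by (simp add: c_def powr_powr)
    moreover have "0 < 2 * (\<omega> + 1)" using \<omega> by simp
    ultimately have "2 * c powr p * (\<omega> + 1) = e" by (simp add: field_simps)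
    moreover have "0 \<le> c powr p" by simp
    ultimately have "2 * c powr p * \<omega> \<le> e" unfolding distrib_left by linarith
    then have small: "ennreal (2 * c powr p) * WQ \<le> ennreal e"
      using \<omega> by (simp add: ennreal_mult[symmetric] ennreal_leI)
    have "(\<integral>\<^sup>+x\<in>Q. ennreal (f x powr p) * w x \<partial>lborel) \<le> ennreal (2 * c powr p) * WQ + ennreal (C * (8 * p / \<sigma>) powr p) * E"
      by (rule main[OF c])
    also have "\<dots> \<le> ennreal e + ennreal (C * (8 * p / \<sigma>) powr p) * E" by (intro add_right_mono small)
    also have "\<dots> = ennreal (C * (8 * p / \<sigma>) powr p) * E + ennreal e" by (rule add.commute)
    finally show "(\<integral>\<^sup>+x\<in>Q. ennreal (f x powr p) * w x \<partial>lborel) \<le> ennreal (C * (8 * p / \<sigma>) powr p) * E + ennreal e" .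
  qed
  then show ?thesis by (simp add: C_def E_def)
qed

end

text \<open>The median is the infimum of the levels that \<open>u\<close> exceeds on at most half of \<open>Q\<close>. Both inequalities pass to
  the infimum by continuity of the measure along monotone sequences.\<close>

lemma median_exists:
  fixes u :: "'a::euclidean_space \<Rightarrow> real"
  assumes u [measurable]: "u \<in> borel_measurable borel" and Q [measurable]: "Q \<in> sets borel"
    and fin: "emeasure lborel Q < \<infinity>" and pos: "0 < emeasure lborel Q"
  obtains c where "2 * emeasure lborel {x \<in> Q. c < u x} \<le> emeasure lborel Q"
    "2 * emeasure lborel {x \<in> Q. u x < c} \<le> emeasure lborel Q"
proof -
  define q where "q = measure lborel Q"
  define G where "G t = measure lborel {x \<in> Q. t < u x}" for t
  define L where "L t = measure lborel {x \<in> Q. u x \<le> t}" for t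
  have finS: "emeasure lborel S < \<infinity>" if "S \<subseteq> Q" for S
    using that by (intro le_less_trans[OF emeasure_mono fin]) auto
  have eqm: "emeasure lborel S = ennreal (measure lborel S)" if "S \<subseteq> Q" for S
    using finS[OF that] by (intro emeasure_eq_ennreal_measure) auto
  have q: "0 < q" using pos unfolding eqm[OF order.refl] by (simp add: q_def)
  have mono: "measure lborel S \<le> measure lborel T" if "S \<subseteq> T" "T \<subseteq> Q" "T \<in> sets borel" for S T
  proof -
    have "emeasure lborel S \<le> emeasure lborel T" using that by (intro emeasure_mono) auto
    then show ?thesis using that by (subst (asm) (1 2) eqm) auto
  qed
  have GL: "G t + L t = q" for t
  proof -
    have "emeasure lborel {x \<in> Q. t < u x} + emeasure lborel {x \<in> Q. u x \<le> t} = emeasure lborel Q"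
      by (subst plus_emeasure) (auto intro!: arg_cong[where f="emeasure lborel"])
    then have "ennreal (G t) + ennreal (L t) = ennreal q"
      unfolding G_def L_def q_def by (subst (asm) (1 2 3) eqm) auto
    then show ?thesis using q by (simp add: G_def L_def ennreal_plus[symmetric] del: ennreal_plus)
  qed
  have Gmono: "G t' \<le> G t" if "t \<le> t'" for t t'
    unfolding G_def using that by (intro mono) auto
  define T where "T = {t. 2 * G t \<le> q}"
  have tail: "\<exists>k::nat. measure lborel {x \<in> Q. real k < v x} < q / 2"
    if [measurable]: "v \<in> borel_measurable borel" for v :: "'a \<Rightarrow> real"
  proof -
    define A where "A k = {x \<in> Q. real k < v x}" for k
    have "(\<lambda>k. measure lborel (A k)) \<longlonglongrightarrow> measure lborel (\<Inter>k. A k)"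
    proof (rule Lim_measure_decseq)
      show "range A \<subseteq> sets lborel" unfolding A_def by auto
      show "emeasure lborel (A k) \<noteq> \<infinity>" for k using finS[of "A k"] by (auto simp: A_def)
      show "decseq A" unfolding A_def decseq_def by force
    qed
    moreover have "(\<Inter>k. A k) = {}"
    proof -
      have "\<exists>k. \<not> real k < v x" for x using real_arch_simple[of "v x"] by (auto simp: not_less)
      then show ?thesis by (auto simp: A_def)
    qed
    ultimately have "(\<lambda>k. measure lborel (A k)) \<longlonglongrightarrow> 0" by simp
    then have "\<forall>\<^sub>F k in sequentially. measure lborel (A k) < q / 2" using q by (intro order_tendstoD) auto
    then show ?thesis by (auto simp: eventually_sequentially A_def)
  qed
  have limit: "2 * measure lborel {x \<in> Q. 0 < v x} \<le> q"
    if [measurable]: "v \<in> borel_measurable borel"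
      and le: "\<And>e. 0 < e \<Longrightarrow> 2 * measure lborel {x \<in> Q. e < v x} \<le> q" for v :: "'a \<Rightarrow> real"
  proof -
    define A where "A k = {x \<in> Q. inverse (real (Suc k)) < v x}" for k
    have UA: "(\<Union>k. A k) = {x \<in> Q. 0 < v x}"
    proof -
      have "\<exists>k. inverse (real (Suc k)) < v x" if "0 < v x" for x using that by (rule reals_Archimedean)
      moreover have "0 < v x" if "inverse (real (Suc k)) < v x" for x k
        using that by (rule less_trans[rotated]) simp
      ultimately show ?thesis unfolding A_def by blast
    qed
    have "(\<lambda>k. measure lborel (A k)) \<longlonglongrightarrow> measure lborel (\<Union>k. A k)"
    proof (rule Lim_measure_incseq)
      show "range A \<subseteq> sets lborel" unfolding A_def by auto
      show "emeasure lborel (\<Union>k. A k) \<noteq> \<infinity>" unfolding UA by (rule less_imp_neq[OF finS]) auto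
      show "incseq A"
      proof (rule incseq_SucI)
        fix k
        have "inverse (real (Suc (Suc k))) \<le> inverse (real (Suc k))" by (intro le_imp_inverse_le) auto
        then have "inverse (real (Suc (Suc k))) < t" if "inverse (real (Suc k)) < t" for t
          using that by linarith
        then show "A k \<subseteq> A (Suc k)" unfolding A_def by blast
      qed
    qed
    then have "(\<lambda>k. 2 * measure lborel (A k)) \<longlonglongrightarrow> 2 * measure lborel {x \<in> Q. 0 < v x}"
      unfolding UA by (intro tendsto_mult_left)
    moreover have "\<exists>N. \<forall>k\<ge>N. 2 * measure lborel (A k) \<le> q"
      using le[of "inverse (real (Suc k))" for k] by (simp add: A_def del: of_nat_Suc)
    ultimately show ?thesis by (rule LIMSEQ_le_const2)
  qed
  from tail[OF u] obtain k where k: "measure lborel {x \<in> Q. real k < u x} < q / 2" by blast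
  then have up: "T \<noteq> {}" by (auto simp: T_def G_def intro: exI[of _ "real k"])
  have "(\<lambda>x. - u x) \<in> borel_measurable borel" by measurable
  from tail[OF this] obtain k' where k': "measure lborel {x \<in> Q. real k' < - u x} < q / 2" by blast
  have "- real k' \<le> t" if "t \<in> T" for t
  proof (rule ccontr)
    assume "\<not> - real k' \<le> t"
    then have "L t \<le> measure lborel {x \<in> Q. real k' < - u x}" unfolding L_def by (intro mono) auto
    then show False using k' GL[of t] that by (simp add: T_def)
  qed
  then have bdd: "bdd_below T" by (auto simp: bdd_below_def)
  define c where "c = Inf T"
  have above: "2 * G t \<le> q" if "c < t" for t
  proof -
    from cInf_lessD[OF up] that obtain t' where "t' \<in> T" "t' < t" by (auto simp: c_def)
    then show ?thesis using Gmono[of t' t] by (simp add: T_def)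
  qed
  have below: "2 * L t \<le> q" if "t < c" for t
  proof -
    have "t \<notin> T" using cInf_lower[OF _ bdd, of t] that by (auto simp: c_def)
    then show ?thesis using GL[of t] by (simp add: T_def)
  qed
  have "2 * measure lborel {x \<in> Q. 0 < u x - c} \<le> q"
  proof (rule limit)
    fix e :: real assume "0 < e"
    then have "measure lborel {x \<in> Q. e < u x - c} \<le> G (c + e)" unfolding G_def by (intro mono) auto
    then show "2 * measure lborel {x \<in> Q. e < u x - c} \<le> q" using above[of "c + e"] \<open>0 < e\<close> by simp
  qed measurable
  then have upper: "2 * measure lborel {x \<in> Q. c < u x} \<le> q" by simp
  have "2 * measure lborel {x \<in> Q. 0 < c - u x} \<le> q"
  proof (rule limit)
    fix e :: real assume "0 < e"
    then have "measure lborel {x \<in> Q. e < c - u x} \<le> L (c - e)" unfolding L_def by (intro mono) auto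
    then show "2 * measure lborel {x \<in> Q. e < c - u x} \<le> q" using below[of "c - e"] \<open>0 < e\<close> by simp
  qed measurable
  then have lower: "2 * measure lborel {x \<in> Q. u x < c} \<le> q" by simp
  have conv: "2 * emeasure lborel S \<le> emeasure lborel Q" if "S \<subseteq> Q" "2 * measure lborel S \<le> q" for S
  proof -
    have "2 * emeasure lborel S = ennreal (2 * measure lborel S)"
      unfolding eqm[OF that(1)] by (subst ennreal_mult) auto
    also have "\<dots> \<le> emeasure lborel Q" unfolding eqm[OF order.refl] using that by (intro ennreal_leI) (simp add: q_def)
    finally show ?thesis .
  qed
  show ?thesis by (rule that[of c]; rule conv) (use upper lower in auto)
qed

lemma (in dyadic_weight) weighted_median:
  fixes u :: "real ^ 'n \<Rightarrow> real"
  assumes u [measurable]: "u \<in> borel_measurable borel" and p: "1 \<le> p" "s < p"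
  obtains c where "(\<integral>\<^sup>+x\<in>Q. ennreal (\<bar>u x - c\<bar> powr p) * w x \<partial>lborel) \<le>
     ennreal (2 * (A * (2 ^ (CARD('n) + 5) * (p - s) * real CARD('n) ^ CARD('n)) * (8 * p / \<sigma>) powr p)) *
       (\<integral>\<^sup>+x\<in>Q. energy_density s p u Q x \<partial>lborel)"
proof -
  define C where "C = A * (2 ^ (CARD('n) + 5) * (p - s) * real CARD('n) ^ CARD('n)) * (8 * p / \<sigma>) powr p"
  have C: "0 \<le> C" using A p by (simp add: C_def)
  define E where "E = (\<integral>\<^sup>+x\<in>Q. energy_density s p u Q x \<partial>lborel)"
  have "emeasure lborel Q = ennreal (l ^ CARD('n))" using l by (simp add: Q_def emeasure_dyadic_cube)
  then have "emeasure lborel Q < \<infinity>" "0 < emeasure lborel Q" using l by simp_all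
  then obtain c where c: "2 * emeasure lborel {x \<in> Q. c < u x} \<le> emeasure lborel Q"
    "2 * emeasure lborel {x \<in> Q. u x < c} \<le> emeasure lborel Q"
    by (rule median_exists[OF u Q_sets])
  have part: "(\<integral>\<^sup>+x\<in>Q. ennreal (f x powr p) * w x \<partial>lborel) \<le> ennreal C * E"
    if [measurable]: "f \<in> borel_measurable borel" and "\<And>x. 0 \<le> f x"
      and half: "2 * emeasure lborel {x \<in> Q. 0 < f x} \<le> emeasure lborel Q"
      and lip: "\<And>x y. \<bar>f x - f y\<bar> \<le> \<bar>u x - u y\<bar>" for f
  proof -
    have "(\<integral>\<^sup>+x\<in>Q. ennreal (f x powr p) * w x \<partial>lborel) \<le> ennreal C * (\<integral>\<^sup>+x\<in>Q. energy_density s p f Q x \<partial>lborel)"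
      unfolding C_def by (rule weighted_half_vanishing[OF _ _ p]) fact+
    also have "\<dots> \<le> ennreal C * E"
      unfolding E_def energy_density_def
      by (intro mult_left_mono nn_integral_mono mult_right_mono ennreal_leI divide_right_mono powr_mono2 lip) (use p in auto)
    finally show ?thesis .
  qed
  have "(\<integral>\<^sup>+x\<in>Q. ennreal (\<bar>u x - c\<bar> powr p) * w x \<partial>lborel) \<le>
     (\<integral>\<^sup>+x. ennreal (max (u x - c) 0 powr p) * w x * indicator Q x + ennreal (max (c - u x) 0 powr p) * w x * indicator Q x \<partial>lborel)"
  proof (intro nn_integral_mono)
    fix x
    show "ennreal (\<bar>u x - c\<bar> powr p) * w x * indicator Q x \<le>
      ennreal (max (u x - c) 0 powr p) * w x * indicator Q x + ennreal (max (c - u x) 0 powr p) * w x * indicator Q x"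
      by (cases "c \<le> u x") (auto simp: abs_if max_def)
  qed
  also have "\<dots> = (\<integral>\<^sup>+x\<in>Q. ennreal (max (u x - c) 0 powr p) * w x \<partial>lborel) + (\<integral>\<^sup>+x\<in>Q. ennreal (max (c - u x) 0 powr p) * w x \<partial>lborel)"
    by (intro nn_integral_add) auto
  also have "\<dots> \<le> ennreal C * E + ennreal C * E"
  proof (intro add_mono part)
    show "2 * emeasure lborel {x \<in> Q. 0 < max (u x - c) 0} \<le> emeasure lborel Q"
      using c(1) by (simp add: less_max_iff_disj)
    show "2 * emeasure lborel {x \<in> Q. 0 < max (c - u x) 0} \<le> emeasure lborel Q"
      using c(2) by (simp add: less_max_iff_disj)
  qed auto
  also have "\<dots> = ennreal (2 * C) * E"
  proof -
    have "ennreal (2 * C) = ennreal C + ennreal C" using C by (subst ennreal_plus[symmetric]) auto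
    then show ?thesis by (simp only: distrib_right)
  qed
  finally show ?thesis by (intro that) (simp add: C_def E_def)
qed

section \<open>A maximal weight with centred balls\<close>

text \<open>A version of the weight with centred balls in place of cubes. It is lower semicontinuous, and the
  covering lemma applies to it directly.\<close>

definition ball_weight :: "real \<Rightarrow> real \<Rightarrow> (real ^ 'n) measure \<Rightarrow> real ^ 'n \<Rightarrow> ennreal" where
  "ball_weight \<beta> s \<mu> x = (SUP r\<in>{0<..}. ennreal (measure \<mu> (ball x r) powr \<beta> * r powr (- s)))"

lemma ball_weight_upper:
  "0 < r \<Longrightarrow> ennreal (measure \<mu> (ball x r) powr \<beta> * r powr (- s)) \<le> ball_weight \<beta> s \<mu> x"
  unfolding ball_weight_def by (rule SUP_upper) simp

lemma ball_weight_measurable [measurable]: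
  fixes \<mu> :: "(real ^ 'n) measure"
  assumes "finite_measure \<mu>" and sets: "sets \<mu> = sets borel" and \<beta>: "0 < \<beta>"
  shows "ball_weight \<beta> s \<mu> \<in> borel_measurable borel"
proof (rule borel_measurableI_greater)
  interpret finite_measure \<mu> by fact
  fix t :: ennreal
  have "open {x. t < ball_weight \<beta> s \<mu> x}"
  proof (rule openI)
    fix x assume "x \<in> {x. t < ball_weight \<beta> s \<mu> x}"
    then obtain r where r: "0 < r" "t < ennreal (measure \<mu> (ball x r) powr \<beta> * r powr (- s))"
      by (auto simp: ball_weight_def less_SUP_iff)
    have "((\<lambda>e. ennreal (measure \<mu> (ball x r) powr \<beta> * (r + e) powr (- s))) \<longlongrightarrow>
        ennreal (measure \<mu> (ball x r) powr \<beta> * (r + 0) powr (- s))) (at_right 0)"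
      using r by (intro tendsto_ennrealI tendsto_intros) auto
    then have "\<forall>\<^sub>F e in at_right 0. t < ennreal (measure \<mu> (ball x r) powr \<beta> * (r + e) powr (- s))"
      using r by (intro order_tendstoD) auto
    then have "\<forall>\<^sub>F e in at_right 0. t < ennreal (measure \<mu> (ball x r) powr \<beta> * (r + e) powr (- s)) \<and> 0 < e"
      by (intro eventually_conj eventually_at_right_less)
    then obtain e where e: "0 < e" "t < ennreal (measure \<mu> (ball x r) powr \<beta> * (r + e) powr (- s))"
      using eventually_happens trivial_limit_at_right_real by blast
    have "ball x e \<subseteq> {x. t < ball_weight \<beta> s \<mu> x}"
    proof
      fix y assume y: "y \<in> ball x e"
      have "ball x r \<subseteq> ball y (r + e)"
        using y dist_triangle2[of y _ x] by (auto simp: dist_commute) (smt (verit) dist_commute dist_triangle)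
      then have "measure \<mu> (ball x r) \<le> measure \<mu> (ball y (r + e))"
        using sets by (intro finite_measure_mono) auto
      then have "measure \<mu> (ball x r) powr \<beta> * (r + e) powr (- s) \<le> measure \<mu> (ball y (r + e)) powr \<beta> * (r + e) powr (- s)"
        using \<beta> by (intro mult_right_mono powr_mono2) auto
      then have "t < ennreal (measure \<mu> (ball y (r + e)) powr \<beta> * (r + e) powr (- s))"
        using e(2) by (meson ennreal_leI less_le_trans)
      also have "\<dots> \<le> ball_weight \<beta> s \<mu> y"
        using r e by (intro ball_weight_upper) auto
      finally show "y \<in> {x. t < ball_weight \<beta> s \<mu> x}" by simp
    qed
    then show "\<exists>e>0. ball x e \<subseteq> {x. t < ball_weight \<beta> s \<mu> x}" using e by blast
  qed
  then show "{x \<in> space borel. t < ball_weight \<beta> s \<mu> x} \<in> sets borel" by simp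
qed

lemma emeasure_ball_le:
  fixes x :: "real ^ 'n"
  assumes "0 \<le> r"
  shows "emeasure lborel (ball x r) \<le> ennreal ((2 * r) ^ CARD('n))"
proof -
  have "ball x r \<subseteq> {y. \<forall>i. (x - (\<chi> i. r)) $ i \<le> y $ i \<and> y $ i < (x - (\<chi> i. r)) $ i + 2 * r}"
  proof (intro subsetI CollectI allI)
    fix y i assume "y \<in> ball x r"
    then have "\<bar>(x - y) $ i\<bar> < r"
      using component_le_norm_cart[of "x - y" i] by (simp add: dist_norm)
    then show "(x - (\<chi> i. r)) $ i \<le> y $ i \<and> y $ i < (x - (\<chi> i. r)) $ i + 2 * r" by auto
  qed
  then have "emeasure lborel (ball x r) \<le> emeasure lborel {y. \<forall>i. (x - (\<chi> i. r)) $ i \<le> y $ i \<and> y $ i < (x - (\<chi> i. r)) $ i + 2 * r}"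
    by (intro emeasure_mono) (auto intro: halfopen_box_measurable)
  also have "\<dots> = ennreal ((2 * r) ^ CARD('n))" using assms by (intro emeasure_halfopen_box) simp
  finally show ?thesis .
qed

text \<open>A ball of radius \<open>r\<close> with \<open>\<mu>(ball) powr \<beta> * r powr (- s) > t\<close> satisfies
  \<open>r ^ n \<le> t powr (- n / s) * \<mu>(ball) powr q\<close> with \<open>q = \<beta> n / s\<close>. As \<open>q \<ge> 1\<close>, the sum of \<open>\<mu>(ball) powr q\<close> over
  disjoint balls is at most \<open>\<mu>(U) powr q\<close>, and by the Vitali covering lemma five times larger balls cover
  the set. A Borel set \<open>V\<close> is returned, so that nothing has to be proved about the measurability of the set
  itself.\<close>

lemma weak_type:
  fixes \<mu> :: "(real ^ 'n) measure"
  assumes fin: "finite_measure \<mu>" and sets: "sets \<mu> = sets borel"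
    and s: "0 < s" and \<beta>: "s \<le> \<beta> * real CARD('n)" and t: "0 < t"
    and U: "U \<in> sets borel" "\<And>x r. x \<in> P \<Longrightarrow> r \<le> d \<Longrightarrow> ball x r \<subseteq> U"
  obtains V where "V \<in> sets borel"
    "{x \<in> P. \<exists>r. 0 < r \<and> r \<le> d \<and> t < measure \<mu> (ball x r) powr \<beta> * r powr (- s)} \<subseteq> V"
    "emeasure lborel V \<le> ennreal (10 ^ CARD('n) * t powr (- (real CARD('n) / s)) * measure \<mu> U powr (\<beta> * real CARD('n) / s))"
proof -
  interpret finite_measure \<mu> by fact
  define n where "n = CARD('n)"
  define q where "q = \<beta> * real n / s"
  define \<nu> where "\<nu> = measure \<mu> U"
  have n: "0 < n" by (simp add: n_def)
  have q: "1 \<le> q" using \<beta> s by (simp add: q_def n_def)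
  define S where "S = {x \<in> P. \<exists>r. 0 < r \<and> r \<le> d \<and> t < measure \<mu> (ball x r) powr \<beta> * r powr (- s)}"
  have "\<forall>x\<in>S. \<exists>r. 0 < r \<and> r \<le> d \<and> t < measure \<mu> (ball x r) powr \<beta> * r powr (- s)" by (auto simp: S_def)
  then obtain r where r: "\<And>x. x \<in> S \<Longrightarrow> 0 < r x \<and> r x \<le> d \<and> t < measure \<mu> (ball x (r x)) powr \<beta> * r x powr (- s)"
    by metis
  obtain C where C: "countable C" "C \<subseteq> S"
    and disj: "pairwise (\<lambda>i j. disjnt (cball i (r i)) (cball j (r j))) C"
    and cov: "\<And>i. i \<in> S \<Longrightarrow> \<exists>j. j \<in> C \<and> \<not> disjnt (cball i (r i)) (cball j (r j)) \<and> cball i (r i) \<subseteq> ball j (5 * r j)"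
    by (rule Vitali_covering_lemma_cballs_balls[of S r d "\<lambda>x. x"]) (use r in blast)+
  define V where "V = (\<Union>x\<in>C. ball x (5 * r x))"
  have "S \<subseteq> V"
  proof
    fix x assume x: "x \<in> S"
    from cov[OF x] obtain j where "j \<in> C" "cball x (r x) \<subseteq> ball j (5 * r j)" by blast
    moreover have "x \<in> cball x (r x)" using r[OF x] by simp
    ultimately show "x \<in> V" unfolding V_def by blast
  qed
  moreover have "V \<in> sets borel" unfolding V_def by (intro borel_open open_UN) auto
  moreover have "emeasure lborel V \<le> ennreal (10 ^ n * t powr (- (real n / s)) * \<nu> powr q)"
  proof -
    have one: "emeasure lborel (ball x (5 * r x)) \<le> ennreal (10 ^ n * t powr (- (real n / s)) * \<nu> powr (q - 1)) * emeasure \<mu> (ball x (r x))"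
      if "x \<in> C" for x
    proof -
      have x: "x \<in> S" using that C by auto
      define m where "m = measure \<mu> (ball x (r x))"
      have m0: "0 \<le> m" by (simp add: m_def)
      have rx: "0 < r x" "r x \<le> d" "t < m powr \<beta> * r x powr (- s)" using r[OF x] by (auto simp: m_def)
      have "r x powr s < m powr \<beta> / t" using rx t by (simp add: powr_minus field_simps)
      then have "(r x powr s) powr (real n / s) \<le> (m powr \<beta> / t) powr (real n / s)"
        using s by (intro powr_mono2) auto
      moreover have "(r x powr s) powr (real n / s) = r x ^ n"
        using s rx by (simp add: powr_powr powr_realpow)
      moreover have "(m powr \<beta> / t) powr (real n / s) = m powr q * t powr (- (real n / s))"
      proof -
        have "(m powr \<beta> / t) powr (real n / s) = (m powr \<beta>) powr (real n / s) / t powr (real n / s)"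
          by (rule powr_divide)
        also have "\<dots> = m powr q * t powr (- (real n / s))"
          by (simp only: powr_powr powr_minus q_def divide_inverse mult.assoc)
        finally show ?thesis .
      qed
      ultimately have "r x ^ n \<le> m powr q * t powr (- (real n / s))" by simp
      also have "m powr q = m powr (q - 1) * m"
        using m0 by (cases "m = 0") (auto simp: powr_diff)
      also have "m powr (q - 1) \<le> \<nu> powr (q - 1)"
        using q m0 U x sets rx unfolding m_def \<nu>_def S_def
        by (intro powr_mono2 finite_measure_mono) auto
      finally have rn: "r x ^ n \<le> \<nu> powr (q - 1) * m * t powr (- (real n / s))"
        using m0 by (auto simp: mult_right_mono)
      have "emeasure lborel (ball x (5 * r x)) \<le> ennreal ((2 * (5 * r x)) ^ n)"
        unfolding n_def using rx by (intro emeasure_ball_le) auto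
      also have "2 * (5 * r x) = 10 * r x" by simp
      also have "(10 * r x) ^ n = 10 ^ n * r x ^ n" by (rule power_mult_distrib)
      also have "ennreal \<dots> \<le> ennreal (10 ^ n * (\<nu> powr (q - 1) * m * t powr (- (real n / s))))"
        using rn by (intro ennreal_leI mult_left_mono) auto
      also have "\<dots> = ennreal (10 ^ n * t powr (- (real n / s)) * \<nu> powr (q - 1)) * ennreal m"
        using m0 by (simp add: ennreal_mult[symmetric] mult_ac)
      also have "ennreal m = emeasure \<mu> (ball x (r x))" by (simp add: m_def emeasure_eq_measure)
      finally show ?thesis .
    qed
    have "emeasure lborel V \<le> (\<integral>\<^sup>+x. emeasure lborel (ball x (5 * r x)) \<partial>count_space C)"
      unfolding V_def using C by (intro emeasure_UN_countable_le) auto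
    also have "\<dots> \<le> (\<integral>\<^sup>+x. ennreal (10 ^ n * t powr (- (real n / s)) * \<nu> powr (q - 1)) * emeasure \<mu> (ball x (r x)) \<partial>count_space C)"
      by (intro nn_integral_mono one) auto
    also have "\<dots> = ennreal (10 ^ n * t powr (- (real n / s)) * \<nu> powr (q - 1)) * (\<integral>\<^sup>+x. emeasure \<mu> (ball x (r x)) \<partial>count_space C)"
      by (simp add: nn_integral_cmult)
    also have "(\<integral>\<^sup>+x. emeasure \<mu> (ball x (r x)) \<partial>count_space C) = emeasure \<mu> (\<Union>x\<in>C. ball x (r x))"
    proof (rule emeasure_UN_countable[symmetric])
      show "disjoint_family_on (\<lambda>x. ball x (r x)) C"
        using disj unfolding disjoint_family_on_def pairwise_def disjnt_def
        using ball_subset_cball by blast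
    qed (use C sets in auto)
    also have "\<dots> \<le> emeasure \<mu> U"
    proof (rule emeasure_mono)
      show "(\<Union>x\<in>C. ball x (r x)) \<subseteq> U" using U(2) r C unfolding S_def by blast
    qed (use U sets in auto)
    also have "emeasure \<mu> U = ennreal \<nu>" by (simp add: \<nu>_def emeasure_eq_measure)
    also have "ennreal (10 ^ n * t powr (- (real n / s)) * \<nu> powr (q - 1)) * ennreal \<nu> = ennreal (10 ^ n * t powr (- (real n / s)) * \<nu> powr q)"
    proof -
      have "\<nu> powr q = \<nu> powr (q - 1) * \<nu>"
        by (cases "\<nu> = 0") (auto simp: powr_diff \<nu>_def)
      then show ?thesis by (subst ennreal_mult[symmetric]) (auto simp: \<nu>_def mult_ac)
    qed
    finally show ?thesis by (simp add: mult_left_mono)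
  qed
  ultimately show ?thesis using that unfolding S_def n_def q_def \<nu>_def by blast
qed

text \<open>The sum of the geometric series that arises from the weak type estimate at the levels \<open>2 ^ k\<close>. It blows up
  like \<open>1 / (n - s)\<close> as \<open>s\<close> tends to \<open>n\<close>, and stays bounded as \<open>s\<close> tends to \<open>0\<close>.\<close>

lemma inverse_one_minus_two_powr:
  fixes n s :: real
  assumes "0 < s" "s < n"
  shows "2 powr (1 - n / s) < 1" "1 / (1 - 2 powr (1 - n / s)) \<le> 2 * n / (n - s)"
proof -
  define z where "z = n / s - 1"
  have z: "0 < z" using assms by (simp add: z_def)
  have "1 + z / 2 \<le> 1 + z * ln 2"
    using z ln2_ge_two_thirds by simp
  also have "\<dots> \<le> 2 powr z"
    using exp_ge_add_one_self[of "z * ln 2"] by (simp add: powr_def)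
  finally have a: "1 + z / 2 \<le> 2 powr z" .
  have e: "2 powr (1 - n / s) = 1 / 2 powr z"
    by (simp add: z_def powr_diff)
  have "1 / 2 powr z \<le> 1 / (1 + z / 2)"
    using a z by (intro divide_left_mono) auto
  then have b: "1 - 1 / 2 powr z \<ge> z / (2 + z)" using z by (simp add: field_simps)
  have "z / (2 + z) \<ge> z / (2 + 2 * z)" using z by (intro divide_left_mono) auto
  moreover have "z / (2 + 2 * z) = (n - s) / (2 * n)" using assms by (simp add: z_def field_simps)
  ultimately have c: "(n - s) / (2 * n) \<le> 1 - 1 / 2 powr z" using b by simp
  have pos: "0 < (n - s) / (2 * n)" using assms by simp
  show "2 powr (1 - n / s) < 1" using assms by (intro powr_less_one) (auto simp: field_simps)
  have "1 / (1 - 1 / 2 powr z) \<le> 1 / ((n - s) / (2 * n))"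
    using c pos less_le_trans[OF pos c] by (intro divide_left_mono mult_pos_pos) simp_all
  then show "1 / (1 - 2 powr (1 - n / s)) \<le> 2 * n / (n - s)" unfolding e by simp
qed

text \<open>Balls of radius at least \<open>d\<close> contribute at most \<open>z\<close> at every point. For the smaller ones, which stay inside
  \<open>U\<close>, the weak type estimate at the levels \<open>z * 2 ^ k\<close> gives superlevel sets of measure at most
  \<open>10 ^ n * d ^ n * 2 powr (- k n / s)\<close>, and the resulting geometric series converges because \<open>s < n\<close>.\<close>

lemma integral_ball_weight:
  fixes \<mu> :: "(real ^ 'n) measure"
  assumes fin: "finite_measure \<mu>" and sets: "sets \<mu> = sets borel"
    and s: "0 < s" "s < real CARD('n)" and \<beta>: "0 < \<beta>" "s \<le> \<beta> * real CARD('n)" and d: "0 < d" and z: "0 \<le> z"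
    and U: "U \<in> sets borel" "\<And>x r. x \<in> P \<Longrightarrow> r \<le> d \<Longrightarrow> ball x r \<subseteq> U"
    and far: "\<And>x r. x \<in> P \<Longrightarrow> d \<le> r \<Longrightarrow> measure \<mu> (ball x r) powr \<beta> * r powr (- s) \<le> z"
    and near: "measure \<mu> U powr \<beta> * d powr (- s) \<le> z"
    and P [measurable]: "P \<in> sets borel" and v: "0 \<le> v" "emeasure lborel P = ennreal v"
  shows "(\<integral>\<^sup>+x\<in>P. ball_weight \<beta> s \<mu> x \<partial>lborel) \<le> ennreal (z * (v + 10 ^ CARD('n) * d ^ CARD('n) * (2 * real CARD('n) / (real CARD('n) - s))))"
proof (cases "z = 0")
  case True
  interpret finite_measure \<mu> by fact
  \<comment> \<open>There are no levels \<open>z * 2 ^ k\<close> in this case, but the weight vanishes on \<open>P\<close>.\<close>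
  have "measure \<mu> U powr \<beta> \<le> 0" using near d True by (simp add: mult_le_0_iff)
  then have U0: "measure \<mu> U = 0" by (simp add: measure_nonneg)
  have "ball_weight \<beta> s \<mu> x = 0" if x: "x \<in> P" for x
  proof -
    have "ennreal (measure \<mu> (ball x r) powr \<beta> * r powr (- s)) = 0" if r: "0 < r" for r
    proof (cases "d \<le> r")
      case True
      then show ?thesis using far[OF x True] \<open>z = 0\<close> by (simp add: ennreal_eq_0_iff)
    next
      case False
      then have "measure \<mu> (ball x r) \<le> measure \<mu> U"
        using U x sets by (intro finite_measure_mono) auto
      then have "measure \<mu> (ball x r) = 0" using U0 by (simp add: measure_le_0_iff)
      then show ?thesis by simp
    qed
    then show ?thesis by (simp add: ball_weight_def)
  qed
  then have "(\<integral>\<^sup>+x\<in>P. ball_weight \<beta> s \<mu> x \<partial>lborel) = (\<integral>\<^sup>+x. 0 \<partial>(lborel :: (real^'n) measure))"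
    by (intro nn_integral_cong) (auto simp: indicator_def)
  then show ?thesis by simp
next
  case False
  interpret finite_measure \<mu> by fact
  have z0: "0 < z" using False z by simp
  define n where "n = CARD('n)"
  define S where "S k = {x \<in> P. \<exists>r. 0 < r \<and> r \<le> d \<and> z * 2 ^ k < measure \<mu> (ball x r) powr \<beta> * r powr (- s)}" for k
  define c where "c k = 10 ^ n * (z * 2 ^ k) powr (- (real n / s)) * measure \<mu> U powr (\<beta> * real n / s)" for k
  have "\<exists>V. V \<in> sets borel \<and> S k \<subseteq> V \<and> emeasure lborel V \<le> ennreal (c k)" for k
  proof (rule weak_type[OF fin sets s(1) \<beta>(2) _ U, where t = "z * 2 ^ k" and P = P])
    show "0 < z * 2 ^ k" using z0 by simp
    fix V assume "V \<in> sets borel" "{x \<in> P. \<exists>r. 0 < r \<and> r \<le> d \<and> z * 2 ^ k < measure \<mu> (ball x r) powr \<beta> * r powr (- s)} \<subseteq> V"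
      "emeasure lborel V \<le> ennreal (10 ^ CARD('n) * (z * 2 ^ k) powr (- (real CARD('n) / s)) * measure \<mu> U powr (\<beta> * real CARD('n) / s))"
    then show ?thesis unfolding S_def c_def n_def by blast
  qed
  then have "\<exists>V. \<forall>k. V k \<in> sets borel \<and> S k \<subseteq> V k \<and> emeasure lborel (V k) \<le> ennreal (c k)"
    by (intro choice allI)
  then obtain V where Vall: "\<forall>k. V k \<in> sets borel \<and> S k \<subseteq> V k \<and> emeasure lborel (V k) \<le> ennreal (c k)" ..
  then have V [measurable]: "V k \<in> sets borel" and SV: "S k \<subseteq> V k" and mV: "emeasure lborel (V k) \<le> ennreal (c k)" for k
    by (simp_all only: Vall)
  define \<rho> where "\<rho> = 2 powr (1 - real n / s)"
  have \<rho>: "0 < \<rho>" "\<rho> < 1" "1 / (1 - \<rho>) \<le> 2 * real n / (real n - s)"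
    using inverse_one_minus_two_powr[of s "real n"] s by (auto simp: \<rho>_def n_def)
  have Vk: "ennreal (z * 2 ^ k) * emeasure lborel (V k) \<le> ennreal (z * (10 ^ n * d ^ n)) * ennreal (\<rho> ^ k)" for k
  proof -
    have "measure \<mu> U powr \<beta> \<le> z * d powr s" using near d by (simp add: powr_minus field_simps)
    then have "(measure \<mu> U powr \<beta>) powr (real n / s) \<le> (z * d powr s) powr (real n / s)"
      using s by (intro powr_mono2) auto
    then have \<nu>: "measure \<mu> U powr (\<beta> * real n / s) \<le> z powr (real n / s) * d ^ n"
      using s z0 d by (simp add: powr_powr powr_mult powr_realpow)
    have "ennreal (z * 2 ^ k) * emeasure lborel (V k) \<le> ennreal (z * 2 ^ k) * ennreal (10 ^ n * (z * 2 ^ k) powr (- (real n / s)) * measure \<mu> U powr (\<beta> * real n / s))"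
      using mV[of k] unfolding c_def by (intro mult_left_mono) auto
    also have "\<dots> \<le> ennreal (z * 2 ^ k) * ennreal (10 ^ n * (z * 2 ^ k) powr (- (real n / s)) * (z powr (real n / s) * d ^ n))"
      by (intro mult_left_mono ennreal_leI \<nu>) auto
    also have "\<dots> = ennreal ((z * 2 ^ k) * (10 ^ n * (z * 2 ^ k) powr (- (real n / s)) * (z powr (real n / s) * d ^ n)))"
      using z0 d by (subst ennreal_mult) auto
    also have "(z * 2 ^ k) * (10 ^ n * (z * 2 ^ k) powr (- (real n / s)) * (z powr (real n / s) * d ^ n)) = z * (10 ^ n * d ^ n) * \<rho> ^ k"
    proof -
      have "\<rho> ^ k = 2 ^ k * (2 ^ k) powr (- (real n / s))"
      proof -
        have "\<rho> = 2 * 2 powr (- (real n / s))" by (simp add: \<rho>_def powr_diff powr_minus divide_inverse)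
        then have "\<rho> ^ k = 2 ^ k * (2 powr (- (real n / s))) ^ k" by (simp add: power_mult_distrib)
        also have "(2 powr (- (real n / s))) ^ k = (2 ^ k) powr (- (real n / s))"
          by (simp add: powr_realpow[symmetric] powr_powr mult.commute)
        finally show ?thesis .
      qed
      moreover have "(z * 2 ^ k) powr (- (real n / s)) * z powr (real n / s) = (2 ^ k) powr (- (real n / s))"
        using z0 by (simp add: powr_mult powr_minus)
      ultimately show ?thesis by (simp add: mult_ac)
    qed
    finally show ?thesis using z0 d \<rho> by (simp add: ennreal_mult)
  qed
  have "(\<integral>\<^sup>+x\<in>P. ball_weight \<beta> s \<mu> x \<partial>lborel) \<le> (\<integral>\<^sup>+x. ennreal z * indicator P x + (\<Sum>k. ennreal (z * 2 ^ k) * indicator (V k) x) \<partial>lborel)"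
  proof (intro nn_integral_mono)
    fix x :: "real^'n"
    show "ball_weight \<beta> s \<mu> x * indicator P x \<le> ennreal z * indicator P x + (\<Sum>k. ennreal (z * 2 ^ k) * indicator (V k) x)"
    proof (cases "x \<in> P")
      case x: True
      have "ball_weight \<beta> s \<mu> x \<le> ennreal z + (\<Sum>k. ennreal (z * 2 ^ k) * indicator (V k) x)"
        unfolding ball_weight_def
      proof (rule SUP_least)
        fix r :: real assume "r \<in> {0<..}"
        then have r: "0 < r" by simp
        define b where "b = measure \<mu> (ball x r) powr \<beta> * r powr (- s)"
        show "ennreal (measure \<mu> (ball x r) powr \<beta> * r powr (- s)) \<le> ennreal z + (\<Sum>k. ennreal (z * 2 ^ k) * indicator (V k) x)"
        proof (cases "d \<le> r")
          case True
          have "ennreal (measure \<mu> (ball x r) powr \<beta> * r powr (- s)) \<le> ennreal z"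
            by (intro ennreal_leI far x True)
          then show ?thesis by (rule order.trans) simp
        next
          case False
          have "ennreal b = ennreal (b powr 1)" by (simp add: b_def)
          also have "\<dots> \<le> ennreal (z powr 1) + (\<Sum>k. ennreal ((2 powr 1 - 1) * (z * 2 ^ k) powr 1) * (if z * 2 ^ k < b then 1 else 0))"
            using z0 by (intro powr_le_sum_levels) (auto simp: b_def)
          also have "\<dots> \<le> ennreal z + (\<Sum>k. ennreal (z * 2 ^ k) * indicator (V k) x)"
          proof (intro add_mono suminf_le)
            fix k
            have "x \<in> V k" if "z * 2 ^ k < b" using that SV[of k] x r False by (force simp: b_def S_def)
            then show "ennreal ((2 powr 1 - 1) * (z * 2 ^ k) powr 1) * (if z * 2 ^ k < b then 1 else 0) \<le> ennreal (z * 2 ^ k) * indicator (V k) x"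
              using z0 by (auto simp: indicator_def)
          qed (use z0 in auto)
          finally show ?thesis by (simp add: b_def)
        qed
      qed
      then show ?thesis using x by simp
    qed simp
  qed
  also have "\<dots> = ennreal z * ennreal v + (\<Sum>k. ennreal (z * 2 ^ k) * emeasure lborel (V k))"
    by (simp add: nn_integral_add nn_integral_cmult nn_integral_suminf v)
  also have "\<dots> \<le> ennreal z * ennreal v + (\<Sum>k. ennreal (z * (10 ^ n * d ^ n)) * ennreal (\<rho> ^ k))"
    by (intro add_left_mono suminf_le Vk) auto
  also have "(\<Sum>k. ennreal (z * (10 ^ n * d ^ n)) * ennreal (\<rho> ^ k)) = ennreal (z * (10 ^ n * d ^ n)) * ennreal (1 / (1 - \<rho>))"
  proof -
    have "(\<Sum>k. ennreal (\<rho> ^ k)) = ennreal (\<Sum>k. \<rho> ^ k)"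
      using \<rho> by (intro suminf_ennreal2) (auto intro: summable_geometric)
    also have "(\<Sum>k. \<rho> ^ k) = 1 / (1 - \<rho>)" using \<rho> by (intro suminf_geometric) auto
    finally show ?thesis by simp
  qed
  also have "ennreal z * ennreal v + ennreal (z * (10 ^ n * d ^ n)) * ennreal (1 / (1 - \<rho>)) = ennreal (z * v + z * (10 ^ n * d ^ n) * (1 / (1 - \<rho>)))"
    using z0 v d \<rho> by (simp add: ennreal_mult[symmetric])
  also have "\<dots> \<le> ennreal (z * (v + 10 ^ n * d ^ n * (2 * real n / (real n - s))))"
  proof (intro ennreal_leI)
    have "z * (10 ^ n * d ^ n) * (1 / (1 - \<rho>)) \<le> z * (10 ^ n * d ^ n) * (2 * real n / (real n - s))"
      using z0 d \<rho>(3) by (intro mult_left_mono) auto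
    then show "z * v + z * (10 ^ n * d ^ n) * (1 / (1 - \<rho>)) \<le> z * (v + 10 ^ n * d ^ n * (2 * real n / (real n - s)))"
      by (simp add: algebra_simps)
  qed
  finally show ?thesis by (simp add: n_def)
qed

section \<open>Averages of the maximal weight over cubes\<close>

text \<open>For \<open>P\<close> a cube and \<open>d\<close> its diameter, \<open>average_const n / (n - s)\<close> bounds the quotient by \<open>z\<close> and the volume
  of \<open>P\<close> that \<open>integral_ball_weight\<close> yields (\<open>cube_integral_constant\<close>).\<close>

definition average_const :: "nat \<Rightarrow> real" where
  "average_const n = 3 * real n * (10 * real n) ^ n"

lemma cube_integral_constant:
  fixes s r z :: real and n :: nat
  assumes "1 \<le> n" "0 < s" "s < real n" "0 < r" "0 \<le> z"
  shows "z * (r ^ n + 10 ^ n * (sqrt (real n) * r) ^ n * (2 * real n / (real n - s))) \<le> z * (average_const n / (real n - s) * r ^ n)"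
proof (intro mult_left_mono)
  have n: "1 \<le> real n" using assms by simp
  have "sqrt (real n) * 1 \<le> sqrt (real n) * sqrt (real n)"
    using n by (intro mult_left_mono) auto
  then have sq: "sqrt (real n) \<le> real n" using n by simp
  have "10 ^ n * (sqrt (real n) * r) ^ n \<le> 10 ^ n * (real n * r) ^ n"
    using sq assms by (intro mult_left_mono power_mono mult_right_mono) auto
  also have "\<dots> = (10 * real n) ^ n * r ^ n" by (simp add: power_mult_distrib)
  finally have a: "10 ^ n * (sqrt (real n) * r) ^ n * (2 * real n / (real n - s)) \<le> (10 * real n) ^ n * r ^ n * (2 * real n / (real n - s))"
    using assms by (intro mult_right_mono) auto
  have b: "r ^ n \<le> (10 * real n) ^ n * r ^ n * (real n / (real n - s))"
  proof -
    have "1 \<le> (10 * real n) ^ n" using n by (intro one_le_power) auto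
    moreover have "1 \<le> real n / (real n - s)" using assms by simp
    ultimately have "1 * 1 \<le> (10 * real n) ^ n * (real n / (real n - s))" by (intro mult_mono) auto
    then have "r ^ n * 1 \<le> r ^ n * ((10 * real n) ^ n * (real n / (real n - s)))"
      using assms by (intro mult_left_mono) auto
    then show ?thesis by (simp add: mult_ac)
  qed
  have "(10 * real n) ^ n * r ^ n * (real n / (real n - s)) + (10 * real n) ^ n * r ^ n * (2 * real n / (real n - s)) = average_const n / (real n - s) * r ^ n"
  proof -
    define t where "t = real n / (real n - s)"
    have "2 * real n / (real n - s) = 2 * t" "average_const n / (real n - s) = 3 * (10 * real n) ^ n * t"
      by (simp_all add: t_def average_const_def)
    then show ?thesis by (simp add: t_def[symmetric] algebra_simps)
  qed
  then show "r ^ n + 10 ^ n * (sqrt (real n) * r) ^ n * (2 * real n / (real n - s)) \<le> average_const n / (real n - s) * r ^ n"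
    using a b by linarith
qed (use assms in auto)

lemma average_const_ge: "1 \<le> n \<Longrightarrow> real n \<le> average_const n"
proof -
  assume n: "1 \<le> n"
  have "1 \<le> (10 * real n) ^ n" using n by (intro one_le_power) auto
  then have "real n * 1 \<le> 3 * real n * (10 * real n) ^ n" by (intro mult_mono) auto
  then show ?thesis by (simp add: average_const_def)
qed

text \<open>The second condition on \<open>\<beta>\<close> is the one under which \<open>\<mu>(ball) powr (\<beta> n / s)\<close> is superadditive over disjoint
  balls; \<open>s < n\<close> is what makes the weight locally integrable.\<close>

locale maximal_weight =
  fixes \<mu> :: "(real ^ 'n) measure" and \<beta> s :: real
  assumes fin: "finite_measure \<mu>" and sets: "sets \<mu> = sets borel"
    and s: "0 < s" "s < real CARD('n)" and \<beta>: "0 < \<beta>" "s \<le> \<beta> * real CARD('n)"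
begin

lemma card_ge_1: "1 \<le> CARD('n)"
  by (simp add: Suc_leI)

lemma measure_mono: "S \<subseteq> T \<Longrightarrow> T \<in> sets borel \<Longrightarrow> measure \<mu> S \<le> measure \<mu> T"
  using finite_measure.finite_measure_mono[OF fin] sets by auto

lemma ball_in_UNIV: "measure \<mu> (ball x r) powr \<beta> \<le> measure \<mu> UNIV powr \<beta>"
  using \<beta> by (intro powr_mono2 measure_mono) auto

lemma growth:
  fixes a :: "real ^ 'n"
  assumes l: "0 < l"
  shows "(\<integral>\<^sup>+x\<in>dyadic_cube a l k x0. ball_weight \<beta> s \<mu> x \<partial>lborel) \<le>
     ennreal (measure \<mu> UNIV powr \<beta> * (average_const CARD('n) / (real CARD('n) - s)) * (l / 2 ^ k) powr (real CARD('n) - s))"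
proof -
  define r where "r = l / 2 ^ k"
  define d where "d = sqrt (real CARD('n)) * r"
  define z where "z = measure \<mu> UNIV powr \<beta> * r powr (- s)"
  have r: "0 < r" using l by (simp add: r_def)
  have d: "0 < d" "r \<le> d" using r card_ge_1 by (simp_all add: d_def)
  have dr: "\<rho> powr (- s) \<le> r powr (- s)" if "d \<le> \<rho>" for \<rho>
    using r d s that by (intro powr_mono2') auto
  have "(\<integral>\<^sup>+x\<in>dyadic_cube a l k x0. ball_weight \<beta> s \<mu> x \<partial>lborel) \<le>
     ennreal (z * (r ^ CARD('n) + 10 ^ CARD('n) * d ^ CARD('n) * (2 * real CARD('n) / (real CARD('n) - s))))"
  proof (rule integral_ball_weight[OF fin sets s \<beta> d(1), where U = UNIV])
    show "measure \<mu> (ball x \<rho>) powr \<beta> * \<rho> powr (- s) \<le> z" if "d \<le> \<rho>" for x \<rho>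
      unfolding z_def using dr[OF that] ball_in_UNIV by (intro mult_mono) auto
    show "measure \<mu> UNIV powr \<beta> * d powr (- s) \<le> z"
      unfolding z_def using dr[of d] by (intro mult_mono) auto
    show "emeasure lborel (dyadic_cube a l k x0) = ennreal (r ^ CARD('n))"
      using l by (simp add: emeasure_dyadic_cube r_def)
  qed (use l r in \<open>auto simp: z_def\<close>)
  also have "\<dots> \<le> ennreal (z * (average_const CARD('n) / (real CARD('n) - s) * r ^ CARD('n)))"
    unfolding d_def using card_ge_1 s r by (intro ennreal_leI cube_integral_constant) (auto simp: z_def)
  also have "z * (average_const CARD('n) / (real CARD('n) - s) * r ^ CARD('n)) =
      measure \<mu> UNIV powr \<beta> * (average_const CARD('n) / (real CARD('n) - s)) * (r powr (- s) * r powr real CARD('n))"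
    using r by (simp add: z_def powr_realpow)
  also have "r powr (- s) * r powr real CARD('n) = r powr (real CARD('n) - s)"
    by (simp add: powr_add[symmetric])
  finally show ?thesis by (simp add: r_def)
qed

text \<open>Moving the centre of a ball from a point of the cube to another point \<open>y\<close> of it at most doubles a radius
  that is not smaller than the diameter, which changes the quotient by at most \<open>2 powr s\<close>. The balls of
  smaller radius all lie in one ball around \<open>y\<close> of twice the diameter. So \<open>2 ^ n\<close> times the value of the
  weight at \<open>y\<close> can serve as the number \<open>z\<close> of \<open>integral_ball_weight\<close>.\<close>

lemma average_le_minimum:
  fixes a :: "real ^ 'n"
  assumes l: "0 < l" and y: "y \<in> dyadic_cube a l k x0"
  shows "(\<integral>\<^sup>+x\<in>dyadic_cube a l k x0. ball_weight \<beta> s \<mu> x \<partial>lborel) \<le>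
     ennreal (2 ^ CARD('n) * average_const CARD('n) / (real CARD('n) - s) * (l / 2 ^ k) ^ CARD('n)) * ball_weight \<beta> s \<mu> y"
proof (cases "ball_weight \<beta> s \<mu> y = top")
  case True
  define c where "c = 2 ^ CARD('n) * average_const CARD('n) / (real CARD('n) - s) * (l / 2 ^ k) ^ CARD('n)"
  have "0 < c"
    unfolding c_def using l s average_const_ge[OF card_ge_1] card_ge_1 by (intro mult_pos_pos divide_pos_pos) auto
  then show ?thesis unfolding True c_def[symmetric] by (simp add: ennreal_mult_top)
next
  case False
  then obtain \<omega> where \<omega>: "0 \<le> \<omega>" "ball_weight \<beta> s \<mu> y = ennreal \<omega>"
    by (cases "ball_weight \<beta> s \<mu> y") auto
  define r where "r = l / 2 ^ k"
  define d where "d = sqrt (real CARD('n)) * r"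
  define z where "z = 2 ^ CARD('n) * \<omega>"
  have r: "0 < r" using l by (simp add: r_def)
  have d: "0 < d" using r card_ge_1 by (simp add: d_def)
  have dist: "dist x y \<le> d" if "x \<in> dyadic_cube a l k x0" for x
    using dyadic_cube_diameter[OF l that y] by (simp add: d_def r_def dist_norm)
  have two: "measure \<mu> (ball y (2 * \<rho>)) powr \<beta> * \<rho> powr (- s) \<le> z" if "0 < \<rho>" for \<rho>
  proof -
    have "ennreal (measure \<mu> (ball y (2 * \<rho>)) powr \<beta> * (2 * \<rho>) powr (- s)) \<le> ennreal \<omega>"
      unfolding \<omega>(2)[symmetric] using that by (intro ball_weight_upper) simp
    then have b: "measure \<mu> (ball y (2 * \<rho>)) powr \<beta> * (2 * \<rho>) powr (- s) \<le> \<omega>" using \<omega> by simp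
    have "\<rho> powr (- s) = 2 powr s * (2 * \<rho>) powr (- s)"
      using that by (simp add: powr_mult powr_minus)
    then have "measure \<mu> (ball y (2 * \<rho>)) powr \<beta> * \<rho> powr (- s) = 2 powr s * (measure \<mu> (ball y (2 * \<rho>)) powr \<beta> * (2 * \<rho>) powr (- s))"
      by simp
    also have "\<dots> \<le> 2 powr real CARD('n) * \<omega>"
      using b s by (intro mult_mono powr_mono) auto
    also have "\<dots> = z" by (simp add: z_def powr_realpow)
    finally show ?thesis .
  qed
  have "(\<integral>\<^sup>+x\<in>dyadic_cube a l k x0. ball_weight \<beta> s \<mu> x \<partial>lborel) \<le>
     ennreal (z * (r ^ CARD('n) + 10 ^ CARD('n) * d ^ CARD('n) * (2 * real CARD('n) / (real CARD('n) - s))))"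
  proof (rule integral_ball_weight[OF fin sets s \<beta> d, where U = "ball y (2 * d)"])
    show "ball x \<rho> \<subseteq> ball y (2 * d)" if "x \<in> dyadic_cube a l k x0" "\<rho> \<le> d" for x \<rho>
      using dist[OF that(1)] that(2) by (intro ball_subset_ballI) (auto simp: dist_commute)
    show "measure \<mu> (ball x \<rho>) powr \<beta> * \<rho> powr (- s) \<le> z" if x: "x \<in> dyadic_cube a l k x0" and "d \<le> \<rho>" for x \<rho>
    proof -
      have "ball x \<rho> \<subseteq> ball y (2 * \<rho>)" using dist[OF x] that(2) by (intro ball_subset_ballI) (auto simp: dist_commute)
      then have "measure \<mu> (ball x \<rho>) powr \<beta> * \<rho> powr (- s) \<le> measure \<mu> (ball y (2 * \<rho>)) powr \<beta> * \<rho> powr (- s)"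
        using \<beta> by (intro mult_right_mono powr_mono2 measure_mono) auto
      also have "\<dots> \<le> z" using that d by (intro two) auto
      finally show ?thesis .
    qed
    show "measure \<mu> (ball y (2 * d)) powr \<beta> * d powr (- s) \<le> z" by (rule two[OF d])
    show "emeasure lborel (dyadic_cube a l k x0) = ennreal (r ^ CARD('n))"
      using l by (simp add: emeasure_dyadic_cube r_def)
  qed (use l r \<omega> in \<open>auto simp: z_def\<close>)
  also have "\<dots> \<le> ennreal (z * (average_const CARD('n) / (real CARD('n) - s) * r ^ CARD('n)))"
    unfolding d_def using card_ge_1 s r \<omega> by (intro ennreal_leI cube_integral_constant) (auto simp: z_def)
  also have "z * (average_const CARD('n) / (real CARD('n) - s) * r ^ CARD('n)) = 2 ^ CARD('n) * average_const CARD('n) / (real CARD('n) - s) * r ^ CARD('n) * \<omega>"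
    by (simp add: z_def)
  also have "ennreal \<dots> = ennreal (2 ^ CARD('n) * average_const CARD('n) / (real CARD('n) - s) * r ^ CARD('n)) * ennreal \<omega>"
    using \<omega> by (intro ennreal_mult'') 
  finally show ?thesis by (simp add: r_def \<omega>)
qed

text \<open>Integrating \<open>average_le_minimum\<close> over \<open>y \<in> S\<close> compares the weight of the cube with that of \<open>S\<close>.\<close>

lemma retain:
  fixes a :: "real ^ 'n"
  assumes l: "0 < l" and S: "S \<in> sets borel" "S \<subseteq> dyadic_cube a l k x0"
    and half: "emeasure lborel (dyadic_cube a l k x0) \<le> 2 * emeasure lborel S"
  shows "ennreal ((real CARD('n) - s) / (2 ^ (CARD('n) + 1) * average_const CARD('n))) *
     (\<integral>\<^sup>+x\<in>dyadic_cube a l k x0. ball_weight \<beta> s \<mu> x \<partial>lborel) \<le> (\<integral>\<^sup>+x\<in>S. ball_weight \<beta> s \<mu> x \<partial>lborel)"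
proof -
  note [measurable] = S(1) ball_weight_measurable[OF fin sets \<beta>(1)]
  define I where "I = (\<integral>\<^sup>+x\<in>dyadic_cube a l k x0. ball_weight \<beta> s \<mu> x \<partial>lborel)"
  define R where "R = (l / 2 ^ k) ^ CARD('n)"
  define c where "c = 2 ^ CARD('n) * average_const CARD('n) / (real CARD('n) - s)"
  have R: "0 < R" using l by (simp add: R_def)
  have K: "0 < average_const CARD('n)" using average_const_ge[OF card_ge_1] card_ge_1 by linarith
  have c: "0 < c" using K s by (simp add: c_def)
  have "ennreal R * I \<le> 2 * (I * emeasure lborel S)"
    using mult_right_mono[OF half, of I] l by (simp add: emeasure_dyadic_cube R_def mult_ac)
  also have "I * emeasure lborel S = (\<integral>\<^sup>+x\<in>S. I \<partial>lborel)"
    by (simp add: nn_integral_cmult)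
  also have "\<dots> \<le> (\<integral>\<^sup>+x\<in>S. ennreal (c * R) * ball_weight \<beta> s \<mu> x \<partial>lborel)"
  proof (intro nn_integral_mono)
    fix x
    show "I * indicator S x \<le> ennreal (c * R) * ball_weight \<beta> s \<mu> x * indicator S x"
      using average_le_minimum[OF l, of x a k x0] S(2) by (auto simp: indicator_def I_def c_def R_def)
  qed
  also have "\<dots> = ennreal (c * R) * (\<integral>\<^sup>+x\<in>S. ball_weight \<beta> s \<mu> x \<partial>lborel)"
    by (simp add: nn_integral_cmult mult.assoc)
  also have "2 * (ennreal (c * R) * (\<integral>\<^sup>+x\<in>S. ball_weight \<beta> s \<mu> x \<partial>lborel)) = ennreal R * (ennreal (2 * c) * (\<integral>\<^sup>+x\<in>S. ball_weight \<beta> s \<mu> x \<partial>lborel))"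
  proof -
    have "ennreal R * ennreal (2 * c) = ennreal (2 * (c * R))"
      using c R by (subst ennreal_mult[symmetric]) (auto simp: mult_ac)
    also have "\<dots> = 2 * ennreal (c * R)" using c R by (subst ennreal_mult) auto
    finally show ?thesis by (simp only: mult.assoc[symmetric])
  qed
  finally have "ennreal R * I \<le> ennreal R * (ennreal (2 * c) * (\<integral>\<^sup>+x\<in>S. ball_weight \<beta> s \<mu> x \<partial>lborel))"
    by (simp only: mult_left_mono zero_le)
  then have "I \<le> ennreal (2 * c) * (\<integral>\<^sup>+x\<in>S. ball_weight \<beta> s \<mu> x \<partial>lborel)"
    by (rule ennreal_mult_le_cancel[OF R])
  then have "ennreal (1 / (2 * c)) * I \<le> ennreal (1 / (2 * c)) * (ennreal (2 * c) * (\<integral>\<^sup>+x\<in>S. ball_weight \<beta> s \<mu> x \<partial>lborel))"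
    by (intro mult_left_mono) auto
  also have "\<dots> = (\<integral>\<^sup>+x\<in>S. ball_weight \<beta> s \<mu> x \<partial>lborel)"
    using c by (simp add: mult.assoc[symmetric] ennreal_mult[symmetric])
  also have "1 / (2 * c) = (real CARD('n) - s) / (2 ^ (CARD('n) + 1) * average_const CARD('n))"
    by (simp add: c_def)
  finally show ?thesis by (simp add: I_def)
qed

lemma dyadic_weight_ball_weight:
  fixes a :: "real ^ 'n"
  assumes l: "0 < l"
  shows "dyadic_weight a l s (measure \<mu> UNIV powr \<beta> * (average_const CARD('n) / (real CARD('n) - s)))
     ((real CARD('n) - s) / (2 ^ (CARD('n) + 1) * average_const CARD('n))) (ball_weight \<beta> s \<mu>)"
proof
  note [measurable] = ball_weight_measurable[OF fin sets \<beta>(1)]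
  have K: "real CARD('n) \<le> average_const CARD('n)" using average_const_ge[OF card_ge_1] .
  then have K_pos: "0 < average_const CARD('n)" using card_ge_1 by linarith
  have W: "emeasure (density lborel (ball_weight \<beta> s \<mu>)) S = (\<integral>\<^sup>+x\<in>S. ball_weight \<beta> s \<mu> x \<partial>lborel)" if "S \<in> sets borel" for S
    using that by (simp add: emeasure_density)
  show "0 < (real CARD('n) - s) / (2 ^ (CARD('n) + 1) * average_const CARD('n))"
    using K s card_ge_1 by (intro divide_pos_pos mult_pos_pos) auto
  have "real CARD('n) - s \<le> 1 * average_const CARD('n)" using K s by simp
  also have "\<dots> \<le> 2 ^ (CARD('n) + 1) * average_const CARD('n)" using K one_le_power[of "2::real" "CARD('n) + 1"] by (intro mult_right_mono) auto
  finally show "(real CARD('n) - s) / (2 ^ (CARD('n) + 1) * average_const CARD('n)) \<le> 1"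
    using K_pos by (subst divide_le_eq_1_pos) auto
  show "0 \<le> measure \<mu> UNIV powr \<beta> * (average_const CARD('n) / (real CARD('n) - s))"
    using K s by (intro mult_nonneg_nonneg divide_nonneg_nonneg) auto
  show "emeasure (density lborel (ball_weight \<beta> s \<mu>)) (dyadic_cube a l k x) \<le>
      ennreal (measure \<mu> UNIV powr \<beta> * (average_const CARD('n) / (real CARD('n) - s)) * (l / 2 ^ k) powr (real CARD('n) - s))" for x k
    using growth[OF l, of a k x] l by (simp add: W)
  show "ennreal ((real CARD('n) - s) / (2 ^ (CARD('n) + 1) * average_const CARD('n))) * emeasure (density lborel (ball_weight \<beta> s \<mu>)) (dyadic_cube a l k x)
      \<le> emeasure (density lborel (ball_weight \<beta> s \<mu>)) S"
    if "S \<in> sets borel" "S \<subseteq> dyadic_cube a l k x" "emeasure lborel (dyadic_cube a l k x) \<le> 2 * emeasure lborel S" for x k S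
    using retain[OF l that] l that by (simp add: W)
qed (use l s ball_weight_measurable[OF fin sets \<beta>(1)] in auto)

end

section \<open>Arbitrary cubes and the fractional maximal function\<close>

text \<open>An interval that may or may not contain its end points differs from an open one by a finite set, so every
  cube is a Borel set.\<close>

lemma cube_of_sideE:
  fixes R :: "(real ^ 'n) set"
  assumes "cube_of_side l R"
  obtains a :: "real ^ 'n" where "0 < l" "R \<in> sets borel"
    "\<And>y i. y \<in> R \<Longrightarrow> a $ i \<le> y $ i \<and> y $ i \<le> a $ i + l"
    "\<And>y. \<forall>i. a $ i < y $ i \<and> y $ i < a $ i + l \<Longrightarrow> y \<in> R"
proof -
  from assms obtain a I where l: "0 < l" and I: "\<And>i. {a i<..<a i + l} \<subseteq> I i \<and> I i \<subseteq> {a i..a i + l}"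
    and R: "R = {x. \<forall>i. x $ i \<in> I i}"
    unfolding cube_of_side_def by blast
  have Ib: "I i \<in> sets borel" for i
  proof -
    have "I i = {a i<..<a i + l} \<union> (I i \<inter> {a i, a i + l})" using I[of i] by fastforce
    moreover have "finite (I i \<inter> {a i, a i + l})" by simp
    ultimately show ?thesis by (metis borel_closed borel_open finite_imp_closed open_greaterThanLessThan sets.Un)
  qed
  have "R = (\<Inter>i. (\<lambda>x. x $ i) -` I i)" by (auto simp: R)
  moreover have "(\<lambda>x::real^'n. x $ i) -` I i \<in> sets borel" for i
    using Ib by (intro measurable_sets_borel[of _ borel]) auto
  ultimately have "R \<in> sets borel" by (auto intro!: sets.finite_INT)
  then show ?thesis
  proof (rule that[OF l, where a = "\<chi> i. a i"])
    show "(\<chi> i. a i) $ i \<le> y $ i \<and> y $ i \<le> (\<chi> i. a i) $ i + l" if "y \<in> R" for y i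
      using that I[of i] unfolding R by force
    show "y \<in> R" if "\<forall>i. (\<chi> i. a i) $ i < y $ i \<and> y $ i < (\<chi> i. a i) $ i + l" for y
      unfolding R using that I by fastforce
  qed
qed

lemma emeasure_cube_of_side:
  fixes R :: "(real ^ 'n) set"
  assumes "cube_of_side l R"
  shows "emeasure lborel R = ennreal (l ^ CARD('n))"
proof -
  obtain a :: "real^'n" where l: "0 < l" and R: "R \<in> sets borel"
    "\<And>y i. y \<in> R \<Longrightarrow> a $ i \<le> y $ i \<and> y $ i \<le> a $ i + l"
    "\<And>y. \<forall>i. a $ i < y $ i \<and> y $ i < a $ i + l \<Longrightarrow> y \<in> R"
    by (rule cube_of_sideE[OF assms]) (rule that)
  define b where "b = a + (\<chi> i. l)"
  have "emeasure lborel (cbox a b) = emeasure lborel (box a b)"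
    by (simp add: emeasure_lborel_box_eq emeasure_lborel_cbox_eq)
  moreover have le: "emeasure lborel (box a b) \<le> emeasure lborel R" "emeasure lborel R \<le> emeasure lborel (cbox a b)"
    using R by (auto intro!: emeasure_mono simp: mem_box_cart b_def)
  moreover have "emeasure lborel (box a b) \<le> emeasure lborel {y. \<forall>i. a $ i \<le> y $ i \<and> y $ i < a $ i + l}"
    by (intro emeasure_mono) (auto simp: mem_box_cart b_def less_imp_le intro!: halfopen_box_measurable)
  moreover have "emeasure lborel {y. \<forall>i. a $ i \<le> y $ i \<and> y $ i < a $ i + l} \<le> emeasure lborel (cbox a b)"
    by (intro emeasure_mono) (auto simp: mem_box_cart b_def less_imp_le)
  ultimately show ?thesis using emeasure_halfopen_box[of l a] l by simp
qed

lemma dyadic_cube_0: "0 < l \<Longrightarrow> dyadic_cube a l 0 a = {y. \<forall>i. a $ i \<le> y $ i \<and> y $ i < a $ i + l}"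
  by (subst dyadic_cube_eq_box) auto

lemma is_cube_AE_dyadic_cube:
  fixes Q :: "(real ^ 'n) set"
  assumes "is_cube Q"
  obtains a :: "real ^ 'n" and l where "0 < l" "AE x in lebesgue. x \<in> Q \<longleftrightarrow> x \<in> dyadic_cube a l 0 a"
proof -
  from assms obtain l where c: "cube_of_side l Q" by (auto simp: is_cube_def)
  obtain a :: "real^'n" where l: "0 < l" and R: 
    "\<And>y i. y \<in> Q \<Longrightarrow> a $ i \<le> y $ i \<and> y $ i \<le> a $ i + l"
    "\<And>y. \<forall>i. a $ i < y $ i \<and> y $ i < a $ i + l \<Longrightarrow> y \<in> Q"
    by (rule cube_of_sideE[OF c]) (rule that)
  define b where "b = a + (\<chi> i. l)"
  have "cbox a b - box a b \<in> null_sets lebesgue"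
    using negligible_frontier_interval[of a b] by (simp add: negligible_iff_null_sets)
  then have "AE x in lebesgue. x \<notin> cbox a b - box a b" by (rule AE_not_in)
  then have "AE x in lebesgue. x \<in> Q \<longleftrightarrow> x \<in> dyadic_cube a l 0 a"
  proof (rule AE_mp, intro AE_I2 impI)
    fix x assume x: "x \<notin> cbox a b - box a b"
    show "x \<in> Q \<longleftrightarrow> x \<in> dyadic_cube a l 0 a"
    proof
      assume "x \<in> Q"
      then have "x \<in> cbox a b" using R(1) by (simp add: mem_box_cart b_def)
      then have "x \<in> box a b" using x by simp
      then show "x \<in> dyadic_cube a l 0 a" using l by (simp add: dyadic_cube_0 mem_box_cart b_def less_imp_le)
    next
      assume "x \<in> dyadic_cube a l 0 a"
      then have "x \<in> cbox a b" using l by (simp add: dyadic_cube_0 mem_box_cart b_def less_imp_le)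
      then have "x \<in> box a b" using x by simp
      then show "x \<in> Q" using R(2) by (simp add: mem_box_cart b_def)
    qed
  qed
  with l show ?thesis by (rule that)
qed

text \<open>A cube of side \<open>l\<close> through \<open>x\<close> lies in the ball around \<open>x\<close> of radius \<open>2 * sqrt n * l\<close>.\<close>

lemma (in maximal_weight) frac_maximal_le_ball_weight:
  "ennreal_powr (frac_maximal (real CARD('n) - s / \<beta>) \<mu> x) \<beta> \<le> ennreal ((2 * real CARD('n)) ^ CARD('n)) * ball_weight \<beta> s \<mu> x"
proof (cases "ball_weight \<beta> s \<mu> x = top")
  case True
  then show ?thesis using card_ge_1 by (simp add: ennreal_mult_top)
next
  case False
  then obtain \<omega> where \<omega>: "0 \<le> \<omega>" "ball_weight \<beta> s \<mu> x = ennreal \<omega>"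
    by (cases "ball_weight \<beta> s \<mu> x") auto
  define n where "n = real CARD('n)"
  have n: "1 \<le> n" using card_ge_1 by (simp add: n_def)
  define C where "C = (2 * n) ^ CARD('n)"
  have C: "0 \<le> C" using n by (simp add: C_def)
  have *: "ennreal (l powr (n - s / \<beta>)) * (emeasure \<mu> R / emeasure lborel R) \<le> ennreal ((C * \<omega>) powr (1 / \<beta>))"
    if R: "cube_of_side l R" "x \<in> R" for l R
  proof -
    obtain a :: "real^'n" where l: "0 < l" and Ra:
      "\<And>y i. y \<in> R \<Longrightarrow> a $ i \<le> y $ i \<and> y $ i \<le> a $ i + l"
      by (rule cube_of_sideE[OF R(1)]) (rule that)
    define \<rho> where "\<rho> = 2 * sqrt n * l"
    have \<rho>: "0 < \<rho>" using l n by (simp add: \<rho>_def)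
    have "R \<subseteq> ball x \<rho>"
    proof
      fix y assume y: "y \<in> R"
      have "\<bar>(x - y) $ i\<bar> \<le> l" for i using Ra[OF y, of i] Ra[OF R(2), of i] unfolding vector_minus_component by linarith
      then have "norm (x - y) \<le> norm (\<chi> i::'n. l)" using l by (intro norm_le_componentwise_cart) auto
      also have "\<dots> = sqrt n * l" using l by (simp add: norm_vec_def L2_set_def real_sqrt_mult n_def)
      also have "\<dots> < \<rho>" using l n by (simp add: \<rho>_def)
      finally show "y \<in> ball x \<rho>" by (simp add: dist_norm)
    qed
    then have "emeasure \<mu> R \<le> emeasure \<mu> (ball x \<rho>)" using sets by (intro emeasure_mono) auto
    define m where "m = measure \<mu> (ball x \<rho>)"
    have em: "emeasure \<mu> (ball x \<rho>) = ennreal m"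
      unfolding m_def by (rule finite_measure.emeasure_eq_measure[OF fin])
    have "ennreal (m powr \<beta> * \<rho> powr (- s)) \<le> ennreal \<omega>"
      unfolding m_def \<omega>(2)[symmetric] by (rule ball_weight_upper[OF \<rho>])
    then have m\<omega>: "m powr \<beta> * \<rho> powr (- s) \<le> \<omega>" using \<omega> by simp
    have "(l powr (- (s / \<beta>)) * m) powr \<beta> = l powr (- s) * m powr \<beta>"
      using \<beta> by (simp add: powr_mult powr_powr m_def)
    also have "\<dots> = (2 * sqrt n) powr s * (m powr \<beta> * \<rho> powr (- s))"
    proof -
      define t where "t = 2 * sqrt n"
      have "0 < t" using n by (simp add: t_def)
      then have "t powr s * (t powr (- s) * l powr (- s)) = l powr (- s)" by (simp add: powr_minus)
      moreover have "\<rho> powr (- s) = t powr (- s) * l powr (- s)"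
        unfolding \<rho>_def t_def by (rule powr_mult)
      ultimately show ?thesis unfolding t_def by (simp add: mult.left_commute mult.commute)
    qed
    also have "\<dots> \<le> C * \<omega>"
    proof (intro mult_mono m\<omega>)
      have "sqrt n * 1 \<le> sqrt n * sqrt n" using n by (intro mult_left_mono) auto
      then have sq: "sqrt n \<le> n" "1 \<le> sqrt n" using n by auto
      then have sq2: "1 \<le> 2 * sqrt n" by linarith
      have "(2 * sqrt n) powr s \<le> (2 * sqrt n) powr n"
        using s sq2 by (intro powr_mono) (simp_all add: n_def)
      also have "\<dots> \<le> (2 * n) powr n" using sq n by (intro powr_mono2) auto
      also have "\<dots> = C" using n by (simp add: C_def n_def powr_realpow)
      finally show "(2 * sqrt n) powr s \<le> C" .
    qed (use C in auto)
    finally have "((l powr (- (s / \<beta>)) * m) powr \<beta>) powr (1 / \<beta>) \<le> (C * \<omega>) powr (1 / \<beta>)"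
      using \<beta> by (intro powr_mono2) auto
    then have fin: "l powr (- (s / \<beta>)) * m \<le> (C * \<omega>) powr (1 / \<beta>)"
      using \<beta> by (simp add: powr_powr m_def)
    have "ennreal (l powr (n - s / \<beta>)) * (emeasure \<mu> R / emeasure lborel R) \<le> ennreal (l powr (n - s / \<beta>)) * (ennreal m / ennreal (l ^ CARD('n)))"
      unfolding emeasure_cube_of_side[OF R(1)] em[symmetric]
      by (intro mult_left_mono divide_right_mono_ennreal) (fact, simp)
    also have "\<dots> = ennreal (l powr (n - s / \<beta>) * (m / l ^ CARD('n)))"
      using l by (simp add: divide_ennreal m_def ennreal_mult[symmetric])
    also have "l powr (n - s / \<beta>) * (m / l ^ CARD('n)) = l powr (- (s / \<beta>)) * m"
      using l by (simp add: n_def powr_diff powr_minus powr_realpow field_simps)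
    also have "ennreal \<dots> \<le> ennreal ((C * \<omega>) powr (1 / \<beta>))" by (intro ennreal_leI fin)
    finally show ?thesis .
  qed
  have "frac_maximal (n - s / \<beta>) \<mu> x \<le> ennreal ((C * \<omega>) powr (1 / \<beta>))"
    unfolding frac_maximal_def by (rule SUP_least) (auto intro: *)
  then have "ennreal_powr (frac_maximal (n - s / \<beta>) \<mu> x) \<beta> \<le> ennreal_powr (ennreal ((C * \<omega>) powr (1 / \<beta>))) \<beta>"
    using \<beta> by (intro ennreal_powr_mono)
  also have "\<dots> = ennreal (C * \<omega>)" using \<beta> C \<omega> by (simp add: ennreal_powr_ennreal powr_powr)
  finally show ?thesis using C \<omega> by (simp add: n_def C_def ennreal_mult)
qed

section \<open>Passing to Borel functions\<close>

text \<open>This settles the case in which the right-hand side of the inequality is a product of \<open>\<infinity>\<close> and \<open>0\<close>: the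
  left-hand side is then \<open>0\<close> as well.\<close>

lemma energy_zero_imp_constant:
  fixes u :: "real ^ 'n \<Rightarrow> real"
  assumes u [measurable]: "u \<in> borel_measurable borel" and Q [measurable]: "Q \<in> sets borel" and pos: "0 < emeasure lborel Q"
    and zero: "(\<integral>\<^sup>+x\<in>Q. energy_density s p u Q x \<partial>lborel) = 0"
  obtains c where "AE x in lborel. x \<in> Q \<longrightarrow> u x = c"
proof -
  have AE: "AE x in lborel. energy_density s p u Q x * indicator Q x = 0"
    using zero by (subst (asm) nn_integral_0_iff_AE) auto
  have "\<exists>x\<in>Q. energy_density s p u Q x = 0"
  proof (rule ccontr)
    assume "\<not> ?thesis"
    then have "AE x in lborel. x \<notin> Q"
      using AE by (auto elim!: AE_mp simp: indicator_def)
    then have "emeasure lborel Q = 0" by (subst (asm) AE_iff_measurable[of Q]) auto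
    then show False using pos by simp
  qed
  then obtain x where x: "x \<in> Q" "energy_density s p u Q x = 0" by blast
  have "AE y in lborel. ennreal (\<bar>u x - u y\<bar> powr p / norm (x - y) powr (real CARD('n) + s)) * indicator Q y = 0"
    using x(2) unfolding energy_density_def by (subst (asm) nn_integral_0_iff_AE) auto
  then have "AE y in lborel. y \<in> Q \<longrightarrow> u y = u x"
  proof (rule AE_mp, intro AE_I2 impI)
    fix y assume *: "ennreal (\<bar>u x - u y\<bar> powr p / norm (x - y) powr (real CARD('n) + s)) * indicator Q y = 0" and y: "y \<in> Q"
    show "u y = u x"
    proof (cases "y = x")
      case False
      have "\<bar>u x - u y\<bar> powr p / norm (x - y) powr (real CARD('n) + s) \<le> 0"
        using * y by (simp add: ennreal_eq_0_iff)
      moreover have "0 < norm (x - y) powr (real CARD('n) + s)" using False by simp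
      ultimately have "\<bar>u x - u y\<bar> powr p \<le> 0" by (simp add: divide_le_0_iff)
      then show ?thesis by simp
    qed simp
  qed
  then show ?thesis by (rule that)
qed

text \<open>All integrals in the theorem are taken with respect to the completed measure, for which products of
  measure spaces are inconvenient. Changing \<open>u\<close> on a null set and \<open>Q\<close> by a part of its boundary leads to
  Borel functions and to a half-open cube, without affecting the energy.\<close>

lemma borel_representative:
  fixes u :: "real ^ 'n \<Rightarrow> real" and Q :: "(real ^ 'n) set"
  assumes "L1_loc u" "is_cube Q"
  obtains a :: "real ^ 'n" and l u' where "0 < l" "u' \<in> borel_measurable borel"
    "AE x in lebesgue. (x \<in> Q \<longleftrightarrow> x \<in> dyadic_cube a l 0 a) \<and> (x \<in> dyadic_cube a l 0 a \<longrightarrow> u x = u' x)"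
    "\<And>\<delta> p. frac_energy \<delta> p u Q = (\<integral>\<^sup>+x\<in>dyadic_cube a l 0 a. energy_density (\<delta> * p) p u' (dyadic_cube a l 0 a) x \<partial>lborel)"
proof -
  obtain a :: "real^'n" and l where l: "0 < l" and QD: "AE x in lebesgue. x \<in> Q \<longleftrightarrow> x \<in> dyadic_cube a l 0 a"
    by (rule is_cube_AE_dyadic_cube[OF assms(2)]) (rule that)
  define D where "D = dyadic_cube a l 0 a"
  define K where "K = cbox a (a + (\<chi> i. l))"
  have [measurable]: "D \<in> sets borel" using l by (simp add: D_def)
  have DK: "D \<subseteq> K" using l by (auto simp: D_def K_def dyadic_cube_0 mem_box_cart less_imp_le)
  have "u absolutely_integrable_on K" using assms(1) by (auto simp: L1_loc_def K_def)
  then have "(\<lambda>x. indicator K x *\<^sub>R u x) \<in> borel_measurable lebesgue"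
    unfolding set_integrable_def by (rule borel_measurable_integrable)
  then obtain u' where u' [measurable]: "u' \<in> borel_measurable lborel" and "AE x in lborel. indicator K x *\<^sub>R u x = u' x"
    using completion_ex_borel_measurable_real by blast
  then have "AE x in lebesgue. indicator K x *\<^sub>R u x = u' x" by (intro AE_completion)
  with QD have AE: "AE x in lebesgue. (x \<in> Q \<longleftrightarrow> x \<in> D) \<and> (x \<in> D \<longrightarrow> u x = u' x)"
  proof eventually_elim
    case (elim x)
    then show ?case using DK by (auto simp: D_def)
  qed
  have energy: "frac_energy \<delta> p u Q = (\<integral>\<^sup>+x\<in>D. energy_density (\<delta> * p) p u' D x \<partial>lborel)" for \<delta> p
  proof -
    have inner: "(\<integral>\<^sup>+y\<in>Q. ennreal (\<bar>u x - u y\<bar> powr p / norm (x - y) powr (real CARD('n) + \<delta> * p)) \<partial>lebesgue)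
        = energy_density (\<delta> * p) p u' D x" if "x \<in> D \<longrightarrow> u x = u' x" "x \<in> D" for x
    proof -
      have "(\<integral>\<^sup>+y\<in>Q. ennreal (\<bar>u x - u y\<bar> powr p / norm (x - y) powr (real CARD('n) + \<delta> * p)) \<partial>lebesgue)
         = (\<integral>\<^sup>+y\<in>D. ennreal (\<bar>u' x - u' y\<bar> powr p / norm (x - y) powr (real CARD('n) + \<delta> * p)) \<partial>lebesgue)"
      proof (rule nn_integral_cong_AE)
        show "AE y in lebesgue. ennreal (\<bar>u x - u y\<bar> powr p / norm (x - y) powr (real CARD('n) + \<delta> * p)) * indicator Q y
            = ennreal (\<bar>u' x - u' y\<bar> powr p / norm (x - y) powr (real CARD('n) + \<delta> * p)) * indicator D y"
          using AE by eventually_elim (use that in \<open>auto simp: indicator_def\<close>)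
      qed
      also have "\<dots> = energy_density (\<delta> * p) p u' D x"
        unfolding energy_density_def by (rule nn_integral_completion) measurable
      finally show ?thesis .
    qed
    have "frac_energy \<delta> p u Q = (\<integral>\<^sup>+x\<in>D. energy_density (\<delta> * p) p u' D x \<partial>lebesgue)"
      unfolding frac_energy_def
    proof (rule nn_integral_cong_AE)
      show "AE x in lebesgue. (\<integral>\<^sup>+y\<in>Q. ennreal (\<bar>u x - u y\<bar> powr p / norm (x - y) powr (real CARD('n) + \<delta> * p)) \<partial>lebesgue) * indicator Q x
          = energy_density (\<delta> * p) p u' D x * indicator D x"
        using AE
      proof eventually_elim
        case (elim x)
        then show ?case using inner[of x] by (cases "x \<in> D") auto
      qed
    qed
    also have "\<dots> = (\<integral>\<^sup>+x\<in>D. energy_density (\<delta> * p) p u' D x \<partial>lborel)"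
      using u' by (intro nn_integral_completion)
    finally show ?thesis .
  qed
  show ?thesis
    by (rule that[OF l, of u' a]) (use u' AE energy in \<open>auto simp: D_def\<close>)
qed

section \<open>The constant\<close>

text \<open>The constant \<open>c\<^sub>n\<close>: the factors that depend on the dimension in \<open>constant_bound\<close>, multiplied together.
  Each is at least \<open>1\<close>, so the product may be raised to the power \<open>p (\<beta> + 1)\<close> instead of \<open>1\<close> or \<open>p\<close>.\<close>

definition poincare_const :: "nat \<Rightarrow> real" where
  "poincare_const n = (2 * real n) ^ n * (2 * average_const n * 2 ^ (n + 5) * real n ^ n) * (16 * 2 ^ (n + 1) * average_const n)"

lemma poincare_const_ge_1: "1 \<le> n \<Longrightarrow> 1 \<le> poincare_const n"
proof -
  assume n: "1 \<le> n"
  have K: "1 \<le> average_const n" using average_const_ge[OF n] n by linarith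
  have a: "1 \<le> (2 * real n) ^ n" "1 \<le> real n ^ n" "(1::real) \<le> 2 ^ (n + 5)" "(1::real) \<le> 2 ^ (n + 1)"
    by (rule one_le_power, use n in simp)+
  have m: "1 \<le> x * y" if "1 \<le> x" "1 \<le> y" for x y :: real
    using mult_mono[of 1 x 1 y] that by simp
  show ?thesis unfolding poincare_const_def by (intro m a K) auto
qed

lemma constant_bound:
  fixes p s \<delta> m \<beta> :: real and n :: nat
  assumes n: "1 \<le> n" and p: "1 \<le> p" and \<delta>: "0 < \<delta>" "\<delta> < 1" and s: "s = \<delta> * p" "s < real n" and m: "0 \<le> m" and \<beta>: "0 < \<beta>"
  shows "(2 * real n) ^ n * (2 * (m * (average_const n / (real n - s)) * (2 ^ (n + 5) * (p - s) * real n ^ n) *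
       (8 * p / ((real n - s) / (2 ^ (n + 1) * average_const n))) powr p)) \<le>
     m * (poincare_const n powr (\<beta> + 1) * (1 - \<delta>) powr (1 / p) * (p / (real n - s) powr (1 + 1 / p))) powr p"
proof -
  define \<epsilon> where "\<epsilon> = real n - s"
  have \<epsilon>: "0 < \<epsilon>" using s by (simp add: \<epsilon>_def)
  have K: "1 \<le> average_const n" using average_const_ge[OF n] n by linarith
  define B where "B = (2 * real n) ^ n * (2 * average_const n * 2 ^ (n + 5) * real n ^ n)"
  define D where "D = 8 * 2 ^ (n + 1) * average_const n"
  have ge: "1 \<le> x * y" if "1 \<le> x" "1 \<le> y" for x y :: real
    using mult_mono[of 1 x 1 y] that by simp
  have B: "1 \<le> B" unfolding B_def using n K
    by (intro ge one_le_power) (auto simp del: power_Suc intro!: one_le_power)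
  have D: "0 < D" using K by (simp add: D_def)
  have pc: "poincare_const n = B * 2 * D" by (simp add: poincare_const_def B_def D_def mult_ac)
  have ps: "p - s = p * (1 - \<delta>)" by (simp add: s algebra_simps)
  \<comment> \<open>The factor \<open>p\<close> of \<open>p - s = p (1 - \<delta>)\<close> has to disappear in an exponential, as the bound contains only \<open>p powr p\<close>.\<close>
  have p2: "p \<le> 2 powr p"
  proof -
    have "p / 3 \<le> p / 2 * ln 2" using p ln2_ge_two_thirds mult_left_mono[of "2/3" "ln 2" "p / 2"] by simp
    then have "1 + p / 3 \<le> exp (p / 2 * ln 2)" using exp_ge_add_one_self[of "p / 2 * ln 2"] by linarith
    then have "(1 + p / 3)\<^sup>2 \<le> (exp (p / 2 * ln 2))\<^sup>2" using p by (intro power_mono) auto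
    also have "\<dots> = 2 powr p" by (simp add: powr_def power2_eq_square exp_add[symmetric])
    finally have "(1 + p / 3)\<^sup>2 \<le> 2 powr p" .
    moreover have "p \<le> (1 + p / 3)\<^sup>2"
      using sum_squares_ge_zero[of "p / 3 - 1 / 2" 0] by (simp add: power2_eq_square algebra_simps)
    ultimately show ?thesis by linarith
  qed
  have "B * p * D powr p \<le> poincare_const n powr p"
  proof -
    have "B powr 1 \<le> B powr p" using B p by (intro powr_mono) auto
    then have "B * p \<le> B powr p * 2 powr p" using B p p2 by (intro mult_mono) auto
    then have "B * p * D powr p \<le> B powr p * 2 powr p * D powr p" by (intro mult_right_mono) auto
    also have "\<dots> = poincare_const n powr p" using B D by (simp add: pc powr_mult)
    finally show ?thesis .
  qed
  also have "poincare_const n powr p \<le> (poincare_const n powr (\<beta> + 1)) powr p"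
    using poincare_const_ge_1[OF n] \<beta> p by (simp add: powr_powr) (intro powr_mono; simp add: distrib_right)
  finally have main: "B * p * D powr p \<le> (poincare_const n powr (\<beta> + 1)) powr p" .
  have "(2 * real n) ^ n * (2 * (m * (average_const n / \<epsilon>) * (2 ^ (n + 5) * (p * (1 - \<delta>)) * real n ^ n) *
       (8 * p / (\<epsilon> / (2 ^ (n + 1) * average_const n))) powr p)) = m * (1 - \<delta>) * (B * p * D powr p) * (p powr p / \<epsilon> powr (p + 1))"
  proof -
    have *: "8 * p / (\<epsilon> / (2 ^ (n + 1) * average_const n)) = D * p / \<epsilon>" by (simp add: D_def)
    have Z: "(8 * p / (\<epsilon> / (2 ^ (n + 1) * average_const n))) powr p = D powr p * p powr p / \<epsilon> powr p"
      unfolding * by (simp add: powr_mult powr_divide)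
    show ?thesis unfolding Z using \<epsilon> by (simp add: B_def powr_add divide_inverse inverse_mult_distrib mult_ac)
  qed
  also have "\<dots> \<le> m * (1 - \<delta>) * (poincare_const n powr (\<beta> + 1)) powr p * (p powr p / \<epsilon> powr (p + 1))"
    using main m \<delta> by (intro mult_right_mono mult_left_mono) auto
  also have "\<dots> = m * (poincare_const n powr (\<beta> + 1) * (1 - \<delta>) powr (1 / p) * (p / \<epsilon> powr (1 + 1 / p))) powr p"
  proof -
    have "(\<epsilon> powr (1 + 1 / p)) powr p = \<epsilon> powr (p + 1)"
      using p by (simp add: powr_powr distrib_right)
    moreover have "((1 - \<delta>) powr (1 / p)) powr p = 1 - \<delta>" using \<delta> p by (simp add: powr_powr)
    ultimately show ?thesis
      using p \<delta> by (simp add: powr_mult powr_divide)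
  qed
  finally show ?thesis by (simp add: ps \<epsilon>_def)
qed

section \<open>The inequalities for general measures and for a point mass\<close>

definition bound_factor :: "nat \<Rightarrow> real \<Rightarrow> real \<Rightarrow> real \<Rightarrow> real" where
  "bound_factor n \<beta> \<delta> p = poincare_const n powr (\<beta> + 1) * (1 - \<delta>) powr (1 / p) * (p / (real n - \<delta> * p) powr (1 + 1 / p))"

lemma weighted_poincare_finite:
  fixes u :: "real ^ 'n \<Rightarrow> real" and \<mu> :: "(real ^ 'n) measure"
  assumes delta: "0 < \<delta>" "\<delta> < 1" and beta: "0 < \<beta>" and p: "1 \<le> p" "\<delta> * p < real CARD('n)" "\<delta> * p \<le> \<beta> * real CARD('n)"
    and mu_sets: "sets \<mu> = sets borel" and mu_fin: "emeasure \<mu> UNIV < \<infinity>" and u: "L1_loc u" and Q: "is_cube Q"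
  shows "\<exists>c. (\<integral>\<^sup>+x\<in>Q. ennreal (\<bar>u x - c\<bar> powr p) * ennreal_powr (frac_maximal (real CARD('n) - p * \<delta> / \<beta>) \<mu> x) \<beta> \<partial>lebesgue)
     \<le> ennreal (bound_factor CARD('n) \<beta> \<delta> p powr p) * ennreal_powr (emeasure \<mu> UNIV) \<beta> * frac_energy \<delta> p u Q"
proof -
  obtain a :: "real^'n" and l u' where l: "0 < l" and u' [measurable]: "u' \<in> borel_measurable borel"
    and AE: "AE x in lebesgue. (x \<in> Q \<longleftrightarrow> x \<in> dyadic_cube a l 0 a) \<and> (x \<in> dyadic_cube a l 0 a \<longrightarrow> u x = u' x)"
    and energy: "\<And>\<delta> p. frac_energy \<delta> p u Q = (\<integral>\<^sup>+x\<in>dyadic_cube a l 0 a. energy_density (\<delta> * p) p u' (dyadic_cube a l 0 a) x \<partial>lborel)"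
    by (rule borel_representative[OF u Q]) (rule that)
  define D where "D = dyadic_cube a l 0 a"
  define s where "s = \<delta> * p"
  have sp: "s < p" using delta p by (simp add: s_def)
  have space: "space \<mu> = UNIV" using sets_eq_imp_space_eq[OF mu_sets] by simp
  interpret finite_measure \<mu> by (rule finite_measureI) (use mu_fin space in auto)
  interpret maximal_weight \<mu> \<beta> s
    by standard (use mu_sets delta beta p finite_measure_axioms in \<open>auto simp: s_def\<close>)
  note [measurable] = ball_weight_measurable[OF finite_measure_axioms mu_sets beta]
  have [measurable]: "D \<in> sets borel" using l by (simp add: D_def)
  define m where "m = measure \<mu> UNIV"
  define \<sigma> where "\<sigma> = (real CARD('n) - s) / (2 ^ (CARD('n) + 1) * average_const CARD('n))"
  define A where "A = m powr \<beta> * (average_const CARD('n) / (real CARD('n) - s))"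
  interpret dyadic_weight a l s A \<sigma> "ball_weight \<beta> s \<mu>" D "density lborel (ball_weight \<beta> s \<mu>)"
    using dyadic_weight_ball_weight[OF l, of a] by (simp_all add: A_def \<sigma>_def m_def D_def)
  define C where "C = 2 * (A * (2 ^ (CARD('n) + 5) * (p - s) * real CARD('n) ^ CARD('n)) * (8 * p / \<sigma>) powr p)"
  define N where "N = (2 * real CARD('n)) ^ CARD('n)"
  have N: "0 \<le> N" by (simp add: N_def)
  obtain c where c: "(\<integral>\<^sup>+x\<in>D. ennreal (\<bar>u' x - c\<bar> powr p) * ball_weight \<beta> s \<mu> x \<partial>lborel) \<le>
     ennreal C * (\<integral>\<^sup>+x\<in>D. energy_density s p u' D x \<partial>lborel)"
    by (rule weighted_median[OF u' p(1) sp, folded C_def]) (rule that)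
  have E: "frac_energy \<delta> p u Q = (\<integral>\<^sup>+x\<in>D. energy_density s p u' D x \<partial>lborel)"
    by (simp add: energy D_def s_def)
  have "(\<integral>\<^sup>+x\<in>Q. ennreal (\<bar>u x - c\<bar> powr p) * ennreal_powr (frac_maximal (real CARD('n) - p * \<delta> / \<beta>) \<mu> x) \<beta> \<partial>lebesgue)
     \<le> (\<integral>\<^sup>+x. ennreal N * (ennreal (\<bar>u' x - c\<bar> powr p) * ball_weight \<beta> s \<mu> x * indicator D x) \<partial>lebesgue)"
  proof (rule nn_integral_mono_AE)
    show "AE x in lebesgue. ennreal (\<bar>u x - c\<bar> powr p) * ennreal_powr (frac_maximal (real CARD('n) - p * \<delta> / \<beta>) \<mu> x) \<beta> * indicator Q x
        \<le> ennreal N * (ennreal (\<bar>u' x - c\<bar> powr p) * ball_weight \<beta> s \<mu> x * indicator D x)"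
      using AE
    proof eventually_elim
      case (elim x)
      have "ennreal_powr (frac_maximal (real CARD('n) - p * \<delta> / \<beta>) \<mu> x) \<beta> \<le> ennreal N * ball_weight \<beta> s \<mu> x"
        using frac_maximal_le_ball_weight[of x] by (simp add: N_def s_def mult.commute)
      from mult_left_mono[OF this, of "ennreal (\<bar>u' x - c\<bar> powr p)"]
      show ?case using elim by (cases "x \<in> D") (auto simp: D_def mult_ac)
    qed
  qed
  also have "\<dots> = (\<integral>\<^sup>+x. ennreal N * (ennreal (\<bar>u' x - c\<bar> powr p) * ball_weight \<beta> s \<mu> x * indicator D x) \<partial>lborel)"
    by (rule nn_integral_completion) measurable
  also have "\<dots> = ennreal N * (\<integral>\<^sup>+x\<in>D. ennreal (\<bar>u' x - c\<bar> powr p) * ball_weight \<beta> s \<mu> x \<partial>lborel)"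
    by (rule nn_integral_cmult) measurable
  also have "\<dots> \<le> ennreal N * (ennreal C * frac_energy \<delta> p u Q)"
    unfolding E by (intro mult_left_mono c) auto
  also have "\<dots> = ennreal (N * C) * frac_energy \<delta> p u Q"
    using N by (simp add: ennreal_mult' mult.assoc)
  also have "\<dots> \<le> ennreal (m powr \<beta> * bound_factor CARD('n) \<beta> \<delta> p powr p) * frac_energy \<delta> p u Q"
  proof (intro mult_right_mono ennreal_leI)
    show "N * C \<le> m powr \<beta> * bound_factor CARD('n) \<beta> \<delta> p powr p"
      using constant_bound[OF card_ge_1 p(1) delta s_def, of "m powr \<beta>" \<beta>] p beta
      by (simp add: N_def C_def A_def \<sigma>_def bound_factor_def s_def)
  qed auto
  also have "ennreal (m powr \<beta> * bound_factor CARD('n) \<beta> \<delta> p powr p) = ennreal (bound_factor CARD('n) \<beta> \<delta> p powr p) * ennreal_powr (emeasure \<mu> UNIV) \<beta>"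
    by (simp add: emeasure_eq_measure ennreal_powr_ennreal m_def ennreal_mult mult.commute)
  finally show ?thesis by blast
qed

lemma zero_energy:
  fixes u :: "real ^ 'n \<Rightarrow> real"
  assumes u: "L1_loc u" and Q: "is_cube Q" and zero: "frac_energy \<delta> p u Q = 0"
  shows "\<exists>c. (\<integral>\<^sup>+x\<in>Q. ennreal (\<bar>u x - c\<bar> powr p) * W x \<partial>lebesgue) = 0"
proof -
  obtain a :: "real^'n" and l u' where l: "0 < l" and u': "u' \<in> borel_measurable borel"
    and AE: "AE x in lebesgue. (x \<in> Q \<longleftrightarrow> x \<in> dyadic_cube a l 0 a) \<and> (x \<in> dyadic_cube a l 0 a \<longrightarrow> u x = u' x)"
    and energy: "\<And>\<delta> p. frac_energy \<delta> p u Q = (\<integral>\<^sup>+x\<in>dyadic_cube a l 0 a. energy_density (\<delta> * p) p u' (dyadic_cube a l 0 a) x \<partial>lborel)"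
    by (rule borel_representative[OF u Q]) (rule that)
  obtain c where c: "AE x in lborel. x \<in> dyadic_cube a l 0 a \<longrightarrow> u' x = c"
  proof (rule energy_zero_imp_constant[OF u'])
    show "0 < emeasure lborel (dyadic_cube a l 0 a)" using l by (simp add: emeasure_dyadic_cube)
    show "(\<integral>\<^sup>+x\<in>dyadic_cube a l 0 a. energy_density (\<delta> * p) p u' (dyadic_cube a l 0 a) x \<partial>lborel) = 0"
      using zero energy by simp
  qed (use l that in auto)
  have "(\<integral>\<^sup>+x\<in>Q. ennreal (\<bar>u x - c\<bar> powr p) * W x \<partial>lebesgue) = (\<integral>\<^sup>+x. 0 \<partial>(lebesgue :: (real^'n) measure))"
  proof (rule nn_integral_cong_AE)
    show "AE x in lebesgue. ennreal (\<bar>u x - c\<bar> powr p) * W x * indicator Q x = 0"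
      using AE AE_completion[OF c] by eventually_elim (auto simp: indicator_def)
  qed
  then show ?thesis by auto
qed

text \<open>If \<open>\<mu>\<close> has infinite mass, the right-hand side is \<open>\<infinity>\<close> unless the energy vanishes, and in that case \<open>u\<close> is
  almost everywhere constant on \<open>Q\<close>.\<close>

lemma weighted_poincare:
  fixes u :: "real ^ 'n \<Rightarrow> real" and \<mu> :: "(real ^ 'n) measure"
  assumes \<delta>: "0 < \<delta>" "\<delta> < 1" and \<beta>: "0 < \<beta>" and p: "1 \<le> p" "p < real CARD('n) / \<delta> * min 1 \<beta>"
    and sets: "sets \<mu> = sets borel" and u: "L1_loc u" and Q: "is_cube Q"
  shows "(INF c. ennreal_powr (\<integral>\<^sup>+x\<in>Q. ennreal (\<bar>u x - c\<bar> powr p) * ennreal_powr (frac_maximal (real CARD('n) - p * \<delta> / \<beta>) \<mu> x) \<beta> \<partial>lebesgue) (1 / p))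
     \<le> ennreal (bound_factor CARD('n) \<beta> \<delta> p) * ennreal_powr (emeasure \<mu> UNIV) (\<beta> / p) * ennreal_powr (frac_energy \<delta> p u Q) (1 / p)"
proof -
  let ?I = "\<lambda>c. \<integral>\<^sup>+x\<in>Q. ennreal (\<bar>u x - c\<bar> powr p) * ennreal_powr (frac_maximal (real CARD('n) - p * \<delta> / \<beta>) \<mu> x) \<beta> \<partial>lebesgue"
  let ?K = "bound_factor CARD('n) \<beta> \<delta> p"
  have "\<delta> * p < real CARD('n) * min 1 \<beta>" using p(2) \<delta> by (simp add: field_simps)
  moreover have "real CARD('n) * min 1 \<beta> \<le> real CARD('n) * 1" "real CARD('n) * min 1 \<beta> \<le> real CARD('n) * \<beta>"
    by (intro mult_left_mono; simp)+
  ultimately have dp: "\<delta> * p < real CARD('n)" "\<delta> * p \<le> \<beta> * real CARD('n)"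
    unfolding mult.commute[of \<beta> "real CARD('n)"] by linarith+
  have "1 \<le> poincare_const CARD('n)" by (intro poincare_const_ge_1) (simp add: Suc_leI)
  then have K: "0 < ?K" unfolding bound_factor_def using \<delta> p dp by (intro mult_pos_pos divide_pos_pos) auto
  have "\<exists>c. ennreal_powr (?I c) (1 / p) \<le> ennreal ?K * ennreal_powr (emeasure \<mu> UNIV) (\<beta> / p) * ennreal_powr (frac_energy \<delta> p u Q) (1 / p)"
  proof (cases "frac_energy \<delta> p u Q = 0")
    case True
    from zero_energy[OF u Q this, of "\<lambda>x. ennreal_powr (frac_maximal (real CARD('n) - p * \<delta> / \<beta>) \<mu> x) \<beta>"] obtain c where "?I c = 0" by blast
    then have "ennreal_powr (?I c) (1 / p) = 0" by (simp add: ennreal_powr_def)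
    then show ?thesis by (intro exI[of _ c]) simp
  next
    case E: False
    show ?thesis
    proof (cases "emeasure \<mu> UNIV = \<infinity>")
      case True
      have "ennreal_powr (frac_energy \<delta> p u Q) (1 / p) \<noteq> 0"
        using E by (auto simp: ennreal_powr_def enn2real_eq_0_iff)
      then show ?thesis using True K by (simp add: ennreal_powr_def ennreal_mult_top ennreal_top_mult)
    next
      case False
      then have "emeasure \<mu> UNIV < \<infinity>" by (simp add: less_top)
      from weighted_poincare_finite[OF \<delta> \<beta> p(1) dp sets this u Q]
      obtain c where c: "?I c \<le> ennreal (?K powr p) * ennreal_powr (emeasure \<mu> UNIV) \<beta> * frac_energy \<delta> p u Q" by blast
      have "ennreal_powr (?I c) (1 / p) \<le> ennreal_powr (ennreal (?K powr p) * ennreal_powr (emeasure \<mu> UNIV) \<beta> * frac_energy \<delta> p u Q) (1 / p)"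
        using p by (intro ennreal_powr_mono c) auto
      also have "\<dots> = ennreal ?K * ennreal_powr (emeasure \<mu> UNIV) (\<beta> / p) * ennreal_powr (frac_energy \<delta> p u Q) (1 / p)"
        using p K \<beta> by (simp add: ennreal_powr_mult ennreal_powr_powr ennreal_powr_ennreal powr_powr)
      finally show ?thesis by blast
    qed
  qed
  then obtain c where "ennreal_powr (?I c) (1 / p) \<le> ennreal ?K * ennreal_powr (emeasure \<mu> UNIV) (\<beta> / p) * ennreal_powr (frac_energy \<delta> p u Q) (1 / p)"
    by blast
  then show ?thesis by (rule INF_lower2[OF UNIV_I])
qed

definition dirac_origin :: "(real ^ 'n) measure" where
  "dirac_origin = distr (count_space {()}) borel (\<lambda>_. 0)"

lemma sets_dirac_origin [simp]: "sets dirac_origin = sets borel"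
  by (simp add: dirac_origin_def)

lemma emeasure_dirac_origin: "S \<in> sets borel \<Longrightarrow> emeasure dirac_origin S = indicator S 0"
  by (auto simp: dirac_origin_def emeasure_distr indicator_def)

lemma frac_maximal_dirac:
  fixes x :: "real ^ 'n"
  assumes s: "0 \<le> s"
  shows "ennreal (1 / norm x powr s) \<le> frac_maximal (real CARD('n) - s) dirac_origin x"
proof (cases "x = 0")
  case False
  define r where "r = norm x"
  have r: "0 < r" using False by (simp add: r_def)
  \<comment> \<open>The corner of a cube of side \<open>|x|\<close> that contains both \<open>0\<close> and \<open>x\<close>.\<close>
  define a where "a i = (if 0 \<le> x $ i then 0 else - r)" for i
  define R where "R = {y :: real^'n. \<forall>i. y $ i \<in> {a i..a i + r}}"
  have R: "cube_of_side r R"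
    unfolding cube_of_side_def using r by (auto intro!: exI[of _ a] exI[of _ "\<lambda>i. {a i..a i + r}"] simp: R_def)
  have x: "x \<in> R" using component_le_norm_cart[of x] by (auto simp: R_def a_def r_def abs_le_iff) (smt (verit))
  have "0 \<in> R" using r by (auto simp: R_def a_def)
  moreover have "R \<in> sets borel" by (rule cube_of_sideE[OF R])
  ultimately have "emeasure dirac_origin R = 1" by (simp add: emeasure_dirac_origin)
  then have "ennreal (r powr (real CARD('n) - s)) * (emeasure dirac_origin R / emeasure lborel R) = ennreal (r powr (real CARD('n) - s)) * (1 / ennreal (r ^ CARD('n)))"
    by (simp add: emeasure_cube_of_side[OF R])
  also have "\<dots> = ennreal (r powr (real CARD('n) - s) * (1 / r ^ CARD('n)))"
    using r by (simp add: ennreal_mult divide_ennreal[symmetric] ennreal_times_divide)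
  also have "r powr (real CARD('n) - s) * (1 / r ^ CARD('n)) = 1 / r powr s"
    using r by (simp add: powr_diff powr_realpow)
  finally have "ennreal (1 / norm x powr s) = ennreal (r powr (real CARD('n) - s)) * (emeasure dirac_origin R / emeasure lborel R)"
    by (simp add: r_def)
  also have "\<dots> \<le> frac_maximal (real CARD('n) - s) dirac_origin x"
    unfolding frac_maximal_def using R x by (intro SUP_upper2[of "(r, R)"]) auto
  finally show ?thesis .
qed simp

theorem corollary2p7:
  shows "(\<exists>c>0. \<forall>(\<delta>::real) (\<beta>::real) (p::real) (\<mu>::(real ^ 'n) measure) (u::real ^ 'n \<Rightarrow> real) Q.
            0 < \<delta> \<and> \<delta> < 1 \<and> \<beta> > 0 \<and> 1 \<le> p \<and> p < real CARD('n) / \<delta> * min 1 \<beta> \<and>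
            sets \<mu> = sets borel \<and>
            (AE x in lebesgue. frac_maximal (real CARD('n) - p * \<delta> / \<beta>) \<mu> x < \<infinity>) \<and>
            L1_loc u \<and> is_cube Q \<longrightarrow>
            (INF a::real. ennreal_powr
               (\<integral>\<^sup>+x\<in>Q. ennreal (\<bar>u x - a\<bar> powr p) *
                   ennreal_powr (frac_maximal (real CARD('n) - p * \<delta> / \<beta>) \<mu> x) \<beta> \<partial>lebesgue) (1 / p))
            \<le> ennreal (c powr (\<beta> + 1) * (1 - \<delta>) powr (1 / p) *
                  (p / (real CARD('n) - \<delta> * p) powr (1 + 1 / p))) *
               ennreal_powr (emeasure \<mu> UNIV) (\<beta> / p) *
               ennreal_powr (frac_energy \<delta> p u Q) (1 / p))
       \<and> (\<exists>c>0. \<forall>(\<delta>::real) (p::real) (u::real ^ 'n \<Rightarrow> real) Q.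
            0 < \<delta> \<and> \<delta> < 1 \<and> 1 \<le> p \<and> p < real CARD('n) / \<delta> \<and> L1_loc u \<and> is_cube Q \<longrightarrow>
            (INF a::real. ennreal_powr
               (\<integral>\<^sup>+x\<in>Q. ennreal (\<bar>u x - a\<bar> powr p * (1 / norm x powr (\<delta> * p))) \<partial>lebesgue) (1 / p))
            \<le> ennreal (c * (1 - \<delta>) powr (1 / p) *
                  (p / (real CARD('n) - \<delta> * p) powr (1 + 1 / p))) *
               ennreal_powr (frac_energy \<delta> p u Q) (1 / p))"
proof (rule conjI, goal_cases)
  case 1
  have pc: "1 \<le> poincare_const CARD('n)" by (intro poincare_const_ge_1) (simp add: Suc_leI)
  show ?case
    using pc by (intro exI[of _ "poincare_const CARD('n)"] conjI allI impI)
      (linarith, (elim conjE, rule weighted_poincare[unfolded bound_factor_def]; assumption))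
next
  case 2
  have pc: "1 \<le> poincare_const CARD('n)" by (intro poincare_const_ge_1) (simp add: Suc_leI)
  show ?case
  proof (intro exI[of _ "poincare_const CARD('n) powr (1 + 1)"] conjI allI impI)
    show "0 < poincare_const CARD('n) powr (1 + 1)" using pc by simp
    fix \<delta> p :: real and u :: "real ^ 'n \<Rightarrow> real" and Q :: "(real ^ 'n) set"
    assume "0 < \<delta> \<and> \<delta> < 1 \<and> 1 \<le> p \<and> p < real CARD('n) / \<delta> \<and> L1_loc u \<and> is_cube Q"
    then have h: "0 < \<delta>" "\<delta> < 1" "1 \<le> p" "p < real CARD('n) / \<delta>" "L1_loc u" "is_cube Q" by auto
    let ?M = "\<lambda>x :: real ^ 'n. frac_maximal (real CARD('n) - p * \<delta> / 1) dirac_origin x"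
    have powr1: "ennreal_powr t 1 = t" for t
      by (cases t) (auto simp: ennreal_powr_def)
    have pt: "ennreal (1 / norm x powr (\<delta> * p)) \<le> ?M x" for x :: "real ^ 'n"
      using frac_maximal_dirac[of "\<delta> * p" x] h by (simp add: mult.commute)
    have "(INF a::real. ennreal_powr (\<integral>\<^sup>+x\<in>Q. ennreal (\<bar>u x - a\<bar> powr p * (1 / norm x powr (\<delta> * p))) \<partial>lebesgue) (1 / p))
       \<le> (INF a::real. ennreal_powr (\<integral>\<^sup>+x\<in>Q. ennreal (\<bar>u x - a\<bar> powr p) * ennreal_powr (?M x) 1 \<partial>lebesgue) (1 / p))"
    proof (intro INF_mono' ennreal_powr_mono nn_integral_mono mult_right_mono)
      fix a :: real and x :: "real ^ 'n"
      show "ennreal (\<bar>u x - a\<bar> powr p * (1 / norm x powr (\<delta> * p))) \<le> ennreal (\<bar>u x - a\<bar> powr p) * ennreal_powr (?M x) 1"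
        unfolding powr1 using mult_left_mono[OF pt[of x], of "ennreal (\<bar>u x - a\<bar> powr p)"]
        by (simp add: ennreal_mult[symmetric])
    qed (use h in auto)
    also have "\<dots> \<le> ennreal (bound_factor CARD('n) 1 \<delta> p) * ennreal_powr (emeasure (dirac_origin :: (real ^ 'n) measure) UNIV) (1 / p) * ennreal_powr (frac_energy \<delta> p u Q) (1 / p)"
      using h by (intro weighted_poincare) auto
    also have "emeasure (dirac_origin :: (real ^ 'n) measure) UNIV = 1" by (simp add: emeasure_dirac_origin)
    also have "ennreal_powr 1 (1 / p) = 1" by (simp add: ennreal_powr_def)
    finally show "(INF a::real. ennreal_powr
               (\<integral>\<^sup>+x\<in>Q. ennreal (\<bar>u x - a\<bar> powr p * (1 / norm x powr (\<delta> * p))) \<partial>lebesgue) (1 / p))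
            \<le> ennreal (poincare_const CARD('n) powr (1 + 1) * (1 - \<delta>) powr (1 / p) *
                  (p / (real CARD('n) - \<delta> * p) powr (1 + 1 / p))) *
               ennreal_powr (frac_energy \<delta> p u Q) (1 / p)"
      by (simp add: bound_factor_def)
  qed
qed

end
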